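(* Let $(\mathrm{hor}_P,F^\wedge)$ be an algebra of horizontal forms on a quantum principal $G$-bundle $P$, and let $\mathfrak{h}[\widetilde P]=\mathrm{hor}_P\otimes S(\mathbb{V})$ with coaction $H\colon\mathfrak{h}[\widetilde P]\to\mathfrak{h}[\widetilde P]\otimes\widetilde{\mathcal{A}}$ be the associated algebra of affine horizontal forms (see context). (i) Let $\lambda\colon\mathbb{V}\to\mathrm{hor}_P$ be a first-order linear map (that is, $\lambda(\mathbb{V})\subseteq\mathrm{hor}_P^1$) satisfying $$F^\wedge\lambda=(\lambda\otimes\mathrm{id})\varkappa,\qquad \lambda(\theta)\varphi=(-1)^{\partial\varphi}\sum_k\varphi_k\lambda(\theta\circ c_k)$$ for all $\theta\in\mathbb{V}$ and all homogeneous $\varphi\in\mathrm{hor}_P$, where $\sum_k\varphi_k\otimes c_k=F^\wedge(\varphi)$. Then every $F^\wedge$-covariant first-order antiderivation $D\colon\mathrm{hor}_P\to\mathrm{hor}_P$ admits a unique extension to a first-order antiderivation $D\colon\mathfrak{h}[\widetilde P]\to\mathfrak{h}[\widetilde P]$ such that $D(\theta)=\lambda(\theta)$ for each $\theta\in\mathbb{V}$. (ii) This extension is automatically $H$-covariant, i.e. $HD=(D\otimes\mathrm{id})H$. It is hermitian if and only if both $\lambda$ and the initial $D\colon\mathrm{hor}_P\to\mathrm{hor}_P$ are hermitian.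
   Context: All algebras are complex and unital; $\phi(a)=a^{(1)}\otimes a^{(2)}$ is Sweedler notation. $\mathcal{A}$ is the Hopf $*$-algebra (coproduct $\phi$, counit $\epsilon$, antipode $\kappa$) of polynomial functions on a compact matrix quantum group $G$. Affine extension of the group. $\Psi$ is a bicovariant $*$-bimodule over $\mathcal{A}$, $\mathbb{V}=\Psi_{inv}$ its $*$-invariant subspace of left-invariant elements, with right $\mathcal{A}$-comodule structure $\varkappa\colon\mathbb{V}\to\mathbb{V}\otimes\mathcal{A}$ (restriction of the right coaction) and right $\mathcal{A}$-module structure $\theta\circ a=\kappa(a^{(1)})\theta a^{(2)}$. With $\varkappa(\theta)=\sum_k\theta_k\otimes c_k$ one has $\varkappa(\theta\circ a)=\sum_k(\theta_k\circ a^{(2)})\otimes\kappa(a^{(1)})c_ka^{(3)}$, $\varkappa*=( *\otimes* )\varkappa$, $(\theta\circ a)^*=\theta^*\circ\kappa(a)^*$. These structures extend to the tensor algebra $\mathbb{V}^\otimes$ by $\varkappa(\theta\eta)=\varkappa(\theta)\varkappa(\eta)$, $(\theta\eta)^*=\eta^*\theta^*$, $(\theta\eta)\circ a=(\theta\circ a^{(1)})(\eta\circ a^{(2)})$, $1\circ a=\epsilon(a)1$. The braid operator is $\tau(\eta\otimes\theta)=\sum_k\theta_k\otimes(\eta\circ c_k)$ on $\mathbb{V}^{\otimes2}$; for $\pi\in S_n$, $\tau_\pi$ is obtained from a minimal decomposition of $\pi$ into adjacent transpositions by replacing each transposition by the corresponding $\tau$; $Y_n=\sum_{\pi\in S_n}\tau_\pi$,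 $Y=\oplus_nY_n$. $S(\mathbb{V})=\mathbb{V}^\otimes/\ker Y$ is a graded $*$-algebra to which $\varkappa,\circ$ descend. $\widetilde{\mathcal{A}}$ is the Hopf $*$-algebra generated by $\mathcal{A}$ and $S(\mathbb{V})$ with relations $\theta a=a^{(1)}(\theta\circ a^{(2)})$, multiplication giving a linear isomorphism $\mathcal{A}\otimes S(\mathbb{V})\cong\widetilde{\mathcal{A}}$, with $\phi,\epsilon,\kappa,*$ extending those of $\mathcal{A}$ and $\phi(\theta)=1\otimes\theta+\varkappa(\theta)$, $\epsilon(\theta)=0$, $\kappa(\theta)=-\sum_k\theta_k\kappa(c_k)$ for $\theta\in\mathbb{V}$. $\widehat\varkappa\colon S(\mathbb{V})\to S(\mathbb{V})\otimes\widetilde{\mathcal{A}}$ is the restriction of $\phi$. Bundle and horizontal forms. $P=(\mathcal{B},i,F)$ is a quantum principal $G$-bundle over a quantum space $M$: $\mathcal{B}$ is a $*$-algebra, $F\colon\mathcal{B}\to\mathcal{B}\otimes\mathcal{A}$ a counital coassociative $*$-homomorphism, $\mathcal{V}$ (identified via $i$) its fixed-point subalgebra, and $q\otimes b\mapsto(q\otimes1)F(b)$, $\mathcal{B}\otimes_{\mathcal{V}}\mathcal{B}\to\mathcal{B}\otimes\mathcal{A}$, is surjective (hence bijective, as is known for compact $G$). $\mathrm{hor}_P$ is a graded $*$-algebra with $\mathrm{hor}_P^0=\mathcal{B}$ (convention: $(\varphi\psi)^*=(-1)^{\partial\varphi\partial\psi}\psi^*\varphi^*$), $F^\wedge\colon\mathrm{hor}_P\to\mathrm{hor}_P\otimes\mathcal{A}$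 is a coassociative grade-preserving $*$-homomorphism extending $F$, and $\Omega_M\subseteq\mathrm{hor}_P$ is the $F^\wedge$-fixed-point subalgebra, equipped with a hermitian first-order differential $d_M$. $\mathfrak{h}[\widetilde P]=\mathrm{hor}_P\otimes S(\mathbb{V})$ is the $*$-algebra with $(\psi\otimes\theta)(\varphi\otimes\eta)=\sum_k\psi\varphi_k\otimes(\theta\circ c_k)\eta$ and $(\varphi\otimes\theta)^*=\sum_k\varphi_k^*\otimes(\theta^*\circ c_k^* )$, where $F^\wedge(\varphi)=\sum_k\varphi_k\otimes c_k$; it is graded by the horizontal degree $\partial$ (inherited from $\mathrm{hor}_P$, with $S(\mathbb{V})$ in degree $0$). $H\colon\mathfrak{h}[\widetilde P]\to\mathfrak{h}[\widetilde P]\otimes\widetilde{\mathcal{A}}$ is the $*$-homomorphism extending $F^\wedge$ and $\widehat\varkappa$. A first-order antiderivation is a linear map $D$ raising the horizontal degree by $1$ with $D(\varphi\psi)=D(\varphi)\psi+(-1)^{\partial\varphi}\varphi D(\psi)$. $F^\wedge$-covariant means $F^\wedge D=(D\otimes\mathrm{id})F^\wedge$. Hermitian means commuting with $*$: $D(\varphi^* )=D(\varphi)^*$, resp. $\lambda(\theta^* )=\lambda(\theta)^*$. *)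

theory Defs
  imports Complex_Main "HOL-Library.Poly_Mapping" "HOL-Combinatorics.Permutations"
begin

section \<open>Complex vector spaces, algebras and star-algebras\<close>

class scaleC =
  fixes scaleC :: "complex \<Rightarrow> 'a \<Rightarrow> 'a" (infixr "*\<^sub>C" 75)

class complex_vector = scaleC + ab_group_add +
  assumes scaleC_add_right: "c *\<^sub>C (x + y) = c *\<^sub>C x + c *\<^sub>C y"
    and scaleC_add_left: "(c + d) *\<^sub>C x = c *\<^sub>C x + d *\<^sub>C x"
    and scaleC_scaleC: "c *\<^sub>C d *\<^sub>C x = (c * d) *\<^sub>C x"
    and scaleC_one: "1 *\<^sub>C x = x"

text \<open>\<^class>\<open>ring_1\<close> is avoided because it excludes the zero algebra.\<close>

class complex_algebra_1 = complex_vector + ring + monoid_mult +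
  assumes mult_scaleC_left: "c *\<^sub>C x * y = c *\<^sub>C (x * y)"
    and mult_scaleC_right: "x * c *\<^sub>C y = c *\<^sub>C (x * y)"

class complex_star_vector = complex_vector +
  fixes star :: "'a \<Rightarrow> 'a"
  assumes star_add: "star (x + y) = star x + star y"
    and star_scaleC: "star (c *\<^sub>C x) = cnj c *\<^sub>C star x"
    and star_star: "star (star x) = x"

class complex_star_algebra_1 = complex_algebra_1 + complex_star_vector +
  assumes star_mult: "star (x * y) = star y * star x"

instantiation complex :: complex_star_algebra_1
begin
definition scaleC_complex :: "complex \<Rightarrow> complex \<Rightarrow> complex"
  where "scaleC_complex c x = c * x"
definition star_complex :: "complex \<Rightarrow> complex"
  where "star_complex x = cnj x"
instance
  by standard (simp_all add: scaleC_complex_def star_complex_def algebra_simps)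
end

global_interpretation complex_vector: vector_space "scaleC :: complex \<Rightarrow> 'a \<Rightarrow> 'a::complex_vector"
  defines csubspace = "complex_vector.subspace" and cspan = "complex_vector.span"
  by standard (simp_all add: scaleC_add_right scaleC_add_left scaleC_scaleC scaleC_one)

abbreviation clinear :: "('a::complex_vector \<Rightarrow> 'b::complex_vector) \<Rightarrow> bool"
  where "clinear \<equiv> Vector_Spaces.linear scaleC scaleC"

definition cbilinear :: "('a::complex_vector \<Rightarrow> 'b::complex_vector \<Rightarrow> 'c::complex_vector) \<Rightarrow> bool"
  where "cbilinear f \<longleftrightarrow> (\<forall>x. clinear (f x)) \<and> (\<forall>y. clinear (\<lambda>x. f x y))"

lemma clinear_iff:
  "clinear f \<longleftrightarrow> (\<forall>x y. f (x + y) = f x + f y) \<and> (\<forall>c x. f (c *\<^sub>C x) = c *\<^sub>C f x)"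
  by (simp add: Vector_Spaces.linear_iff complex_vector.vector_space_axioms)

definition unital_hom ::
    "('a::complex_algebra_1 \<Rightarrow> 'b::complex_algebra_1) \<Rightarrow> bool"
  where "unital_hom f \<longleftrightarrow> clinear f \<and> f 1 = 1 \<and> (\<forall>x y. f (x * y) = f x * f y)"

definition unital_star_hom ::
    "('a::{complex_algebra_1,complex_star_vector} \<Rightarrow> 'b::{complex_algebra_1,complex_star_vector}) \<Rightarrow> bool"
  where "unital_star_hom f \<longleftrightarrow> unital_hom f \<and> (\<forall>x. f (star x) = star (f x))"

definition subalgebra :: "'a::complex_algebra_1 set \<Rightarrow> bool"
  where "subalgebra S \<longleftrightarrow> csubspace S \<and> 1 \<in> S \<and> (\<forall>x\<in>S. \<forall>y\<in>S. x * y \<in> S)"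

definition generated_algebra :: "'a::complex_algebra_1 set \<Rightarrow> 'a set"
  where "generated_algebra X = \<Inter>{S. subalgebra S \<and> X \<subseteq> S}"


section \<open>Quotients of free vector spaces\<close>

instantiation poly_mapping :: (type, complex_vector) complex_vector
begin
definition scaleC_poly_mapping :: "complex \<Rightarrow> ('a \<Rightarrow>\<^sub>0 'b) \<Rightarrow> ('a \<Rightarrow>\<^sub>0 'b)"
  where "scaleC_poly_mapping c p = Poly_Mapping.map (scaleC c) p"

lemma lookup_scaleC: "Poly_Mapping.lookup (c *\<^sub>C p) k = c *\<^sub>C Poly_Mapping.lookup p k"
  unfolding scaleC_poly_mapping_def
  by transfer (simp add: when_def complex_vector.scale_zero_right)

instance
  by standard
     (simp_all add: poly_mapping_eq_iff fun_eq_iff lookup_scaleC lookup_add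
        scaleC_add_right scaleC_add_left scaleC_scaleC scaleC_one)
end

definition delta :: "'k \<Rightarrow> ('k \<Rightarrow>\<^sub>0 complex)"
  where "delta k = Poly_Mapping.single k 1"

text \<open>
  \<open>free_ext \<sigma> g\<close> extends \<open>g\<close> from basis vectors to the free vector space, linearly for
  \<open>\<sigma> = id\<close> and antilinearly for \<open>\<sigma> = cnj\<close>.
\<close>

definition free_ext :: "(complex \<Rightarrow> complex) \<Rightarrow> ('k \<Rightarrow> 'c::complex_vector) \<Rightarrow> ('k \<Rightarrow>\<^sub>0 complex) \<Rightarrow> 'c"
  where "free_ext \<sigma> g p =
    (\<Sum>k\<in>Poly_Mapping.keys p. \<sigma> (Poly_Mapping.lookup p k) *\<^sub>C g k)"

definition id_or_cnj :: "(complex \<Rightarrow> complex) \<Rightarrow> bool"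
  where "id_or_cnj \<sigma> \<longleftrightarrow> \<sigma> = id \<or> \<sigma> = cnj"

lemma id_or_cnj_simps:
  assumes "id_or_cnj \<sigma>"
  shows "\<sigma> (x + y) = \<sigma> x + \<sigma> y" "\<sigma> (x * y) = \<sigma> x * \<sigma> y" "\<sigma> 0 = 0" "\<sigma> 1 = 1"
  using assms by (auto simp: id_or_cnj_def)

lemma id_or_cnj_id [simp]: "id_or_cnj id" and id_or_cnj_cnj [simp]: "id_or_cnj cnj"
  by (auto simp: id_or_cnj_def)

lemma free_ext_superset:
  assumes "id_or_cnj \<sigma>" "finite A" "Poly_Mapping.keys p \<subseteq> A"
  shows "free_ext \<sigma> g p = (\<Sum>k\<in>A. \<sigma> (Poly_Mapping.lookup p k) *\<^sub>C g k)"
  unfolding free_ext_def using assms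
  by (intro sum.mono_neutral_left)
     (auto simp: in_keys_iff id_or_cnj_simps complex_vector.scale_zero_left)

lemma free_ext_add:
  assumes "id_or_cnj \<sigma>"
  shows "free_ext \<sigma> g (p + q) = free_ext \<sigma> g p + free_ext \<sigma> g q"
proof -
  let ?A = "Poly_Mapping.keys p \<union> Poly_Mapping.keys q"
  have "Poly_Mapping.keys (p + q) \<subseteq> ?A" by (rule keys_add)
  then show ?thesis
    using assms
    by (simp add: free_ext_superset[where A = ?A] lookup_add id_or_cnj_simps scaleC_add_left
        sum.distrib)
qed

lemma free_ext_scaleC:
  assumes "id_or_cnj \<sigma>"
  shows "free_ext \<sigma> g (c *\<^sub>C p) = \<sigma> c *\<^sub>C free_ext \<sigma> g p"
proof -
  have "Poly_Mapping.keys (c *\<^sub>C p) \<subseteq> Poly_Mapping.keys p"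
    by (auto simp: in_keys_iff lookup_scaleC complex_vector.scale_zero_right)
  then have "free_ext \<sigma> g (c *\<^sub>C p) =
      (\<Sum>k\<in>Poly_Mapping.keys p. \<sigma> (Poly_Mapping.lookup (c *\<^sub>C p) k) *\<^sub>C g k)"
    using assms by (intro free_ext_superset) auto
  then show ?thesis
    using assms by (simp add: free_ext_def lookup_scaleC scaleC_complex_def id_or_cnj_simps
        complex_vector.scale_sum_right scaleC_scaleC)
qed

lemma free_ext_diff:
  assumes "id_or_cnj \<sigma>"
  shows "free_ext \<sigma> g (p - q) = free_ext \<sigma> g p - free_ext \<sigma> g q"
  using free_ext_add[OF assms, of g "p - q" q] by simp

lemma free_ext_delta:
  assumes "id_or_cnj \<sigma>"
  shows "free_ext \<sigma> g (delta k) = g k"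
  using assms by (simp add: free_ext_def delta_def id_or_cnj_simps scaleC_one)

lemma free_ext_span:
  assumes "id_or_cnj \<sigma>" "\<And>r. r \<in> R \<Longrightarrow> free_ext \<sigma> g r = 0" "p \<in> cspan R"
  shows "free_ext \<sigma> g p = 0"
  using assms(3)
proof (induction rule: complex_vector.span_induct_alt)
  case base
  then show ?case by (simp add: free_ext_def)
next
  case (step c x y)
  then show ?case
    by (simp add: free_ext_add free_ext_scaleC assms complex_vector.scale_zero_right)
qed

lemma free_induct:
  assumes "P 0" "\<And>k. P (delta k)" "\<And>p q. P p \<Longrightarrow> P q \<Longrightarrow> P (p + q)"
    "\<And>c p. P p \<Longrightarrow> P (c *\<^sub>C p)"
  shows "P (p :: 'k \<Rightarrow>\<^sub>0 complex)"
proof (induction p rule: update_induct)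
  case const
  then show ?case by (rule assms)
next
  case (update p k c)
  have "Poly_Mapping.update k c p = p + c *\<^sub>C delta k"
    using update by (auto simp: poly_mapping_eq_iff fun_eq_iff lookup_update lookup_add lookup_scaleC
        delta_def lookup_single when_def scaleC_complex_def in_keys_iff)
  then show ?case using update assms by simp
qed


section \<open>Tensor products\<close>

definition tensor_relators :: "(('a::complex_vector \<times> 'b::complex_vector) \<Rightarrow>\<^sub>0 complex) set"
  where "tensor_relators =
      {delta (x + x', y) - delta (x, y) - delta (x', y) | x x' y. True}
    \<union> {delta (x, y + y') - delta (x, y) - delta (x, y') | x y y'. True}
    \<union> {delta (c *\<^sub>C x, y) - c *\<^sub>C delta (x, y) | c x y. True}
    \<union> {delta (x, c *\<^sub>C y) - c *\<^sub>C delta (x, y) | c x y. True}"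

lemma equivp_span: "equivp (\<lambda>p q. p - q \<in> cspan R)"
proof (rule equivpI)
  show "reflp (\<lambda>p q. p - q \<in> cspan R)"
    by (simp add: reflp_def complex_vector.span_zero)
  show "symp (\<lambda>p q. p - q \<in> cspan R)"
  proof (rule sympI)
    fix p q assume "p - q \<in> cspan R"
    from complex_vector.span_neg[OF this] show "q - p \<in> cspan R" by simp
  qed
  show "transp (\<lambda>p q. p - q \<in> cspan R)"
  proof (rule transpI)
    fix p q r assume "p - q \<in> cspan R" "q - r \<in> cspan R"
    from complex_vector.span_add[OF this] show "p - r \<in> cspan R" by simp
  qed
qed

lemma span_cong:
  assumes "p - p' \<in> cspan R"
  shows "q - q' \<in> cspan R \<Longrightarrow> p + q - (p' + q') \<in> cspan R"
    "q - q' \<in> cspan R \<Longrightarrow> p - q - (p' - q') \<in> cspan R"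
    "- p - - p' \<in> cspan R"
    "c *\<^sub>C p - c *\<^sub>C p' \<in> cspan R"
proof -
  show "p + q - (p' + q') \<in> cspan R" if "q - q' \<in> cspan R"
    using complex_vector.span_add[OF assms that] by (simp add: algebra_simps)
  show "p - q - (p' - q') \<in> cspan R" if "q - q' \<in> cspan R"
    using complex_vector.span_diff[OF assms that] by (simp add: algebra_simps)
  show "- p - - p' \<in> cspan R"
    using complex_vector.span_neg[OF assms] by simp
  show "c *\<^sub>C p - c *\<^sub>C p' \<in> cspan R"
    using complex_vector.span_scale[OF assms, of c]
    by (simp add: complex_vector.scale_right_diff_distrib)
qed

quotient_type (overloaded) ('a, 'b) tensor (infixr "\<otimes>" 21) =
  "('a::complex_vector \<times> 'b::complex_vector) \<Rightarrow>\<^sub>0 complex"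
  / "\<lambda>p q. p - q \<in> cspan tensor_relators"
  by (rule equivp_span)

instantiation tensor :: (complex_vector, complex_vector) complex_vector
begin
lift_definition zero_tensor :: "'a \<otimes> 'b" is "0" .
lift_definition plus_tensor :: "'a \<otimes> 'b \<Rightarrow> 'a \<otimes> 'b \<Rightarrow> 'a \<otimes> 'b" is "(+)"
  by (rule span_cong)
lift_definition uminus_tensor :: "'a \<otimes> 'b \<Rightarrow> 'a \<otimes> 'b" is "uminus"
  by (rule span_cong)
lift_definition minus_tensor :: "'a \<otimes> 'b \<Rightarrow> 'a \<otimes> 'b \<Rightarrow> 'a \<otimes> 'b" is "(-)"
  by (rule span_cong)
lift_definition scaleC_tensor :: "complex \<Rightarrow> 'a \<otimes> 'b \<Rightarrow> 'a \<otimes> 'b" is "scaleC"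
  by (rule span_cong)
instance
  by standard
     (transfer; simp add: algebra_simps scaleC_add_right scaleC_add_left scaleC_scaleC scaleC_one
        complex_vector.span_zero)+
end

lift_definition tensor_pure :: "'a::complex_vector \<Rightarrow> 'b::complex_vector \<Rightarrow> 'a \<otimes> 'b"
    (infixr "\<otimes>" 75)
  is "\<lambda>x y. delta (x, y)" .

lemma tensor_pure_linear:
  "(x + x') \<otimes> y = x \<otimes> y + x' \<otimes> y"
  "x \<otimes> (y + y') = x \<otimes> y + x \<otimes> y'"
  "(c *\<^sub>C x) \<otimes> y = c *\<^sub>C (x \<otimes> y)"
  "x \<otimes> (c *\<^sub>C y) = c *\<^sub>C (x \<otimes> y)"
proof -
  show "(x + x') \<otimes> y = x \<otimes> y + x' \<otimes> y"
    by transfer (unfold diff_diff_eq[symmetric] tensor_relators_def,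
      rule complex_vector.span_base, rule UnI1, rule UnI1, rule UnI1, blast)
  show "x \<otimes> (y + y') = x \<otimes> y + x \<otimes> y'"
    by transfer (unfold diff_diff_eq[symmetric] tensor_relators_def,
      rule complex_vector.span_base, rule UnI1, rule UnI1, rule UnI2, blast)
  show "(c *\<^sub>C x) \<otimes> y = c *\<^sub>C (x \<otimes> y)"
    by transfer (unfold tensor_relators_def,
      rule complex_vector.span_base, rule UnI1, rule UnI2, blast)
  show "x \<otimes> (c *\<^sub>C y) = c *\<^sub>C (x \<otimes> y)"
    by transfer (unfold tensor_relators_def,
      rule complex_vector.span_base, rule UnI2, blast)
qed

lemma tensor_induct [case_names pure add]:
  assumes "\<And>x y. P (x \<otimes> y)" "\<And>s t. P s \<Longrightarrow> P t \<Longrightarrow> P (s + t)"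
  shows "P (t :: 'a::complex_vector \<otimes> 'b::complex_vector)"
proof -
  have "P (abs_tensor p) \<and> (\<forall>c. P (c *\<^sub>C abs_tensor p))" for p :: "('a \<times> 'b) \<Rightarrow>\<^sub>0 complex"
  proof (induction p rule: free_induct)
    case 1
    have "(0::'a) \<otimes> (0::'b) = 0"
      using tensor_pure_linear(3)[of 0 "0::'a" "0::'b"]
      by (simp add: complex_vector.scale_zero_left)
    then have "P 0" using assms(1) by metis
    then show ?case
      by (simp add: zero_tensor_def[symmetric] complex_vector.scale_zero_right)
  next
    case (2 k)
    have "abs_tensor (delta k) = fst k \<otimes> snd k" by (simp add: tensor_pure.abs_eq)
    then show ?case
      using assms(1) by (simp add: tensor_pure_linear(3)[symmetric])
  next
    case (3 p q)
    then show ?case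
      by (simp add: plus_tensor.abs_eq[symmetric] scaleC_add_right assms(2))
  next
    case (4 c p)
    then show ?case
      by (simp add: scaleC_tensor.abs_eq[symmetric] scaleC_scaleC)
  qed
  from this[of "rep_tensor t"] show ?thesis
    by (simp add: Quotient_abs_rep[OF Quotient_tensor])
qed

text \<open>
  \<open>tensor_lift f\<close> is the linear map with \<open>x \<otimes> y \<mapsto> f x y\<close> induced by a bilinear map \<open>f\<close>, and
  \<open>tensor_conj_lift f\<close> the antilinear one induced by an \<open>f\<close> antilinear in each variable; for
  other \<open>f\<close> they have no meaning. Sweedler sums are written with
  them: \<open>\<Sum> f a\<^bsup>(1)\<^esup> a\<^bsup>(2)\<^esup>\<close> is \<open>tensor_lift f (\<phi> a)\<close>.
\<close>

definition tensor_ext ::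
    "(complex \<Rightarrow> complex) \<Rightarrow> ('a \<Rightarrow> 'b \<Rightarrow> 'c::complex_vector) \<Rightarrow>
      'a::complex_vector \<otimes> 'b::complex_vector \<Rightarrow> 'c"
  where "tensor_ext \<sigma> f t = free_ext \<sigma> (\<lambda>(x, y). f x y) (rep_tensor t)"

definition tensor_lift ::
    "('a \<Rightarrow> 'b \<Rightarrow> 'c::complex_vector) \<Rightarrow> 'a::complex_vector \<otimes> 'b::complex_vector \<Rightarrow> 'c"
  where "tensor_lift = tensor_ext id"

definition tensor_conj_lift ::
    "('a \<Rightarrow> 'b \<Rightarrow> 'c::complex_vector) \<Rightarrow> 'a::complex_vector \<otimes> 'b::complex_vector \<Rightarrow> 'c"
  where "tensor_conj_lift = tensor_ext cnj"

definition semilinear :: "(complex \<Rightarrow> complex) \<Rightarrow> ('a::complex_vector \<Rightarrow> 'b::complex_vector) \<Rightarrow> bool"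
  where "semilinear \<sigma> f \<longleftrightarrow>
    (\<forall>x y. f (x + y) = f x + f y) \<and> (\<forall>c x. f (c *\<^sub>C x) = \<sigma> c *\<^sub>C f x)"

definition semibilinear ::
    "(complex \<Rightarrow> complex) \<Rightarrow> ('a::complex_vector \<Rightarrow> 'b::complex_vector \<Rightarrow> 'c::complex_vector) \<Rightarrow> bool"
  where "semibilinear \<sigma> f \<longleftrightarrow> (\<forall>x. semilinear \<sigma> (f x)) \<and> (\<forall>y. semilinear \<sigma> (\<lambda>x. f x y))"

lemma clinear_semilinear: "clinear f \<longleftrightarrow> semilinear id f"
  by (simp add: clinear_iff semilinear_def)

lemma cbilinear_semibilinear: "cbilinear f \<longleftrightarrow> semibilinear id f"
  by (simp add: cbilinear_def semibilinear_def clinear_semilinear)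

lemma tensor_ext_abs:
  assumes "id_or_cnj \<sigma>" "semibilinear \<sigma> f"
  shows "tensor_ext \<sigma> f (abs_tensor p) = free_ext \<sigma> (\<lambda>(x, y). f x y) p"
proof -
  have "rep_tensor (abs_tensor p) - p \<in> cspan tensor_relators"
    by (rule Quotient_rep_abs[OF Quotient_tensor]) (simp add: complex_vector.span_zero)
  moreover have "free_ext \<sigma> (\<lambda>(x, y). f x y) r = 0" if "r \<in> tensor_relators" for r
  proof -
    have "f (x + x') y = f x y + f x' y" "f x (y + y') = f x y + f x y'"
      "f (c *\<^sub>C x) y = \<sigma> c *\<^sub>C f x y" "f x (c *\<^sub>C y) = \<sigma> c *\<^sub>C f x y" for c x x' y y'
      using assms(2) by (simp_all add: semibilinear_def semilinear_def)
    note f = this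
    show ?thesis
      using that unfolding tensor_relators_def
      by (elim UnE CollectE exE conjE)
         (simp_all add: free_ext_diff[OF assms(1)] free_ext_scaleC[OF assms(1)]
            free_ext_delta[OF assms(1)] f)
  qed
  ultimately have "free_ext \<sigma> (\<lambda>(x, y). f x y) (rep_tensor (abs_tensor p) - p) = 0"
    by (rule free_ext_span[OF assms(1), rotated])
  then show ?thesis
    by (simp add: tensor_ext_def free_ext_diff[OF assms(1)])
qed

lemma tensor_ext_pure:
  assumes "id_or_cnj \<sigma>" "semibilinear \<sigma> f"
  shows "tensor_ext \<sigma> f (x \<otimes> y) = f x y"
  using assms by (simp add: tensor_pure.abs_eq tensor_ext_abs free_ext_delta)

lemma semilinear_tensor_ext:
  assumes "id_or_cnj \<sigma>" "semibilinear \<sigma> f"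
  shows "semilinear \<sigma> (tensor_ext \<sigma> f)"
proof -
  have "tensor_ext \<sigma> f (s + t) = tensor_ext \<sigma> f s + tensor_ext \<sigma> f t" for s t
    using assms
    by (induct s rule: tensor.abs_induct, induct t rule: tensor.abs_induct)
       (simp add: plus_tensor.abs_eq tensor_ext_abs free_ext_add)
  moreover have "tensor_ext \<sigma> f (c *\<^sub>C t) = \<sigma> c *\<^sub>C tensor_ext \<sigma> f t" for c t
    using assms
    by (induct t rule: tensor.abs_induct)
       (simp add: scaleC_tensor.abs_eq tensor_ext_abs free_ext_scaleC)
  ultimately show ?thesis by (simp add: semilinear_def)
qed

lemma tensor_lift_pure: "cbilinear f \<Longrightarrow> tensor_lift f (x \<otimes> y) = f x y"
  by (simp add: tensor_lift_def tensor_ext_pure cbilinear_semibilinear)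

lemma clinear_tensor_lift: "cbilinear f \<Longrightarrow> clinear (tensor_lift f)"
  by (simp add: tensor_lift_def clinear_semilinear semilinear_tensor_ext cbilinear_semibilinear)

lemma tensor_conj_lift_pure: "semibilinear cnj f \<Longrightarrow> tensor_conj_lift f (x \<otimes> y) = f x y"
  by (simp add: tensor_conj_lift_def tensor_ext_pure)

lemma semilinear_tensor_conj_lift: "semibilinear cnj f \<Longrightarrow> semilinear cnj (tensor_conj_lift f)"
  by (simp add: tensor_conj_lift_def semilinear_tensor_ext)

definition tensor_map ::
    "('a \<Rightarrow> 'c) \<Rightarrow> ('b \<Rightarrow> 'd) \<Rightarrow>
      'a::complex_vector \<otimes> 'b::complex_vector \<Rightarrow> 'c::complex_vector \<otimes> 'd::complex_vector"
  where "tensor_map f g = tensor_lift (\<lambda>x y. f x \<otimes> g y)"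

text \<open>The tensor product of two antilinear maps.\<close>

definition tensor_conj_map ::
    "('a \<Rightarrow> 'c) \<Rightarrow> ('b \<Rightarrow> 'd) \<Rightarrow>
      'a::complex_vector \<otimes> 'b::complex_vector \<Rightarrow> 'c::complex_vector \<otimes> 'd::complex_vector"
  where "tensor_conj_map f g = tensor_conj_lift (\<lambda>x y. f x \<otimes> g y)"

text \<open>
  The product on tensors induced by bilinear \<open>f\<close>, \<open>g\<close>:
  \<open>(x \<otimes> y) \<cdot> (x' \<otimes> y') = f x x' \<otimes> g y y'\<close>.
\<close>

definition tensor_mult ::
    "('a \<Rightarrow> 'b \<Rightarrow> 'c) \<Rightarrow> ('d \<Rightarrow> 'e \<Rightarrow> 'f) \<Rightarrow>
      'a::complex_vector \<otimes> 'd::complex_vector \<Rightarrow> 'b::complex_vector \<otimes> 'e::complex_vector \<Rightarrow>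
      'c::complex_vector \<otimes> 'f::complex_vector"
  where "tensor_mult f g s t =
    tensor_lift (\<lambda>x y. tensor_lift (\<lambda>x' y'. f x x' \<otimes> g y y') t) s"

definition tensor_assoc ::
    "('a::complex_vector \<otimes> 'b::complex_vector) \<otimes> 'c::complex_vector \<Rightarrow> 'a \<otimes> 'b \<otimes> 'c"
  where "tensor_assoc = tensor_lift (\<lambda>s z. tensor_lift (\<lambda>x y. x \<otimes> y \<otimes> z) s)"

lemma cbilinear_mult: "cbilinear ((*) :: 'a::complex_algebra_1 \<Rightarrow> 'a \<Rightarrow> 'a)"
  by (simp add: cbilinear_def clinear_iff algebra_simps mult_scaleC_left mult_scaleC_right)

lemma cbilinear_pure2:
  assumes "cbilinear f" "cbilinear g"
  shows "cbilinear (\<lambda>x' y'. f x x' \<otimes> g y y')" "cbilinear (\<lambda>x y. f x x' \<otimes> g y y')"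
  using assms by (simp_all add: cbilinear_def clinear_iff tensor_pure_linear)

lemma tensor_mult_pure_left:
  assumes "cbilinear f" "cbilinear g"
  shows "cbilinear (\<lambda>x y. tensor_lift (\<lambda>x' y'. f x x' \<otimes> g y y') t)"
proof -
  have 1: "tensor_lift (\<lambda>x' y'. f x x' \<otimes> g y y') (s + t) =
      tensor_lift (\<lambda>x' y'. f x x' \<otimes> g y y') s + tensor_lift (\<lambda>x' y'. f x x' \<otimes> g y y') t" for x y s t
    using clinear_tensor_lift[OF cbilinear_pure2(1)[OF assms]] by (simp add: clinear_iff)
  show ?thesis
    unfolding cbilinear_def clinear_iff
  proof (intro allI conjI)
    show "tensor_lift (\<lambda>x' y'. f x x' \<otimes> g (y1 + y2) y') t =
        tensor_lift (\<lambda>x' y'. f x x' \<otimes> g y1 y') t + tensor_lift (\<lambda>x' y'. f x x' \<otimes> g y2 y') t"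
      for x y1 y2
      using assms by (induction t rule: tensor_induct)
        (simp_all add: 1 tensor_lift_pure cbilinear_pure2,
         simp add: cbilinear_def clinear_iff tensor_pure_linear)
    show "tensor_lift (\<lambda>x' y'. f x x' \<otimes> g (c *\<^sub>C y) y') t =
        c *\<^sub>C tensor_lift (\<lambda>x' y'. f x x' \<otimes> g y y') t" for x c y
      using assms by (induction t rule: tensor_induct)
        (simp_all add: 1 tensor_lift_pure cbilinear_pure2 scaleC_add_right,
         simp add: cbilinear_def clinear_iff tensor_pure_linear)
    show "tensor_lift (\<lambda>x' y'. f (x1 + x2) x' \<otimes> g y y') t =
        tensor_lift (\<lambda>x' y'. f x1 x' \<otimes> g y y') t + tensor_lift (\<lambda>x' y'. f x2 x' \<otimes> g y y') t"
      for x1 x2 y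
      using assms by (induction t rule: tensor_induct)
        (simp_all add: 1 tensor_lift_pure cbilinear_pure2,
         simp add: cbilinear_def clinear_iff tensor_pure_linear)
    show "tensor_lift (\<lambda>x' y'. f (c *\<^sub>C x) x' \<otimes> g y y') t =
        c *\<^sub>C tensor_lift (\<lambda>x' y'. f x x' \<otimes> g y y') t" for x c y
      using assms by (induction t rule: tensor_induct)
        (simp_all add: 1 tensor_lift_pure cbilinear_pure2 scaleC_add_right,
         simp add: cbilinear_def clinear_iff tensor_pure_linear)
  qed
qed

lemma tensor_mult_pure:
  assumes "cbilinear f" "cbilinear g"
  shows "tensor_mult f g (x \<otimes> y) (x' \<otimes> y') = f x x' \<otimes> g y y'"
  by (simp add: tensor_mult_def tensor_lift_pure tensor_mult_pure_left assms cbilinear_pure2)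

lemma cbilinear_tensor_mult:
  assumes "cbilinear f" "cbilinear g"
  shows "cbilinear (tensor_mult f g)"
proof -
  have 1: "clinear (\<lambda>s. tensor_mult f g s t)" for t
    unfolding tensor_mult_def by (rule clinear_tensor_lift[OF tensor_mult_pure_left[OF assms]])
  have 2: "tensor_mult f g (x \<otimes> y) = tensor_lift (\<lambda>x' y'. f x x' \<otimes> g y y')" for x y
    by (rule ext) (simp add: tensor_mult_def tensor_lift_pure tensor_mult_pure_left assms)
  have "tensor_mult f g s (t + t') = tensor_mult f g s t + tensor_mult f g s t'" for s t t'
  proof (induction s rule: tensor_induct)
    case (pure x y)
    then show ?case
      using clinear_tensor_lift[OF cbilinear_pure2(1)[OF assms]] by (simp add: 2 clinear_iff)
  next
    case (add s s')
    then show ?case using 1 by (simp add: clinear_iff)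
  qed
  moreover have "tensor_mult f g s (c *\<^sub>C t) = c *\<^sub>C tensor_mult f g s t" for s t c
  proof (induction s rule: tensor_induct)
    case (pure x y)
    then show ?case
      using clinear_tensor_lift[OF cbilinear_pure2(1)[OF assms]] by (simp add: 2 clinear_iff)
  next
    case (add s s')
    then show ?case using 1 by (simp add: clinear_iff scaleC_add_right)
  qed
  ultimately show ?thesis using 1 by (simp add: cbilinear_def clinear_iff)
qed

instantiation tensor :: (complex_algebra_1, complex_algebra_1) complex_algebra_1
begin
definition one_tensor :: "'a \<otimes> 'b"
  where "one_tensor = 1 \<otimes> 1"
definition times_tensor :: "'a \<otimes> 'b \<Rightarrow> 'a \<otimes> 'b \<Rightarrow> 'a \<otimes> 'b"
  where "times_tensor = tensor_mult (*) (*)"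

lemma times_tensor_linear:
  fixes s t u :: "'a \<otimes> 'b"
  shows "(s + t) * u = s * u + t * u" "s * (t + u) = s * t + s * u"
    "(c *\<^sub>C s) * t = c *\<^sub>C (s * t)" "s * (c *\<^sub>C t) = c *\<^sub>C (s * t)"
proof -
  have "cbilinear ((*) :: 'a \<otimes> 'b \<Rightarrow> 'a \<otimes> 'b \<Rightarrow> 'a \<otimes> 'b)"
    unfolding times_tensor_def by (rule cbilinear_tensor_mult[OF cbilinear_mult cbilinear_mult])
  then show "(s + t) * u = s * u + t * u" "s * (t + u) = s * t + s * u"
    "(c *\<^sub>C s) * t = c *\<^sub>C (s * t)" "s * (c *\<^sub>C t) = c *\<^sub>C (s * t)"
    by (simp_all add: cbilinear_def clinear_iff)
qed

lemma times_tensor_pure: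
  fixes x x' :: 'a and y y' :: 'b
  shows "(x \<otimes> y) * (x' \<otimes> y') = (x * x') \<otimes> (y * y')"
  by (simp add: times_tensor_def tensor_mult_pure cbilinear_mult)

instance
proof
  fix s t u :: "'a \<otimes> 'b"
  show "s * t * u = s * (t * u)"
  proof (induction s rule: tensor_induct)
    case (pure x y)
    show ?case
    proof (induction t rule: tensor_induct)
      case (pure x' y')
      show ?case
        by (induction u rule: tensor_induct) (simp_all add: times_tensor_linear times_tensor_pure mult.assoc)
    qed (simp add: times_tensor_linear)
  qed (simp add: times_tensor_linear)
  show "1 * s = s" "s * 1 = s"
    by (induction s rule: tensor_induct)
       (simp_all add: times_tensor_linear times_tensor_pure one_tensor_def)
qed (simp_all add: times_tensor_linear)
end

lemma semibilinear_star:
  "semibilinear cnj (\<lambda>(x::'a::complex_star_vector) (y::'b::complex_star_vector). star x \<otimes> star y)"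
  by (simp add: semibilinear_def semilinear_def star_add star_scaleC tensor_pure_linear)

instantiation tensor :: (complex_star_vector, complex_star_vector) complex_star_vector
begin
definition star_tensor :: "'a \<otimes> 'b \<Rightarrow> 'a \<otimes> 'b"
  where "star_tensor = tensor_conj_map star star"

lemma star_tensor_pure: "star (x \<otimes> y :: 'a \<otimes> 'b) = star x \<otimes> star y"
  by (simp add: star_tensor_def tensor_conj_map_def tensor_conj_lift_pure semibilinear_star)

instance
proof
  fix s t :: "'a \<otimes> 'b" and c
  have "semilinear cnj (star :: 'a \<otimes> 'b \<Rightarrow> 'a \<otimes> 'b)"
    unfolding star_tensor_def tensor_conj_map_def
    by (rule semilinear_tensor_conj_lift[OF semibilinear_star])
  then show a: "star (s + t) = star s + star t" and "star (c *\<^sub>C t) = cnj c *\<^sub>C star t"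
    for s t :: "'a \<otimes> 'b" and c
    by (simp_all add: semilinear_def)
  show "star (star t) = t"
    by (induction t rule: tensor_induct) (simp_all add: a star_tensor_pure star_star)
qed
end

instance tensor :: (complex_star_algebra_1, complex_star_algebra_1) complex_star_algebra_1
proof
  fix s t :: "'a \<otimes> 'b"
  show "star (s * t) = star t * star s"
  proof (induction s rule: tensor_induct)
    case (pure x y)
    show ?case
      by (induction t rule: tensor_induct)
         (simp_all add: times_tensor_linear times_tensor_pure star_tensor_pure star_add star_mult)
  qed (simp add: times_tensor_linear star_add)
qed


section \<open>The tensor algebra\<close>

definition word_relators :: "('v::complex_vector list \<Rightarrow>\<^sub>0 complex) set"
  where "word_relators =
      {delta (us @ (x + y) # vs) - delta (us @ x # vs) - delta (us @ y # vs) | us x y vs. True}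
    \<union> {delta (us @ (c *\<^sub>C x) # vs) - c *\<^sub>C delta (us @ x # vs) | us c x vs. True}"

quotient_type (overloaded) 'v tensor_algebra =
  "'v::complex_vector list \<Rightarrow>\<^sub>0 complex" / "\<lambda>p q. p - q \<in> cspan word_relators"
  by (rule equivp_span)

instantiation tensor_algebra :: (complex_vector) complex_vector
begin
lift_definition zero_tensor_algebra :: "'a tensor_algebra" is "0" .
lift_definition plus_tensor_algebra ::
  "'a tensor_algebra \<Rightarrow> 'a tensor_algebra \<Rightarrow> 'a tensor_algebra" is "(+)"
  by (rule span_cong)
lift_definition uminus_tensor_algebra :: "'a tensor_algebra \<Rightarrow> 'a tensor_algebra" is "uminus"
  by (rule span_cong)
lift_definition minus_tensor_algebra ::
  "'a tensor_algebra \<Rightarrow> 'a tensor_algebra \<Rightarrow> 'a tensor_algebra" is "(-)"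
  by (rule span_cong)
lift_definition scaleC_tensor_algebra :: "complex \<Rightarrow> 'a tensor_algebra \<Rightarrow> 'a tensor_algebra" is "scaleC"
  by (rule span_cong)
instance
  by standard
     (transfer; simp add: algebra_simps scaleC_add_right scaleC_add_left scaleC_scaleC scaleC_one
        complex_vector.span_zero)+
end

text \<open>\<open>word [x\<^sub>1, \<dots>, x\<^sub>n]\<close> is the product of the degree-one elements \<open>x\<^sub>i\<close>.\<close>

lift_definition word :: "'v::complex_vector list \<Rightarrow> 'v tensor_algebra" is "delta" .

abbreviation gen :: "'v::complex_vector \<Rightarrow> 'v tensor_algebra"
  where "gen x \<equiv> word [x]"

lemma word_linear:
  "word (us @ (x + y) # vs) = word (us @ x # vs) + word (us @ y # vs)"
  "word (us @ (c *\<^sub>C x) # vs) = c *\<^sub>C word (us @ x # vs)"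
proof -
  show "word (us @ (x + y) # vs) = word (us @ x # vs) + word (us @ y # vs)"
    by transfer (unfold diff_diff_eq[symmetric] word_relators_def,
      rule complex_vector.span_base, rule UnI1, blast)
  show "word (us @ (c *\<^sub>C x) # vs) = c *\<^sub>C word (us @ x # vs)"
    by transfer (unfold word_relators_def,
      rule complex_vector.span_base, rule UnI2, blast)
qed

lemma word_induct [case_names word add scale]:
  assumes "\<And>xs. P (word xs)" "\<And>s t. P s \<Longrightarrow> P t \<Longrightarrow> P (s + t)" "\<And>c t. P t \<Longrightarrow> P (c *\<^sub>C t)"
  shows "P (t :: 'v::complex_vector tensor_algebra)"
proof -
  have "P (abs_tensor_algebra p)" for p :: "'v list \<Rightarrow>\<^sub>0 complex"
  proof (induction p rule: free_induct)
    case 1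
    have "P (0 *\<^sub>C word [])" using assms by blast
    then show ?case
      by (simp add: zero_tensor_algebra_def[symmetric] complex_vector.scale_zero_left)
  qed (simp_all add: plus_tensor_algebra.abs_eq[symmetric] scaleC_tensor_algebra.abs_eq[symmetric]
        word.abs_eq[symmetric] assms)
  from this[of "rep_tensor_algebra t"] show ?thesis
    by (simp add: Quotient_abs_rep[OF Quotient_tensor_algebra])
qed

text \<open>
  \<open>word_lift f\<close> and \<open>word_conj_lift f\<close> are the linear, resp. antilinear, map with
  \<open>word xs \<mapsto> f xs\<close>; they are meaningful for \<open>f\<close> linear, resp. antilinear, in each letter.
\<close>

definition word_ext ::
    "(complex \<Rightarrow> complex) \<Rightarrow> ('v list \<Rightarrow> 'c::complex_vector) \<Rightarrow> 'v::complex_vector tensor_algebra \<Rightarrow> 'c"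
  where "word_ext \<sigma> f t = free_ext \<sigma> f (rep_tensor_algebra t)"

definition word_lift ::
    "('v list \<Rightarrow> 'c::complex_vector) \<Rightarrow> 'v::complex_vector tensor_algebra \<Rightarrow> 'c"
  where "word_lift = word_ext id"

definition word_conj_lift ::
    "('v list \<Rightarrow> 'c::complex_vector) \<Rightarrow> 'v::complex_vector tensor_algebra \<Rightarrow> 'c"
  where "word_conj_lift = word_ext cnj"

definition multisemilinear ::
    "(complex \<Rightarrow> complex) \<Rightarrow> ('v::complex_vector list \<Rightarrow> 'c::complex_vector) \<Rightarrow> bool"
  where "multisemilinear \<sigma> f \<longleftrightarrow> (\<forall>us vs. semilinear \<sigma> (\<lambda>x. f (us @ x # vs)))"

lemma word_ext_abs:
  assumes "id_or_cnj \<sigma>" "multisemilinear \<sigma> f"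
  shows "word_ext \<sigma> f (abs_tensor_algebra p) = free_ext \<sigma> f p"
proof -
  have "rep_tensor_algebra (abs_tensor_algebra p) - p \<in> cspan word_relators"
    by (rule Quotient_rep_abs[OF Quotient_tensor_algebra]) (simp add: complex_vector.span_zero)
  moreover have "free_ext \<sigma> f r = 0" if "r \<in> word_relators" for r
  proof -
    have "f (us @ (x + y) # vs) = f (us @ x # vs) + f (us @ y # vs)"
      "f (us @ (c *\<^sub>C x) # vs) = \<sigma> c *\<^sub>C f (us @ x # vs)" for us vs x y c
      using assms(2) by (simp_all add: multisemilinear_def semilinear_def)
    note f = this
    show ?thesis
      using that unfolding word_relators_def
      by (elim UnE CollectE exE conjE)
         (simp_all add: free_ext_diff[OF assms(1)] free_ext_scaleC[OF assms(1)]
            free_ext_delta[OF assms(1)] f)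
  qed
  ultimately have "free_ext \<sigma> f (rep_tensor_algebra (abs_tensor_algebra p) - p) = 0"
    by (rule free_ext_span[OF assms(1), rotated])
  then show ?thesis
    by (simp add: word_ext_def free_ext_diff[OF assms(1)])
qed

lemma word_ext_word:
  assumes "id_or_cnj \<sigma>" "multisemilinear \<sigma> f"
  shows "word_ext \<sigma> f (word xs) = f xs"
  using assms by (simp add: word.abs_eq word_ext_abs free_ext_delta)

lemma semilinear_word_ext:
  assumes "id_or_cnj \<sigma>" "multisemilinear \<sigma> f"
  shows "semilinear \<sigma> (word_ext \<sigma> f)"
proof -
  have "word_ext \<sigma> f (s + t) = word_ext \<sigma> f s + word_ext \<sigma> f t" for s t
    using assms
    by (induct s rule: tensor_algebra.abs_induct, induct t rule: tensor_algebra.abs_induct)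
       (simp add: plus_tensor_algebra.abs_eq word_ext_abs free_ext_add)
  moreover have "word_ext \<sigma> f (c *\<^sub>C t) = \<sigma> c *\<^sub>C word_ext \<sigma> f t" for c t
    using assms
    by (induct t rule: tensor_algebra.abs_induct)
       (simp add: scaleC_tensor_algebra.abs_eq word_ext_abs free_ext_scaleC)
  ultimately show ?thesis by (simp add: semilinear_def)
qed

lemma word_lift_word: "multisemilinear id f \<Longrightarrow> word_lift f (word xs) = f xs"
  by (simp add: word_lift_def word_ext_word)

lemma clinear_word_lift: "multisemilinear id f \<Longrightarrow> clinear (word_lift f)"
  by (simp add: word_lift_def clinear_semilinear semilinear_word_ext)

lemma word_conj_lift_word: "multisemilinear cnj f \<Longrightarrow> word_conj_lift f (word xs) = f xs"
  by (simp add: word_conj_lift_def word_ext_word)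

lemma semilinear_word_conj_lift: "multisemilinear cnj f \<Longrightarrow> semilinear cnj (word_conj_lift f)"
  by (simp add: word_conj_lift_def semilinear_word_ext)

lemma multisemilinear_append:
  "multisemilinear id (\<lambda>ys. word (xs @ ys))" "multisemilinear id (\<lambda>xs. word (xs @ ys))"
  unfolding multisemilinear_def semilinear_def
  by (auto simp: word_linear append_assoc[symmetric] simp del: append_assoc)
     (simp_all add: word_linear)

instantiation tensor_algebra :: (complex_vector) complex_algebra_1
begin
definition one_tensor_algebra :: "'a tensor_algebra"
  where "one_tensor_algebra = word []"
definition times_tensor_algebra :: "'a tensor_algebra \<Rightarrow> 'a tensor_algebra \<Rightarrow> 'a tensor_algebra"
  where "times_tensor_algebra s t = word_lift (\<lambda>xs. word_lift (\<lambda>ys. word (xs @ ys)) t) s"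

lemma multisemilinear_times:
  "multisemilinear id (\<lambda>xs. word_lift (\<lambda>ys. word (xs @ ys)) (t :: 'a tensor_algebra))"
proof -
  have 1: "clinear (word_lift (\<lambda>ys. word (xs @ ys)))" for xs :: "'a list"
    by (rule clinear_word_lift[OF multisemilinear_append(1)])
  show ?thesis
    unfolding multisemilinear_def semilinear_def
  proof (intro allI conjI)
    fix us vs :: "'a list" and x y :: 'a and c
    show "word_lift (\<lambda>ys. word ((us @ (x + y) # vs) @ ys)) t =
        word_lift (\<lambda>ys. word ((us @ x # vs) @ ys)) t + word_lift (\<lambda>ys. word ((us @ y # vs) @ ys)) t"
    proof (induction t rule: word_induct)
      case (word xs)
      then show ?case
        using word_linear(1)[of us x y "vs @ xs"]
        by (simp add: word_lift_word[OF multisemilinear_append(1)] del: append_assoc) simp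
    next
      case (add s t)
      then show ?case using 1 by (simp add: clinear_iff del: append_assoc)
    next
      case (scale c t)
      then show ?case using 1 by (simp add: clinear_iff scaleC_add_right del: append_assoc)
    qed
    show "word_lift (\<lambda>ys. word ((us @ (c *\<^sub>C x) # vs) @ ys)) t =
        id c *\<^sub>C word_lift (\<lambda>ys. word ((us @ x # vs) @ ys)) t"
    proof (induction t rule: word_induct)
      case (word xs)
      then show ?case
        using word_linear(2)[of us c x "vs @ xs"]
        by (simp add: word_lift_word[OF multisemilinear_append(1)] del: append_assoc) simp
    next
      case (add s t)
      then show ?case using 1 by (simp add: clinear_iff scaleC_add_right del: append_assoc)
    next
      case (scale d t)
      then show ?case using 1
        by (simp add: clinear_iff scaleC_scaleC mult.commute del: append_assoc)
    qed
  qed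
qed

lemma times_word: "word xs * t = word_lift (\<lambda>ys. word (xs @ ys)) (t :: 'a tensor_algebra)"
  by (simp add: times_tensor_algebra_def word_lift_word[OF multisemilinear_times])

lemma times_word_word: "word xs * word ys = (word (xs @ ys) :: 'a tensor_algebra)"
  by (simp add: times_word word_lift_word[OF multisemilinear_append(1)])

lemma times_tensor_algebra_linear_left:
  fixes s t u :: "'a tensor_algebra"
  shows "(s + t) * u = s * u + t * u" "(c *\<^sub>C s) * t = c *\<^sub>C (s * t)"
  using clinear_word_lift[OF multisemilinear_times]
  by (simp_all add: times_tensor_algebra_def clinear_iff)

lemma times_tensor_algebra_linear_right:
  fixes s t u :: "'a tensor_algebra"
  shows "s * (t + u) = s * t + s * u" "s * (c *\<^sub>C t) = c *\<^sub>C (s * t)"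
proof -
  have 1: "clinear (word_lift (\<lambda>ys. word (xs @ ys)))" for xs :: "'a list"
    by (rule clinear_word_lift[OF multisemilinear_append(1)])
  show "s * (t + u) = s * t + s * u"
    by (induction s rule: word_induct)
       (use 1 in \<open>simp_all add: times_tensor_algebra_linear_left times_word clinear_iff scaleC_add_right\<close>)
  show "s * (c *\<^sub>C t) = c *\<^sub>C (s * t)"
    by (induction s rule: word_induct)
       (use 1 in \<open>simp_all add: times_tensor_algebra_linear_left times_word clinear_iff
          scaleC_add_right scaleC_scaleC mult.commute\<close>)
qed

instance
proof
  fix s t u :: "'a tensor_algebra"
  note lin = times_tensor_algebra_linear_left times_tensor_algebra_linear_right
  show "s * t * u = s * (t * u)"
  proof (induction s rule: word_induct)
    case (word xs)
    show ?case
    proof (induction t rule: word_induct)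
      case (word ys)
      show ?case by (induction u rule: word_induct) (simp_all add: lin times_word_word)
    qed (simp_all add: lin)
  qed (simp_all add: lin)
  show "1 * s = s" "s * 1 = s"
    by (induction s rule: word_induct) (simp_all add: lin times_word_word one_tensor_algebra_def)
qed (simp_all add: times_tensor_algebra_linear_left times_tensor_algebra_linear_right)
end

lemma multisemilinear_star:
  "multisemilinear cnj (\<lambda>xs. word (rev (map star xs)) :: 'v::complex_star_vector tensor_algebra)"
  unfolding multisemilinear_def semilinear_def
  by (simp add: star_add star_scaleC word_linear)

instantiation tensor_algebra :: (complex_star_vector) complex_star_algebra_1
begin
definition star_tensor_algebra :: "'a tensor_algebra \<Rightarrow> 'a tensor_algebra"
  where "star_tensor_algebra = word_conj_lift (\<lambda>xs. word (rev (map star xs)))"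

lemma star_word: "star (word xs :: 'a tensor_algebra) = word (rev (map star xs))"
  by (simp add: star_tensor_algebra_def word_conj_lift_word multisemilinear_star)

instance
proof
  fix s t :: "'a tensor_algebra" and c
  have "semilinear cnj (star :: 'a tensor_algebra \<Rightarrow> 'a tensor_algebra)"
    unfolding star_tensor_algebra_def by (rule semilinear_word_conj_lift[OF multisemilinear_star])
  then show a: "star (s + t) = star s + star t"
    and b: "star (c *\<^sub>C t) = cnj c *\<^sub>C star t" for s t :: "'a tensor_algebra" and c
    by (simp_all add: semilinear_def)
  show "star (star t) = t"
    by (induction t rule: word_induct)
       (simp_all add: a b star_word rev_map comp_def star_star)
  show "star (s * t) = star t * star s"
  proof (induction s rule: word_induct)
    case (word xs)
    show ?case
      by (induction t rule: word_induct)
         (simp_all add: a b distrib_left distrib_right mult_scaleC_left mult_scaleC_right star_word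
            times_word_word)
  qed (simp_all add: a b distrib_left distrib_right mult_scaleC_left mult_scaleC_right)
qed
end


section \<open>Compact matrix quantum groups\<close>

locale hopf_star_algebra =
  fixes \<Delta> :: "'a::complex_star_algebra_1 \<Rightarrow> 'a \<otimes> 'a"
    and \<epsilon> :: "'a \<Rightarrow> complex"
    and \<kappa> :: "'a \<Rightarrow> 'a"
  assumes coproduct_hom: "unital_star_hom \<Delta>"
    and coassoc: "tensor_assoc (tensor_map \<Delta> id (\<Delta> a)) = tensor_map id \<Delta> (\<Delta> a)"
    and counit_hom: "unital_hom \<epsilon>"
    and counit_left: "tensor_lift (\<lambda>a\<^sub>1 a\<^sub>2. \<epsilon> a\<^sub>1 *\<^sub>C a\<^sub>2) (\<Delta> a) = a"
    and counit_right: "tensor_lift (\<lambda>a\<^sub>1 a\<^sub>2. \<epsilon> a\<^sub>2 *\<^sub>C a\<^sub>1) (\<Delta> a) = a"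
    and antipode_linear: "clinear \<kappa>"
    and antipode_left: "tensor_lift (\<lambda>a\<^sub>1 a\<^sub>2. \<kappa> a\<^sub>1 * a\<^sub>2) (\<Delta> a) = \<epsilon> a *\<^sub>C 1"
    and antipode_right: "tensor_lift (\<lambda>a\<^sub>1 a\<^sub>2. a\<^sub>1 * \<kappa> a\<^sub>2) (\<Delta> a) = \<epsilon> a *\<^sub>C 1"

text \<open>
  The polynomial functions on a compact matrix quantum group form a Hopf star-algebra generated, as
  an algebra, by the matrix coefficients of one finite-dimensional unitary corepresentation, and
  every such Hopf star-algebra arises in this way (Dijkhuizen and Koornwinder). Here \<open>u\<close> is the
  direct sum of a unitarized fundamental representation and a unitarized conjugate of it,
  so that no adjoints of its coefficients are needed as generators.
\<close>

locale compact_matrix_quantum_group = hopf_star_algebra \<Delta> \<epsilon> \<kappa>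
  for \<Delta> :: "'a::complex_star_algebra_1 \<Rightarrow> 'a \<otimes> 'a"
    and \<epsilon> :: "'a \<Rightarrow> complex"
    and \<kappa> :: "'a \<Rightarrow> 'a" +
  assumes fundamental_corepresentation:
    "\<exists>(n::nat) (u :: nat \<Rightarrow> nat \<Rightarrow> 'a).
      (\<forall>i<n. \<forall>j<n. \<Delta> (u i j) = (\<Sum>k<n. u i k \<otimes> u k j) \<and>
        \<epsilon> (u i j) = (if i = j then 1 else 0) \<and>
        (\<Sum>k<n. u i k * star (u j k)) = (if i = j then 1 else 0) \<and>
        (\<Sum>k<n. star (u k i) * u k j) = (if i = j then 1 else 0)) \<and>
      generated_algebra {u i j | i j. i < n \<and> j < n} = UNIV"


section \<open>Bicovariant star-bimodules and their left-invariant part\<close>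

locale bicovariant_star_bimodule = compact_matrix_quantum_group \<Delta> \<epsilon> \<kappa>
  for \<Delta> :: "'a::complex_star_algebra_1 \<Rightarrow> 'a \<otimes> 'a"
    and \<epsilon> :: "'a \<Rightarrow> complex"
    and \<kappa> :: "'a \<Rightarrow> 'a" +
  fixes lmul :: "'a \<Rightarrow> 'p::complex_star_vector \<Rightarrow> 'p"
    and rmul :: "'p \<Rightarrow> 'a \<Rightarrow> 'p"
    and lco :: "'p \<Rightarrow> 'a \<otimes> 'p"
    and rco :: "'p \<Rightarrow> 'p \<otimes> 'a"
  assumes lmul_bilinear: "cbilinear lmul"
    and lmul_one: "lmul 1 \<xi> = \<xi>"
    and lmul_mult: "lmul (a * b) \<xi> = lmul a (lmul b \<xi>)"
    and rmul_bilinear: "cbilinear rmul"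
    and rmul_one: "rmul \<xi> 1 = \<xi>"
    and rmul_mult: "rmul \<xi> (a * b) = rmul (rmul \<xi> a) b"
    and bimodule: "rmul (lmul a \<xi>) b = lmul a (rmul \<xi> b)"
    and lco_linear: "clinear lco"
    and lco_coassoc: "tensor_assoc (tensor_map \<Delta> id (lco \<xi>)) = tensor_map id lco (lco \<xi>)"
    and lco_counit: "tensor_lift (\<lambda>a \<eta>. \<epsilon> a *\<^sub>C \<eta>) (lco \<xi>) = \<xi>"
    and lco_lmul: "lco (lmul a \<xi>) = tensor_mult (*) lmul (\<Delta> a) (lco \<xi>)"
    and lco_rmul: "lco (rmul \<xi> a) = tensor_mult (*) rmul (lco \<xi>) (\<Delta> a)"
    and rco_linear: "clinear rco"
    and rco_coassoc: "tensor_assoc (tensor_map rco id (rco \<xi>)) = tensor_map id \<Delta> (rco \<xi>)"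
    and rco_counit: "tensor_lift (\<lambda>\<eta> a. \<epsilon> a *\<^sub>C \<eta>) (rco \<xi>) = \<xi>"
    and rco_lmul: "rco (lmul a \<xi>) = tensor_mult lmul (*) (\<Delta> a) (rco \<xi>)"
    and rco_rmul: "rco (rmul \<xi> a) = tensor_mult rmul (*) (rco \<xi>) (\<Delta> a)"
    and bicovariant: "tensor_assoc (tensor_map lco id (rco \<xi>)) = tensor_map id rco (lco \<xi>)"
    and star_lmul: "star (lmul a \<xi>) = rmul (star \<xi>) (star a)"
    and star_rmul: "star (rmul \<xi> a) = lmul (star a) (star \<xi>)"
    and lco_star: "lco (star \<xi>) = star (lco \<xi>)"
    and rco_star: "rco (star \<xi>) = star (rco \<xi>)"

text \<open>
  The space of left-invariant elements is given as a type \<open>'v\<close> with an embedding \<open>incl\<close> onto it;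
  \<open>coV\<close> is the restricted right coaction and \<open>actV \<theta> a\<close> is
  \<open>\<kappa>(a\<^bsup>(1)\<^esup>) \<theta> a\<^bsup>(2)\<^esup>\<close>.
\<close>

locale left_invariant_part = bicovariant_star_bimodule \<Delta> \<epsilon> \<kappa> lmul rmul lco rco
  for \<Delta> :: "'a::complex_star_algebra_1 \<Rightarrow> 'a \<otimes> 'a"
    and \<epsilon> :: "'a \<Rightarrow> complex"
    and \<kappa> :: "'a \<Rightarrow> 'a"
    and lmul :: "'a \<Rightarrow> 'p::complex_star_vector \<Rightarrow> 'p"
    and rmul :: "'p \<Rightarrow> 'a \<Rightarrow> 'p"
    and lco :: "'p \<Rightarrow> 'a \<otimes> 'p"
    and rco :: "'p \<Rightarrow> 'p \<otimes> 'a" +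
  fixes incl :: "'v::complex_star_vector \<Rightarrow> 'p"
    and coV :: "'v \<Rightarrow> 'v \<otimes> 'a"
    and actV :: "'v \<Rightarrow> 'a \<Rightarrow> 'v"
  assumes incl_linear: "clinear incl"
    and incl_inj: "inj incl"
    and incl_range: "range incl = {\<xi>. lco \<xi> = 1 \<otimes> \<xi>}"
    and incl_star: "incl (star \<theta>) = star (incl \<theta>)"
    and coV: "tensor_map incl id (coV \<theta>) = rco (incl \<theta>)"
    and actV: "incl (actV \<theta> a) =
      tensor_lift (\<lambda>a\<^sub>1 a\<^sub>2. rmul (lmul (\<kappa> a\<^sub>1) (incl \<theta>)) a\<^sub>2) (\<Delta> a)"


section \<open>The braided symmetric algebra\<close>

definition braid ::
    "('v \<Rightarrow> 'v \<otimes> 'a::complex_vector) \<Rightarrow> ('v \<Rightarrow> 'a \<Rightarrow> 'v) \<Rightarrow>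
      'v::complex_vector \<otimes> 'v \<Rightarrow> 'v \<otimes> 'v"
  where "braid coV actV =
    tensor_lift (\<lambda>\<eta> \<theta>. tensor_lift (\<lambda>\<theta>\<^sub>k c\<^sub>k. \<theta>\<^sub>k \<otimes> actV \<eta> c\<^sub>k) (coV \<theta>))"

text \<open>
  \<open>braid_at \<tau> i\<close> applies \<open>\<tau>\<close> to the tensor factors at the positions \<open>i\<close> and \<open>i + 1\<close>, counted from
  0; its value on shorter words is irrelevant.
\<close>

definition braid_at ::
    "('v \<otimes> 'v \<Rightarrow> 'v \<otimes> 'v) \<Rightarrow> nat \<Rightarrow> 'v::complex_vector tensor_algebra \<Rightarrow> 'v tensor_algebra"
  where "braid_at \<tau> i = word_lift (\<lambda>xs.
    if Suc i < length xs
    then word (take i xs) * tensor_lift (\<lambda>x y. word [x, y]) (\<tau> (xs ! i \<otimes> xs ! Suc i)) *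
      word (drop (i + 2) xs)
    else word xs)"

text \<open>
  A decomposition \<open>[i\<^sub>1, \<dots>, i\<^sub>l]\<close> stands for \<open>s\<^bsub>i\<^sub>1\<^esub> \<circ> \<dots> \<circ> s\<^bsub>i\<^sub>l\<^esub>\<close>; one of minimal
  length is chosen, the operator built from it being independent of the choice by the braid equation.
\<close>

definition minimal_decomposition :: "nat \<Rightarrow> (nat \<Rightarrow> nat) \<Rightarrow> nat list"
  where "minimal_decomposition n \<pi> = arg_min length
    (\<lambda>is. (\<forall>i\<in>set is. Suc i < n) \<and> foldr (\<lambda>i \<rho>. transpose i (Suc i) \<circ> \<rho>) is id = \<pi>)"

definition braid_perm ::
    "('v \<otimes> 'v \<Rightarrow> 'v \<otimes> 'v) \<Rightarrow> nat \<Rightarrow> (nat \<Rightarrow> nat) \<Rightarrow>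
      'v::complex_vector tensor_algebra \<Rightarrow> 'v tensor_algebra"
  where "braid_perm \<tau> n \<pi> = foldr (\<lambda>i f. braid_at \<tau> i \<circ> f) (minimal_decomposition n \<pi>) id"

text \<open>On words of length \<open>n\<close> this is \<open>Y\<^sub>n = \<Sum>\<^bsub>\<pi> \<in> S\<^sub>n\<^esub> \<tau>\<^sub>\<pi>\<close>, with \<open>S\<^sub>n\<close> acting on \<open>{0, \<dots>, n - 1}\<close>.\<close>

definition braided_symmetrizer ::
    "('v \<otimes> 'v \<Rightarrow> 'v \<otimes> 'v) \<Rightarrow> 'v::complex_vector tensor_algebra \<Rightarrow> 'v tensor_algebra"
  where "braided_symmetrizer \<tau> = word_lift (\<lambda>xs.
    \<Sum>\<pi> | \<pi> permutes {..<length xs}. braid_perm \<tau> (length xs) \<pi> (word xs))"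

definition coT ::
    "('v \<Rightarrow> 'v \<otimes> 'a) \<Rightarrow> 'v::complex_vector tensor_algebra \<Rightarrow> 'v tensor_algebra \<otimes> 'a::complex_algebra_1"
  where "coT coV = word_lift (\<lambda>xs. prod_list (map (\<lambda>x. tensor_map gen id (coV x)) xs))"

primrec act_word ::
    "('a \<Rightarrow> 'a \<otimes> 'a) \<Rightarrow> ('a \<Rightarrow> complex) \<Rightarrow> ('v \<Rightarrow> 'a \<Rightarrow> 'v) \<Rightarrow>
      'v::complex_vector list \<Rightarrow> 'a::complex_vector \<Rightarrow> 'v tensor_algebra"
  where
    "act_word \<Delta> \<epsilon> actV [] a = \<epsilon> a *\<^sub>C 1"
  | "act_word \<Delta> \<epsilon> actV (x # xs) a =
      tensor_lift (\<lambda>a\<^sub>1 a\<^sub>2. gen (actV x a\<^sub>1) * act_word \<Delta> \<epsilon> actV xs a\<^sub>2) (\<Delta> a)"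

definition actT ::
    "('a \<Rightarrow> 'a \<otimes> 'a) \<Rightarrow> ('a \<Rightarrow> complex) \<Rightarrow> ('v \<Rightarrow> 'a \<Rightarrow> 'v) \<Rightarrow>
      'v::complex_vector tensor_algebra \<Rightarrow> 'a::complex_vector \<Rightarrow> 'v tensor_algebra"
  where "actT \<Delta> \<epsilon> actV t a = word_lift (\<lambda>xs. act_word \<Delta> \<epsilon> actV xs a) t"

text \<open>
  The quotient of the tensor algebra by the kernel of the symmetrizer is a type \<open>'s\<close> with a
  surjective homomorphism \<open>proj\<close> having that kernel; \<open>coS\<close> and \<open>actS\<close> are the descended coaction
  and action.
\<close>

locale braided_symmetric_algebra =
  left_invariant_part \<Delta> \<epsilon> \<kappa> lmul rmul lco rco incl coV actV
  for \<Delta> :: "'a::complex_star_algebra_1 \<Rightarrow> 'a \<otimes> 'a"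
    and \<epsilon> :: "'a \<Rightarrow> complex"
    and \<kappa> :: "'a \<Rightarrow> 'a"
    and lmul :: "'a \<Rightarrow> 'p::complex_star_vector \<Rightarrow> 'p"
    and rmul :: "'p \<Rightarrow> 'a \<Rightarrow> 'p"
    and lco :: "'p \<Rightarrow> 'a \<otimes> 'p"
    and rco :: "'p \<Rightarrow> 'p \<otimes> 'a"
    and incl :: "'v::complex_star_vector \<Rightarrow> 'p"
    and coV :: "'v \<Rightarrow> 'v \<otimes> 'a"
    and actV :: "'v \<Rightarrow> 'a \<Rightarrow> 'v" +
  fixes proj :: "'v tensor_algebra \<Rightarrow> 's::complex_star_algebra_1"
    and coS :: "'s \<Rightarrow> 's \<otimes> 'a"
    and actS :: "'s \<Rightarrow> 'a \<Rightarrow> 's"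
  assumes proj_hom: "unital_star_hom proj"
    and proj_surj: "surj proj"
    and proj_kernel: "{t. proj t = 0} = {t. braided_symmetrizer (braid coV actV) t = 0}"
    and coS: "coS (proj t) = tensor_map proj id (coT coV t)"
    and actS: "actS (proj t) a = proj (actT \<Delta> \<epsilon> actV t a)"


section \<open>The affine extension of the quantum group\<close>

text \<open>
  \<open>inA\<close> and \<open>inS\<close> are the inclusions of the two generating subalgebras, and \<open>hatS\<close> is the
  restriction of the coproduct to the second one.
\<close>

locale affine_extension =
  braided_symmetric_algebra \<Delta> \<epsilon> \<kappa> lmul rmul lco rco incl coV actV proj coS actS +
  affine: hopf_star_algebra \<Delta>' \<epsilon>' \<kappa>'
  for \<Delta> :: "'a::complex_star_algebra_1 \<Rightarrow> 'a \<otimes> 'a"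
    and \<epsilon> :: "'a \<Rightarrow> complex"
    and \<kappa> :: "'a \<Rightarrow> 'a"
    and lmul :: "'a \<Rightarrow> 'p::complex_star_vector \<Rightarrow> 'p"
    and rmul :: "'p \<Rightarrow> 'a \<Rightarrow> 'p"
    and lco :: "'p \<Rightarrow> 'a \<otimes> 'p"
    and rco :: "'p \<Rightarrow> 'p \<otimes> 'a"
    and incl :: "'v::complex_star_vector \<Rightarrow> 'p"
    and coV :: "'v \<Rightarrow> 'v \<otimes> 'a"
    and actV :: "'v \<Rightarrow> 'a \<Rightarrow> 'v"
    and proj :: "'v tensor_algebra \<Rightarrow> 's::complex_star_algebra_1"
    and coS :: "'s \<Rightarrow> 's \<otimes> 'a"
    and actS :: "'s \<Rightarrow> 'a \<Rightarrow> 's"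
    and \<Delta>' :: "'t::complex_star_algebra_1 \<Rightarrow> 't \<otimes> 't"
    and \<epsilon>' :: "'t \<Rightarrow> complex"
    and \<kappa>' :: "'t \<Rightarrow> 't" +
  fixes inA :: "'a \<Rightarrow> 't"
    and inS :: "'s \<Rightarrow> 't"
    and hatS :: "'s \<Rightarrow> 's \<otimes> 't"
  assumes inA_hom: "unital_star_hom inA"
    and inS_hom: "unital_star_hom inS"
    and cross_relation: "inS (proj (gen \<theta>)) * inA a =
      tensor_lift (\<lambda>a\<^sub>1 a\<^sub>2. inA a\<^sub>1 * inS (proj (gen (actV \<theta> a\<^sub>2)))) (\<Delta> a)"
    and multiplication_bij: "bij (tensor_lift (\<lambda>a s. inA a * inS s))"
    and coproduct_inA: "\<Delta>' (inA a) = tensor_map inA inA (\<Delta> a)"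
    and counit_inA: "\<epsilon>' (inA a) = \<epsilon> a"
    and antipode_inA: "\<kappa>' (inA a) = inA (\<kappa> a)"
    and coproduct_gen: "\<Delta>' (inS (proj (gen \<theta>))) =
      1 \<otimes> inS (proj (gen \<theta>)) + tensor_map (\<lambda>\<eta>. inS (proj (gen \<eta>))) inA (coV \<theta>)"
    and counit_gen: "\<epsilon>' (inS (proj (gen \<theta>))) = 0"
    and antipode_gen: "\<kappa>' (inS (proj (gen \<theta>))) =
      - tensor_lift (\<lambda>\<theta>\<^sub>k c\<^sub>k. inS (proj (gen \<theta>\<^sub>k)) * inA (\<kappa> c\<^sub>k)) (coV \<theta>)"
    and hatS: "tensor_map inS id (hatS s) = \<Delta>' (inS s)"


section \<open>Quantum principal bundles and horizontal forms\<close>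

definition fixed_points ::
    "('b::complex_vector \<Rightarrow> 'b \<otimes> 'a::complex_algebra_1) \<Rightarrow> 'b set"
  where "fixed_points F = {b. F b = b \<otimes> 1}"

text \<open>
  The canonical map \<open>q \<otimes> b \<mapsto> (q \<otimes> 1) F(b)\<close> on the tensor product over the base algebra
  (the fixed points of \<open>F\<close>) is induced by the same formula on the tensor product over the
  complex numbers, so both have the same image.
\<close>

locale quantum_principal_bundle = compact_matrix_quantum_group \<Delta> \<epsilon> \<kappa>
  for \<Delta> :: "'a::complex_star_algebra_1 \<Rightarrow> 'a \<otimes> 'a"
    and \<epsilon> :: "'a \<Rightarrow> complex"
    and \<kappa> :: "'a \<Rightarrow> 'a" +
  fixes F :: "'b::complex_star_algebra_1 \<Rightarrow> 'b \<otimes> 'a"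
  assumes F_hom: "unital_star_hom F"
    and F_coassoc: "tensor_assoc (tensor_map F id (F b)) = tensor_map id \<Delta> (F b)"
    and F_counit: "tensor_lift (\<lambda>b a. \<epsilon> a *\<^sub>C b) (F b) = b"
    and free_action: "surj (tensor_lift (\<lambda>q b. (q \<otimes> 1) * F b))"

definition graded_decomposition :: "(nat \<Rightarrow> 'h::complex_vector set) \<Rightarrow> bool"
  where "graded_decomposition gr \<longleftrightarrow> (\<forall>n. csubspace (gr n)) \<and>
    (\<forall>x. \<exists>!f. (\<forall>n. f n \<in> gr n) \<and> finite {n. f n \<noteq> 0} \<and> x = (\<Sum>n | f n \<noteq> 0. f n))"

text \<open>
  The algebra of horizontal forms is a star-vector space whose star obeys the graded rule
  \<open>star_hor\<close>. \<open>inB\<close> identifies the algebra of the bundle with the degree-zero part,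
  and \<open>dM\<close> is relevant on the \<open>Fh\<close>-fixed points only. The counit law for \<open>Fh\<close> is what
  makes \<open>1 \<otimes> 1\<close> a left unit of the affine horizontal forms.
\<close>

locale horizontal_forms = quantum_principal_bundle \<Delta> \<epsilon> \<kappa> F
  for \<Delta> :: "'a::complex_star_algebra_1 \<Rightarrow> 'a \<otimes> 'a"
    and \<epsilon> :: "'a \<Rightarrow> complex"
    and \<kappa> :: "'a \<Rightarrow> 'a"
    and F :: "'b::complex_star_algebra_1 \<Rightarrow> 'b \<otimes> 'a" +
  fixes inB :: "'b \<Rightarrow> 'h::{complex_algebra_1,complex_star_vector}"
    and hor :: "nat \<Rightarrow> 'h set"
    and Fh :: "'h \<Rightarrow> 'h \<otimes> 'a"
    and dM :: "'h \<Rightarrow> 'h"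
  assumes hor_graded: "graded_decomposition hor"
    and hor_mult: "\<lbrakk>\<phi> \<in> hor m; \<psi> \<in> hor n\<rbrakk> \<Longrightarrow> \<phi> * \<psi> \<in> hor (m + n)"
    and hor_star: "\<phi> \<in> hor m \<Longrightarrow> star \<phi> \<in> hor m"
    and star_hor: "\<lbrakk>\<phi> \<in> hor m; \<psi> \<in> hor n\<rbrakk> \<Longrightarrow>
      star (\<phi> * \<psi>) = (- 1) ^ (m * n) *\<^sub>C (star \<psi> * star \<phi>)"
    and inB_hom: "unital_star_hom inB"
    and inB_inj: "inj inB"
    and inB_range: "range inB = hor 0"
    and Fh_hom: "unital_star_hom Fh"
    and Fh_coassoc: "tensor_assoc (tensor_map Fh id (Fh \<phi>)) = tensor_map id \<Delta> (Fh \<phi>)"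
    and Fh_counit: "tensor_lift (\<lambda>\<psi> a. \<epsilon> a *\<^sub>C \<psi>) (Fh \<phi>) = \<phi>"
    and Fh_graded: "\<phi> \<in> hor n \<Longrightarrow> Fh \<phi> \<in> cspan {\<psi> \<otimes> a | \<psi> a. \<psi> \<in> hor n}"
    and Fh_inB: "Fh (inB b) = tensor_map inB id (F b)"
    and dM_degree: "\<phi> \<in> fixed_points Fh \<inter> hor n \<Longrightarrow> dM \<phi> \<in> fixed_points Fh \<inter> hor (Suc n)"
    and dM_add: "\<lbrakk>\<phi> \<in> fixed_points Fh; \<psi> \<in> fixed_points Fh\<rbrakk> \<Longrightarrow> dM (\<phi> + \<psi>) = dM \<phi> + dM \<psi>"
    and dM_scaleC: "\<phi> \<in> fixed_points Fh \<Longrightarrow> dM (c *\<^sub>C \<phi>) = c *\<^sub>C dM \<phi>"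
    and dM_mult: "\<lbrakk>\<phi> \<in> fixed_points Fh \<inter> hor n; \<psi> \<in> fixed_points Fh\<rbrakk> \<Longrightarrow>
      dM (\<phi> * \<psi>) = dM \<phi> * \<psi> + (- 1) ^ n *\<^sub>C (\<phi> * dM \<psi>)"
    and dM_square: "\<phi> \<in> fixed_points Fh \<Longrightarrow> dM (dM \<phi>) = 0"
    and dM_star: "\<phi> \<in> fixed_points Fh \<Longrightarrow> dM (star \<phi>) = star (dM \<phi>)"

definition first_order_antiderivation ::
    "('x \<Rightarrow> 'x \<Rightarrow> 'x) \<Rightarrow> (nat \<Rightarrow> 'x set) \<Rightarrow> ('x::complex_vector \<Rightarrow> 'x) \<Rightarrow> bool"
  where "first_order_antiderivation mul gr D \<longleftrightarrow> clinear D \<and>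
    (\<forall>n. \<forall>x\<in>gr n. D x \<in> gr (Suc n)) \<and>
    (\<forall>n. \<forall>x\<in>gr n. \<forall>y. D (mul x y) = mul (D x) y + (- 1) ^ n *\<^sub>C mul x (D y))"


section \<open>Affine horizontal forms\<close>

text \<open>
  The algebra of affine horizontal forms is the vector space \<open>'h \<otimes> 's\<close> with the twisted
  product \<open>aff_mult\<close> and star \<open>aff_star\<close>; the tensor product algebra structure of \<open>'h \<otimes> 's\<close>
  plays no role.
\<close>

definition aff_mult ::
    "('h \<Rightarrow> 'h \<otimes> 'a::complex_vector) \<Rightarrow> ('s \<Rightarrow> 'a \<Rightarrow> 's) \<Rightarrow>
      'h::complex_algebra_1 \<otimes> 's::complex_algebra_1 \<Rightarrow> 'h \<otimes> 's \<Rightarrow> 'h \<otimes> 's"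
  where "aff_mult Fh actS x y =
    tensor_lift (\<lambda>\<psi> \<theta>. tensor_lift (\<lambda>\<phi> \<eta>.
      tensor_lift (\<lambda>\<phi>\<^sub>k c\<^sub>k. (\<psi> * \<phi>\<^sub>k) \<otimes> (actS \<theta> c\<^sub>k * \<eta>)) (Fh \<phi>)) y) x"

definition aff_star ::
    "('h \<Rightarrow> 'h \<otimes> 'a::complex_star_vector) \<Rightarrow> ('s \<Rightarrow> 'a \<Rightarrow> 's) \<Rightarrow>
      'h::complex_star_vector \<otimes> 's::complex_star_vector \<Rightarrow> 'h \<otimes> 's"
  where "aff_star Fh actS =
    tensor_conj_lift (\<lambda>\<phi> \<theta>.
      tensor_conj_lift (\<lambda>\<phi>\<^sub>k c\<^sub>k. star \<phi>\<^sub>k \<otimes> actS (star \<theta>) (star c\<^sub>k)) (Fh \<phi>))"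

definition aff_grade ::
    "(nat \<Rightarrow> 'h set) \<Rightarrow> nat \<Rightarrow> ('h::complex_vector \<otimes> 's::complex_vector) set"
  where "aff_grade hor n = cspan {\<phi> \<otimes> \<theta> | \<phi> \<theta>. \<phi> \<in> hor n}"

locale affine_horizontal_forms =
  affine_extension \<Delta> \<epsilon> \<kappa> lmul rmul lco rco incl coV actV proj coS actS \<Delta>' \<epsilon>' \<kappa>' inA inS hatS +
  horizontal_forms \<Delta> \<epsilon> \<kappa> F inB hor Fh dM
  for \<Delta> :: "'a::complex_star_algebra_1 \<Rightarrow> 'a \<otimes> 'a"
    and \<epsilon> :: "'a \<Rightarrow> complex"
    and \<kappa> :: "'a \<Rightarrow> 'a"
    and lmul :: "'a \<Rightarrow> 'p::complex_star_vector \<Rightarrow> 'p"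
    and rmul :: "'p \<Rightarrow> 'a \<Rightarrow> 'p"
    and lco :: "'p \<Rightarrow> 'a \<otimes> 'p"
    and rco :: "'p \<Rightarrow> 'p \<otimes> 'a"
    and incl :: "'v::complex_star_vector \<Rightarrow> 'p"
    and coV :: "'v \<Rightarrow> 'v \<otimes> 'a"
    and actV :: "'v \<Rightarrow> 'a \<Rightarrow> 'v"
    and proj :: "'v tensor_algebra \<Rightarrow> 's::complex_star_algebra_1"
    and coS :: "'s \<Rightarrow> 's \<otimes> 'a"
    and actS :: "'s \<Rightarrow> 'a \<Rightarrow> 's"
    and \<Delta>' :: "'t::complex_star_algebra_1 \<Rightarrow> 't \<otimes> 't"
    and \<epsilon>' :: "'t \<Rightarrow> complex"
    and \<kappa>' :: "'t \<Rightarrow> 't"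
    and inA :: "'a \<Rightarrow> 't"
    and inS :: "'s \<Rightarrow> 't"
    and hatS :: "'s \<Rightarrow> 's \<otimes> 't"
    and F :: "'b::complex_star_algebra_1 \<Rightarrow> 'b \<otimes> 'a"
    and inB :: "'b \<Rightarrow> 'h::{complex_algebra_1,complex_star_vector}"
    and hor :: "nat \<Rightarrow> 'h set"
    and Fh :: "'h \<Rightarrow> 'h \<otimes> 'a"
    and dM :: "'h \<Rightarrow> 'h" +
  fixes H :: "('h \<otimes> 's) \<Rightarrow> ('h \<otimes> 's) \<otimes> 't"
  assumes H_linear: "clinear H"
    and H_mult: "H (aff_mult Fh actS x y) = tensor_mult (aff_mult Fh actS) (*) (H x) (H y)"
    and H_star: "H (aff_star Fh actS x) = tensor_conj_map (aff_star Fh actS) star (H x)"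
    and H_hor: "H (\<phi> \<otimes> 1) = tensor_map (\<lambda>\<psi>. \<psi> \<otimes> 1) inA (Fh \<phi>)"
    and H_sym: "H (1 \<otimes> s) = tensor_map (\<lambda>r. 1 \<otimes> r) id (hatS s)"

definition extends_antiderivation ::
    "('h::complex_algebra_1 \<Rightarrow> 'h \<otimes> 'a::complex_vector) \<Rightarrow> ('s::complex_algebra_1 \<Rightarrow> 'a \<Rightarrow> 's) \<Rightarrow>
      (nat \<Rightarrow> 'h set) \<Rightarrow> ('v::complex_vector tensor_algebra \<Rightarrow> 's) \<Rightarrow>
      ('v \<Rightarrow> 'h) \<Rightarrow> ('h \<Rightarrow> 'h) \<Rightarrow> ('h \<otimes> 's \<Rightarrow> 'h \<otimes> 's) \<Rightarrow> bool"
  where "extends_antiderivation Fh actS hor proj lam D D' \<longleftrightarrow>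
    first_order_antiderivation (aff_mult Fh actS) (aff_grade hor) D' \<and>
    (\<forall>\<phi>. D' (\<phi> \<otimes> 1) = D \<phi> \<otimes> 1) \<and>
    (\<forall>\<theta>. D' (1 \<otimes> proj (gen \<theta>)) = lam \<theta> \<otimes> 1)"

end

theory Submission
  imports Defs
begin

text \<open>
  The map \<open>\<phi> \<otimes> \<theta> \<mapsto> F\<^sup>\<and>(\<phi>) (1 \<otimes> \<theta>)\<close> identifies the affine horizontal forms with a star-subalgebra of
  the ordinary tensor product of the horizontal forms with the algebra of the affine quantum group.
  There the extension is \<open>D \<otimes> id\<close> plus the antiderivation that kills the horizontal forms and sends
  \<open>s\<close> to \<open>(\<lambda> p \<otimes> id) \<Delta>(s)\<close>, where \<open>\<Delta>\<close> is the coproduct of the affine quantum group and \<open>p\<close> projects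
  the braided symmetric algebra onto its degree-one part. This projection exists because the
  symmetrizer does not change the degree-one part; no further braid combinatorics is needed, since the
  existence of the coproduct encodes it. Uniqueness and covariance are checked on
  generators, and hermiticity follows because the embedding and the coproduct respect the star.
\<close>

section \<open>Linear maps on tensor products\<close>

text \<open>Two facts make \<open>(\<lambda> p \<otimes> id) \<Delta>\<close> the right formula. The
  projection \<open>p\<close> is a derivation relative to the counit, because a product of two words
  has length one only when one of them is empty; with multiplicativity and the counit law of the
  coproduct this gives a derivation along the inclusion of the braided symmetric algebra. On a
  generator the coproduct is \<open>1 \<otimes> \<theta>\<close> plus the coaction of
  \<open>\<theta>\<close>, so covariance of \<lambda> identifies the value with the embedded form
  \<open>\<lambda>(\<theta>)\<close>. The commutation rule of \<lambda> makes this derivation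
  respect the exchange of a form with an element of the symmetric algebra, hence the twisted
  product. The formula takes values in the large tensor product; that they lie in the embedded
  subalgebra follows from the Leibniz rule by induction on products of generators. Signs are carried
  by the grading involution, a linear map, so that graded Leibniz rules become bilinear identities
  that can be tested on pure tensors.\<close>

named_theorems clin

text \<open>The rules in \<open>clin\<close> are closure rules for linearity, mostly composed with
  an arbitrary linear \<open>k\<close>, so that nested Sweedler sums are recognized as linear one
  constructor at a time.\<close>

lemma cbilinearI [clin]:
  "(\<And>x. clinear (f x)) \<Longrightarrow> (\<And>y. clinear (\<lambda>x. f x y)) \<Longrightarrow> cbilinear f"
  by (simp add: cbilinear_def)

lemma clinear_add: "clinear f \<Longrightarrow> f (x + y) = f x + f y"
  and clinear_scaleC: "clinear f \<Longrightarrow> f (c *\<^sub>C x) = c *\<^sub>C f x"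
  by (simp_all add: clinear_iff)

lemma clinear_zero: "clinear f \<Longrightarrow> f 0 = 0"
  by (metis clinear_scaleC complex_vector.scale_zero_left)

lemma clinear_diff: "clinear f \<Longrightarrow> f (x - y) = f x - f y"
  using clinear_add[of f "x - y" y] by simp

lemma clinear_comp: "clinear f \<Longrightarrow> clinear g \<Longrightarrow> clinear (\<lambda>x. f (g x))"
  by (simp add: clinear_iff)

lemma clinear_ident [clin]: "clinear (\<lambda>x. x)" "clinear id" "clinear (\<lambda>x. 0)"
  by (simp_all add: clinear_iff complex_vector.scale_zero_right)

lemma clinear_plus [clin]: "clinear f \<Longrightarrow> clinear g \<Longrightarrow> clinear (\<lambda>x. f x + g x)"
  by (simp add: clinear_iff scaleC_add_right algebra_simps)

lemma clinear_scale [clin]: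
  "clinear f \<Longrightarrow> clinear (\<lambda>x. c *\<^sub>C f x)"
  "clinear k \<Longrightarrow> clinear (\<lambda>x. k x *\<^sub>C y)"
  by (simp_all add: clinear_iff scaleC_add_right scaleC_add_left scaleC_scaleC scaleC_complex_def
      mult.commute)

lemma clinear_pure [clin]:
  "clinear f \<Longrightarrow> clinear (\<lambda>x. f x \<otimes> y)" "clinear f \<Longrightarrow> clinear (\<lambda>x. y \<otimes> f x)"
  by (simp_all add: clinear_iff tensor_pure_linear)

lemma pure_zero: "0 \<otimes> y = 0" "x \<otimes> 0 = 0"
  using clinear_zero[OF clinear_pure(1)[OF clinear_ident(1)]]
    clinear_zero[OF clinear_pure(2)[OF clinear_ident(1)]] by blast+

lemma clinear_mult [clin]:
  fixes f :: "'x::complex_vector \<Rightarrow> 'y::complex_algebra_1"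
  shows "clinear f \<Longrightarrow> clinear (\<lambda>x. f x * y)" "clinear f \<Longrightarrow> clinear (\<lambda>x. y * f x)"
  by (simp_all add: clinear_iff algebra_simps mult_scaleC_left mult_scaleC_right)

lemma clinear_lift [clin]:
  "cbilinear f \<Longrightarrow> clinear k \<Longrightarrow> clinear (\<lambda>x. tensor_lift f (k x))"
  by (rule clinear_comp[OF clinear_tensor_lift])

lemma clinear_map [clin]:
  "clinear f \<Longrightarrow> clinear g \<Longrightarrow> clinear k \<Longrightarrow> clinear (\<lambda>x. tensor_map f g (k x))"
  unfolding tensor_map_def by (simp add: clin)

lemma tensor_map_pure [simp]:
  "clinear f \<Longrightarrow> clinear g \<Longrightarrow> tensor_map f g (x \<otimes> y) = f x \<otimes> g y"
  unfolding tensor_map_def by (simp add: clin tensor_lift_pure)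

lemma tensor_map_add [simp]:
  "clinear f \<Longrightarrow> clinear g \<Longrightarrow> tensor_map f g (s + t) = tensor_map f g s + tensor_map f g t"
  and tensor_map_scaleC [simp]:
  "clinear f \<Longrightarrow> clinear g \<Longrightarrow> tensor_map f g (c *\<^sub>C t) = c *\<^sub>C tensor_map f g t"
  using clinear_map[of f g "\<lambda>x. x"] by (simp_all add: clin clinear_add clinear_scaleC)

lemma tensor_linear_eqI:
  assumes "clinear f" "clinear g" "\<And>x y. f (x \<otimes> y) = g (x \<otimes> y)"
  shows "f t = g t"
  using assms by (induction t rule: tensor_induct) (simp_all add: clinear_add)

text \<open>In a nested Sweedler sum the inner bilinear map contains the outer variables, so
  linearity in such a parameter is needed as well as linearity in the tensor.\<close>

lemma lift_linear_param [clin]: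
  assumes "\<And>x. cbilinear (f x)" "\<And>y z. clinear (\<lambda>x. f x y z)"
  shows "clinear (\<lambda>x. tensor_lift (f x) t)"
proof (induction t rule: tensor_induct)
  case (pure y z)
  then show ?case using assms by (simp add: tensor_lift_pure)
next
  case (add s t)
  then show ?case using assms(1) by (simp add: clinear_add[OF clinear_tensor_lift] clin)
qed

lemma clinear_tensor_lift_apply:
  assumes "clinear h" "cbilinear f"
  shows "h (tensor_lift f t) = tensor_lift (\<lambda>x y. h (f x y)) t"
proof -
  have b: "cbilinear (\<lambda>x y. h (f x y))"
    using assms by (simp add: cbilinear_def clinear_iff)
  show ?thesis
    by (rule tensor_linear_eqI) (simp_all add: assms b clin clinear_comp[OF assms(1)] tensor_lift_pure)
qed

lemma tensor_lift_map:
  assumes "clinear h" "clinear k" "cbilinear f"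
  shows "tensor_lift f (tensor_map h k t) = tensor_lift (\<lambda>x y. f (h x) (k y)) t"
proof -
  have "cbilinear (\<lambda>x y. f (h x) (k y))"
    using assms by (simp add: cbilinear_def clinear_iff)
  then show ?thesis unfolding tensor_map_def
    by (subst clinear_tensor_lift_apply) (simp_all add: assms clin clinear_tensor_lift tensor_lift_pure)
qed

lemma tensor_map_map:
  assumes "clinear h" "clinear k" "clinear f" "clinear g"
  shows "tensor_map f g (tensor_map h k t) = tensor_map (\<lambda>x. f (h x)) (\<lambda>x. g (k x)) t"
  unfolding tensor_map_def[of f g] using assms
  by (simp add: tensor_lift_map clin) (simp add: tensor_map_def)

lemma tensor_map_id: "clinear f \<Longrightarrow> clinear g \<Longrightarrow> (\<And>x. f x = x) \<Longrightarrow> (\<And>x. g x = x) \<Longrightarrow> tensor_map f g t = t"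
  by (rule tensor_linear_eqI) (simp_all add: clin)

lemma tensor_lift_add:
  assumes "cbilinear f" "cbilinear g"
  shows "tensor_lift (\<lambda>x y. f x y + g x y) t = tensor_lift f t + tensor_lift g t"
proof -
  have "cbilinear (\<lambda>x y. f x y + g x y)"
    using assms by (simp add: cbilinear_def clinear_plus)
  then show ?thesis
    by (induction t rule: tensor_induct)
      (simp_all add: assms tensor_lift_pure clinear_add[OF clinear_tensor_lift])
qed

text \<open>Coassociativity in Sweedler form: a trilinear \<open>f\<close> cannot tell which leg was
  split again. Keeping \<open>F\<close> and \<open>G\<close> apart lets one rule serve a coproduct
  (\<open>F\<close> and \<open>G\<close> equal) and a coaction (\<open>F\<close> the coaction,
  \<open>G\<close> the coproduct).\<close>

lemma tensor_lift_assoc: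
  assumes "\<And>x. cbilinear (f x)" "\<And>y z. clinear (\<lambda>x. f x y z)"
    and "clinear F" "clinear G"
    and coassoc: "tensor_assoc (tensor_map F id t) = tensor_map id G t"
  shows "tensor_lift (\<lambda>x y. tensor_lift (f x) (G y)) t =
    tensor_lift (\<lambda>x z. tensor_lift (\<lambda>x' y'. f x' y' z) (F x)) t"
proof -
  have f: "clinear (f x y)" "clinear (\<lambda>y. f x y z)" for x y z
    using assms(1)[of x] by (simp_all add: cbilinear_def)
  note [simp] = tensor_lift_pure clin clinear_tensor_lift f assms(2-4)
  let ?T = "tensor_lift (\<lambda>x s. tensor_lift (f x) s)"
  have T: "cbilinear (\<lambda>x s. tensor_lift (f x) s)"
    by simp
  have 1: "?T (tensor_assoc u) = tensor_lift (\<lambda>s z. tensor_lift (\<lambda>x' y'. f x' y' z) s) u" for u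
  proof (rule tensor_linear_eqI)
    show "clinear (\<lambda>u. ?T (tensor_assoc u))"
      unfolding tensor_assoc_def by simp
    show "clinear (tensor_lift (\<lambda>s z. tensor_lift (\<lambda>x' y'. f x' y' z) s))"
      by simp
    show "?T (tensor_assoc (s \<otimes> z)) = tensor_lift (\<lambda>s z. tensor_lift (\<lambda>x' y'. f x' y' z) s) (s \<otimes> z)"
      for s z
      by (simp add: tensor_assoc_def) (rule tensor_linear_eqI, simp_all)
  qed
  have "?T (tensor_map id G t) = tensor_lift (\<lambda>x y. tensor_lift (f x) (G y)) t"
    by (subst tensor_lift_map) (simp_all)
  moreover have "tensor_lift (\<lambda>s z. tensor_lift (\<lambda>x' y'. f x' y' z) s) (tensor_map F id t) =
    tensor_lift (\<lambda>x z. tensor_lift (\<lambda>x' y'. f x' y' z) (F x)) t"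
    by (subst tensor_lift_map) (simp_all)
  ultimately show ?thesis using 1[of "tensor_map F id t"] coassoc by simp
qed

lemma unital_homD:
  assumes "unital_hom f"
  shows "clinear f" "f 1 = 1" "f (x * y) = f x * f y"
  using assms by (simp_all add: unital_hom_def)

lemma unital_star_homD:
  assumes "unital_star_hom f"
  shows "clinear f" "f 1 = 1" "f (x * y) = f x * f y" "f (star x) = star (f x)"
  using assms by (simp_all add: unital_star_hom_def unital_homD)

lemma tensor_map_mult:
  assumes "clinear f" "clinear g" "\<And>x y. f (x * y) = f x * f y" "\<And>x y. g (x * y) = g x * g y"
  shows "tensor_map f g (s * t) = tensor_map f g s * tensor_map f g t"
proof (induction s rule: tensor_induct)
  case (pure x y)
  show ?case
    by (induction t rule: tensor_induct)
      (simp_all add: assms clin times_tensor_pure algebra_simps)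
qed (simp_all add: assms clin algebra_simps)

lemma tensor_map_star:
  assumes "clinear f" "clinear g" "\<And>x. f (star x) = star (f x)" "\<And>x. g (star x) = star (g x)"
  shows "tensor_map f g (star t) = star (tensor_map f g t)"
  by (induction t rule: tensor_induct)
    (simp_all add: assms clin star_tensor_pure star_add)

lemma clinear_left_inverse:
  fixes f :: "'x::complex_vector \<Rightarrow> 'y::complex_vector"
  assumes "clinear f" "inj f"
  obtains r where "clinear r" "\<And>x. r (f x) = x"
proof -
  interpret P: vector_space_pair "scaleC :: complex \<Rightarrow> 'x \<Rightarrow> 'x" "scaleC :: complex \<Rightarrow> 'y \<Rightarrow> 'y" ..
  show ?thesis
    using P.linear_injective_left_inverse[OF assms] that by (metis comp_def id_apply)
qed

lemma clinear_sum_fun: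
  "(\<And>i. i \<in> I \<Longrightarrow> clinear (f i)) \<Longrightarrow> clinear (\<lambda>x. \<Sum>i\<in>I. f i x)"
  by (induction I rule: infinite_finite_induct) (simp_all add: clin)

lemma clinear_sum: "clinear f \<Longrightarrow> f (sum g I) = (\<Sum>i\<in>I. f (g i))"
  by (induction I rule: infinite_finite_induct) (simp_all add: clinear_zero clinear_add)

lemma word_linear_eqI:
  assumes "clinear f" "clinear g" "\<And>xs. f (word xs) = g (word xs)"
  shows "f t = g t"
  using assms by (induction t rule: word_induct) (simp_all add: clinear_add clinear_scaleC)

lemma span_linear_eqI:
  assumes "x \<in> cspan B" "clinear f" "clinear g" "\<And>b. b \<in> B \<Longrightarrow> f b = g b"
  shows "f x = g x"
  using assms(1)
  by (induction rule: complex_vector.span_induct_alt)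
    (simp_all add: assms(2-) clinear_zero clinear_add clinear_scaleC)

lemma span_linear_mem:
  assumes "x \<in> cspan B" "clinear f" "csubspace S" "\<And>b. b \<in> B \<Longrightarrow> f b \<in> S"
  shows "f x \<in> S"
  using assms(1)
proof (induction rule: complex_vector.span_induct_alt)
  case base
  then show ?case
    using complex_vector.subspace_0[OF assms(3)] by (simp add: clinear_zero[OF assms(2)])
next
  case (step c x y)
  have "c *\<^sub>C f x + f y \<in> S"
    using step assms(4) by (intro complex_vector.subspace_add[OF assms(3)]
        complex_vector.subspace_scale[OF assms(3)])
  then show ?case
    by (simp add: clinear_add[OF assms(2)] clinear_scaleC[OF assms(2)])
qed

lemma tensor_linear_eqI2:
  assumes "\<And>t. clinear (\<lambda>s. f s t)" "\<And>s. clinear (f s)" "\<And>t. clinear (\<lambda>s. g s t)" "\<And>s. clinear (g s)"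
    and "\<And>x y x' y'. f (x \<otimes> y) (x' \<otimes> y') = g (x \<otimes> y) (x' \<otimes> y')"
  shows "f s t = g s t"
proof (rule tensor_linear_eqI[of "\<lambda>s. f s t" "\<lambda>s. g s t"])
  show "f (x \<otimes> y) t = g (x \<otimes> y) t" for x y
    by (rule tensor_linear_eqI[of "f (x \<otimes> y)"]) (simp_all add: assms)
qed (simp_all add: assms)

section \<open>The degree-one part of the braided symmetric algebra\<close>

definition degree_one :: "'v::complex_vector tensor_algebra \<Rightarrow> 'v" where
  "degree_one = word_lift (\<lambda>xs. if length xs = 1 then hd xs else 0)"

lemma multisemilinear_degree_one:
  "multisemilinear id (\<lambda>xs. if length xs = 1 then hd xs else (0::'v::complex_vector))"
proof -
  have "hd (us @ x # vs) = x" if "length us + length vs = 0" for us vs :: "'v list" and x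
    using that by simp
  then show ?thesis
    by (auto simp: multisemilinear_def semilinear_def complex_vector.scale_zero_right)
qed

lemma clinear_degree_one [clin]: "clinear degree_one"
  unfolding degree_one_def by (rule clinear_word_lift[OF multisemilinear_degree_one])

lemma degree_one_word: "degree_one (word xs) = (if length xs = 1 then hd xs else 0)"
  unfolding degree_one_def by (rule word_lift_word[OF multisemilinear_degree_one])

lemma degree_one_star: "degree_one (star t) = star (degree_one t)"
proof (induction t rule: word_induct)
  case (word xs)
  have "star (0::'a) = 0"
    using star_scaleC[of 0 "0::'a"] by (simp add: complex_vector.scale_zero_left)
  then show ?case by (cases xs) (auto simp: star_word degree_one_word)
qed (simp_all add: clinear_add[OF clinear_degree_one] clinear_scaleC[OF clinear_degree_one]
  star_add star_scaleC)

lemma cbilinear_word2: "cbilinear (\<lambda>x y. word [x, y])"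
  using word_linear(1)[of "[]" _ _ "[_]"] word_linear(2)[of "[]" _ _ "[_]"]
    word_linear(1)[of "[_]" _ _ "[]"] word_linear(2)[of "[_]" _ _ "[]"]
  by (auto simp: cbilinear_def clinear_iff)

lemma multisemilinear_braid_at:
  fixes \<tau> :: "'v::complex_vector \<otimes> 'v \<Rightarrow> 'v \<otimes> 'v"
  assumes "clinear \<tau>"
  shows "multisemilinear id (\<lambda>xs. if Suc i < length xs
    then word (take i xs) * tensor_lift (\<lambda>x y. word [x, y]) (\<tau> (xs ! i \<otimes> xs ! Suc i)) *
      word (drop (i + 2) xs)
    else word xs)"
proof -
  let ?f = "\<lambda>xs. if Suc i < length xs
    then word (take i xs) * tensor_lift (\<lambda>x y. word [x, y]) (\<tau> (xs ! i \<otimes> xs ! Suc i)) *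
      word (drop (i + 2) xs)
    else word xs"
  have w: "clinear (\<lambda>x. word (us @ x # vs))" for us vs :: "'v list"
    by (simp add: clinear_iff word_linear)
  note [simp] = clin clinear_comp[OF assms] cbilinear_word2
  have "clinear (\<lambda>x. ?f (us @ x # vs))" for us vs
  \<comment> \<open>The length does not depend on the varying letter, so \<open>undefined\<close>
    stands in for it. The later cases place the letter before the braided pair, in its first or
    second slot, or after it.\<close>
  proof (cases "Suc i < length (us @ undefined # vs)")
    case False
    then show ?thesis by (simp add: w)
  next
    case True
    consider "length us < i" | "length us = i" | "length us = Suc i" | "length us > Suc i"
      by linarith
    then show ?thesis
    proof cases
      case 1
      \<comment> \<open>With \<open>i\<close> in this form, \<open>take i\<close> visibly keeps the
        varying letter and \<open>drop (i + 2)\<close> discards it.\<close>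
      then obtain k where k: "i = length us + Suc k"
        using less_imp_Suc_add by fastforce
      have "drop (3 + k) (x # vs) = drop (Suc (Suc k)) vs" for x
        by (simp add: numeral_3_eq_3)
      then show ?thesis using True
        by (simp add: k nth_append w)
    next
      case 2
      then show ?thesis using True by (simp add: nth_append)
    next
      case 3
      then show ?thesis using True by (simp add: nth_append)
    next
      case 4
      then show ?thesis using True by (simp add: nth_append w)
    qed
  qed
  then show ?thesis
    by (simp only: multisemilinear_def clinear_semilinear) simp
qed

lemma clinear_braid_at: "clinear \<tau> \<Longrightarrow> clinear (braid_at \<tau> i)"
  unfolding braid_at_def by (intro clinear_word_lift multisemilinear_braid_at)

text \<open>A braiding changes only words with at least two letters and turns them into combinations
  of words that again have at least two, so both sides vanish there; all other words are left
  alone.\<close>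

lemma degree_one_braid_at:
  fixes \<tau> :: "'v::complex_vector \<otimes> 'v \<Rightarrow> 'v \<otimes> 'v"
  assumes "clinear \<tau>"
  shows "degree_one (braid_at \<tau> i t) = degree_one t"
proof (rule word_linear_eqI)
  show "clinear (\<lambda>t. degree_one (braid_at \<tau> i t))"
    by (intro clinear_comp[OF clinear_degree_one] clinear_braid_at assms)
  have "degree_one (word us * tensor_lift (\<lambda>x y. word [x, y]) z * word vs) = 0"
    for us vs :: "'v list" and z
    by (rule tensor_linear_eqI)
      (simp_all add: clin clinear_comp[OF clinear_degree_one] cbilinear_word2 tensor_lift_pure
        times_word_word degree_one_word)
  then show "degree_one (braid_at \<tau> i (word xs)) = degree_one (word xs)" for xs
    by (simp add: braid_at_def word_lift_word[OF multisemilinear_braid_at[OF assms]] degree_one_word)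
qed (simp add: clin)

lemma clinear_braid_perm: "clinear \<tau> \<Longrightarrow> clinear (braid_perm \<tau> n \<pi>)"
  and degree_one_braid_perm: "clinear \<tau> \<Longrightarrow> degree_one (braid_perm \<tau> n \<pi> t) = degree_one t"
proof -
  have "clinear (foldr (\<lambda>i f. braid_at \<tau> i \<circ> f) is id)"
    and "degree_one (foldr (\<lambda>i f. braid_at \<tau> i \<circ> f) is id t) = degree_one t" if "clinear \<tau>" for "is"
    using that by (induction "is") (auto simp: clin comp_def degree_one_braid_at
        intro: clinear_comp[OF clinear_braid_at])
  then show "clinear \<tau> \<Longrightarrow> clinear (braid_perm \<tau> n \<pi>)"
    "clinear \<tau> \<Longrightarrow> degree_one (braid_perm \<tau> n \<pi> t) = degree_one t"
    by (simp_all add: braid_perm_def)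
qed

text \<open>
  No \<open>\<tau>\<^sub>\<pi>\<close> changes the degree-one part, which vanishes on words of length \<open>n \<noteq> 1\<close>, and for \<open>n = 1\<close>
  there is only one permutation.
\<close>

lemma degree_one_symmetrizer:
  fixes \<tau> :: "'v::complex_vector \<otimes> 'v \<Rightarrow> 'v \<otimes> 'v"
  assumes "clinear \<tau>"
  shows "degree_one (braided_symmetrizer \<tau> t) = degree_one t"
proof (rule word_linear_eqI)
  let ?f = "\<lambda>xs. \<Sum>\<pi> | \<pi> permutes {..<length xs}. braid_perm \<tau> (length xs) \<pi> (word xs)"
  have w: "clinear (\<lambda>x. word (us @ x # vs))" for us vs :: "'v list"
    by (simp add: clinear_iff word_linear)
  have "clinear (\<lambda>x. ?f (us @ x # vs))" for us vs
    by (simp, intro clinear_sum_fun clinear_comp[OF clinear_braid_perm] assms w)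
  then have f: "multisemilinear id ?f"
    by (simp only: multisemilinear_def clinear_semilinear) simp
  show "clinear (\<lambda>t. degree_one (braided_symmetrizer \<tau> t))"
    unfolding braided_symmetrizer_def
    by (intro clinear_comp[OF clinear_degree_one] clinear_word_lift f)
  show "degree_one (braided_symmetrizer \<tau> (word xs)) = degree_one (word xs)" for xs
  proof -
    have "degree_one (?f xs) = (\<Sum>\<pi> | \<pi> permutes {..<length xs}. degree_one (word xs))"
      by (simp add: clinear_sum[OF clinear_degree_one] degree_one_braid_perm assms)
    also have "\<dots> = degree_one (word xs)"
    proof (cases "length xs = 1")
      case True
      have "{..<Suc 0} = {0}" by auto
      then have "{\<pi>. \<pi> permutes {..<length xs}} = {id}"
        using True by (auto simp: permutes_sing)
      then show ?thesis by simp
    qed (simp add: degree_one_word)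
    finally show ?thesis
      by (simp add: braided_symmetrizer_def word_lift_word[OF f])
  qed
qed (simp add: clin)

context left_invariant_part
begin

text \<open>The map \<open>coV\<close> is specified only through its image under
  \<open>tensor_map incl id\<close>. A linear left inverse of \<open>incl\<close> recovers it as a
  composite of linear maps; the same device serves \<open>actV\<close>.\<close>

lemma clinear_coV [clin]: "clinear k \<Longrightarrow> clinear (\<lambda>x. coV (k x))"
proof (erule clinear_comp[rotated])
  obtain r where r: "clinear r" "\<And>x. r (incl x) = x"
    using clinear_left_inverse[OF incl_linear incl_inj] by blast
  have "coV = (\<lambda>\<theta>. tensor_map r id (rco (incl \<theta>)))"
    by (simp add: fun_eq_iff coV[symmetric] tensor_map_map incl_linear r clin tensor_map_id)
  then show "clinear coV"
    using r(1) by (simp add: clin clinear_comp[OF rco_linear] incl_linear)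
qed

lemma clinear_coproduct [clin]: "clinear k \<Longrightarrow> clinear (\<lambda>x. \<Delta> (k x))"
  and clinear_counit [clin]: "clinear k \<Longrightarrow> clinear (\<lambda>x. \<epsilon> (k x))"
  by (erule clinear_comp[OF unital_star_homD(1)[OF coproduct_hom]]
    clinear_comp[OF unital_homD(1)[OF counit_hom]])+

lemma clinear_actV [clin]:
  "clinear k \<Longrightarrow> clinear (\<lambda>x. actV (k x) a)" "clinear k' \<Longrightarrow> clinear (\<lambda>x. actV \<theta> (k' x))"
proof -
  obtain r where r: "clinear r" "\<And>x. r (incl x) = x"
    using clinear_left_inverse[OF incl_linear incl_inj] by blast
  have "clinear (\<lambda>b. lmul b \<xi>)" "clinear (lmul b)" "clinear (rmul \<xi>)" "clinear (\<lambda>\<xi>. rmul \<xi> b)" for \<xi> b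
    using lmul_bilinear rmul_bilinear by (simp_all add: cbilinear_def)
  note l = this[THEN clinear_comp] antipode_linear[THEN clinear_comp] incl_linear[THEN clinear_comp]
    r(1)[THEN clinear_comp]
  have "actV = (\<lambda>\<theta> a. r (tensor_lift (\<lambda>a\<^sub>1 a\<^sub>2. rmul (lmul (\<kappa> a\<^sub>1) (incl \<theta>)) a\<^sub>2) (\<Delta> a)))"
    by (simp add: fun_eq_iff actV[symmetric] r)
  then have "clinear (\<lambda>\<theta>. actV \<theta> a)" "clinear (actV \<theta>)" for a \<theta>
    by (simp_all add: l clin)
  then show "clinear k \<Longrightarrow> clinear (\<lambda>x. actV (k x) a)" "clinear k' \<Longrightarrow> clinear (\<lambda>x. actV \<theta> (k' x))"
    by (simp_all add: clinear_iff)
qed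

lemma clinear_braid: "clinear (braid coV actV)"
  unfolding braid_def by (simp add: clin)

end

lemma clinear_gen [clin]: "clinear k \<Longrightarrow> clinear (\<lambda>x. gen (k x))"
  using word_linear[of "[]" _ _ "[]"] word_linear(2)[of "[]" _ _ "[]"] by (auto simp: clinear_iff)

lemma gen_scaleC: "gen (c *\<^sub>C x) = c *\<^sub>C gen x"
  using word_linear(2)[of "[]" c x "[]"] by simp

context braided_symmetric_algebra
begin

lemma clinear_proj [clin]: "clinear k \<Longrightarrow> clinear (\<lambda>x. proj (k x))"
  by (rule clinear_comp[OF unital_star_homD(1)[OF proj_hom]])

lemmas proj_simps = unital_star_homD(2-)[OF proj_hom] clinear_add[OF unital_star_homD(1)[OF proj_hom]]
  clinear_scaleC[OF unital_star_homD(1)[OF proj_hom]]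

definition sym_one :: "'s \<Rightarrow> 'v" where
  "sym_one s = degree_one (inv proj s)"

text \<open>Two preimages of one element differ by an element of the kernel of the symmetrizer, and
  the symmetrizer preserves degree-one parts; hence the choice made by \<open>inv proj\<close> is
  immaterial.\<close>

lemma sym_one_proj: "sym_one (proj t) = degree_one t"
proof -
  let ?t = "inv proj (proj t)"
  have "proj ?t = proj t" by (rule surj_f_inv_f[OF proj_surj])
  then have "proj (?t - t) = 0"
    by (simp add: clinear_diff[OF unital_star_homD(1)[OF proj_hom]])
  then have "braided_symmetrizer (braid coV actV) (?t - t) = 0"
    using proj_kernel by blast
  then have "degree_one (?t - t) = 0"
    using degree_one_symmetrizer[OF clinear_braid, of "?t - t"]
    by (simp add: clinear_zero[OF clinear_degree_one])
  then show ?thesis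
    by (simp add: sym_one_def clinear_diff[OF clinear_degree_one])
qed

lemma proj_cases: obtains t where "s = proj t"
  using proj_surj by (metis surjD)

lemma clinear_sym_one [clin]: "clinear k \<Longrightarrow> clinear (\<lambda>x. sym_one (k x))"
proof (erule clinear_comp[rotated])
  have "sym_one (s + s') = sym_one s + sym_one s'" for s s'
    by (rule proj_cases[of s], rule proj_cases[of s'])
      (simp add: proj_simps(4)[symmetric] sym_one_proj clinear_add[OF clinear_degree_one])
  moreover have "sym_one (c *\<^sub>C s) = c *\<^sub>C sym_one s" for c s
    by (rule proj_cases[of s])
      (simp add: proj_simps(5)[symmetric] sym_one_proj clinear_scaleC[OF clinear_degree_one])
  ultimately show "clinear sym_one"
    by (simp add: clinear_iff)
qed

lemma sym_one_star: "sym_one (star s) = star (sym_one s)"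
  by (rule proj_cases[of s]) (simp add: proj_simps(3)[symmetric] sym_one_proj degree_one_star)

text \<open>Products of generators span the algebra because \<open>proj\<close> is onto. Peeling one
  generator off the left matches the recursion of \<open>act_word\<close> and the cross relation,
  which treat one letter at a time.\<close>

lemma sym_induct [case_names one gen add scale]:
  assumes "P 1" "\<And>\<theta> s. P s \<Longrightarrow> P (proj (gen \<theta>) * s)" "\<And>s t. P s \<Longrightarrow> P t \<Longrightarrow> P (s + t)"
    "\<And>c s. P s \<Longrightarrow> P (c *\<^sub>C s)"
  shows "P s"
proof -
  have "P (proj (word xs))" for xs
  proof (induction xs)
    case Nil
    then show ?case
      using assms(1) by (simp add: one_tensor_algebra_def[symmetric] proj_simps)
  next
    case (Cons x xs)
    then show ?case
      using assms(2)[of "proj (word xs)" x] by (simp add: proj_simps(2)[symmetric] times_word_word)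
  qed
  then have "P (proj t)" for t
    by (induction t rule: word_induct) (simp_all add: proj_simps assms)
  then show ?thesis by (metis proj_cases)
qed

lemma clinear_act_word [clin]: "clinear k \<Longrightarrow> clinear (\<lambda>x. act_word \<Delta> \<epsilon> actV xs (k x))"
proof (erule clinear_comp[of "act_word \<Delta> \<epsilon> actV xs", rotated])
  show "clinear (act_word \<Delta> \<epsilon> actV xs)"
  proof (induction xs)
    case (Cons x xs)
    then show ?case by (simp add: clin)
  qed (simp add: clin)
qed

lemma multisemilinear_act_word: "multisemilinear id (\<lambda>xs. act_word \<Delta> \<epsilon> actV xs a)"
proof -
  have "clinear (\<lambda>x. act_word \<Delta> \<epsilon> actV (us @ x # vs) a)" for us vs
    by (induction us arbitrary: a) (simp_all add: clin)
  then show ?thesis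
    by (simp only: multisemilinear_def clinear_semilinear) simp
qed

lemma actS_word: "actS (proj (word xs)) a = proj (act_word \<Delta> \<epsilon> actV xs a)"
  by (simp add: actS actT_def word_lift_word[OF multisemilinear_act_word])

lemma actS_one: "actS 1 a = \<epsilon> a *\<^sub>C 1"
  using actS_word[of "[]" a] by (simp add: one_tensor_algebra_def[symmetric] proj_simps)

text \<open>On a single letter \<open>act_word\<close> still splits \<open>a\<close> and applies
  \<epsilon> to the second leg; the right counit law undoes the split.\<close>

lemma actS_gen: "actS (proj (gen \<theta>)) a = proj (gen (actV \<theta> a))"
proof -
  have "proj (gen (actV \<theta> (tensor_lift (\<lambda>a\<^sub>1 a\<^sub>2. \<epsilon> a\<^sub>2 *\<^sub>C a\<^sub>1) (\<Delta> a)))) =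
      tensor_lift (\<lambda>a\<^sub>1 a\<^sub>2. proj (gen (actV \<theta> (\<epsilon> a\<^sub>2 *\<^sub>C a\<^sub>1)))) (\<Delta> a)"
    by (rule clinear_tensor_lift_apply) (simp_all add: clin)
  also have "\<dots> = proj (act_word \<Delta> \<epsilon> actV [\<theta>] a)"
    by (simp add: clinear_tensor_lift_apply clin gen_scaleC clinear_scaleC mult_scaleC_right proj_simps)
  finally show ?thesis by (simp add: actS_word counit_right)
qed

lemma clinear_actS_left: "clinear (\<lambda>s. actS s a)"
proof -
  have T: "clinear (\<lambda>t. actT \<Delta> \<epsilon> actV t a)"
    unfolding actT_def by (rule clinear_word_lift[OF multisemilinear_act_word])
  have "actS (s + s') a = actS s a + actS s' a" for s s'
    by (rule proj_cases[of s], rule proj_cases[of s'])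
      (simp add: proj_simps(4)[symmetric] actS clinear_add[OF T])
  moreover have "actS (c *\<^sub>C s) a = c *\<^sub>C actS s a" for c s
    by (rule proj_cases[of s]) (simp add: proj_simps(5)[symmetric] actS clinear_scaleC[OF T])
  ultimately show ?thesis
    by (simp add: clinear_iff)
qed

lemma clinear_actS [clin]:
  "clinear k \<Longrightarrow> clinear (\<lambda>x. actS (k x) a)" "clinear k' \<Longrightarrow> clinear (\<lambda>x. actS s (k' x))"
proof -
  have 1: "clinear (actT \<Delta> \<epsilon> actV t)" for t
  proof (induction t rule: word_induct)
    case (word xs)
    then show ?case
      by (simp add: actT_def word_lift_word[OF multisemilinear_act_word] clin)
  qed (simp_all add: actT_def clinear_word_lift[OF multisemilinear_act_word] clinear_add
    clinear_scaleC clin)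
  have "clinear (actS s)"
    by (rule proj_cases[of s]) (simp add: actS[abs_def] clin 1)
  then show "clinear k' \<Longrightarrow> clinear (\<lambda>x. actS s (k' x))"
    by (rule clinear_comp)
  show "clinear k \<Longrightarrow> clinear (\<lambda>x. actS (k x) a)"
    by (rule clinear_comp[OF clinear_actS_left])
qed

text \<open>This is the recursion step of \<open>act_word\<close>, carried to the quotient by
  \<open>proj\<close>.\<close>

lemma actS_mult_gen:
  "actS (proj (gen \<theta>) * s) a = tensor_lift (\<lambda>a\<^sub>1 a\<^sub>2. actS (proj (gen \<theta>)) a\<^sub>1 * actS s a\<^sub>2) (\<Delta> a)"
proof -
  have "actS (proj (gen \<theta>) * proj t) a =
      tensor_lift (\<lambda>a\<^sub>1 a\<^sub>2. actS (proj (gen \<theta>)) a\<^sub>1 * actS (proj t) a\<^sub>2) (\<Delta> a)" for t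
  proof (rule word_linear_eqI[of "\<lambda>t. actS (proj (gen \<theta>) * proj t) a"])
    show "actS (proj (gen \<theta>) * proj (word xs)) a =
        tensor_lift (\<lambda>a\<^sub>1 a\<^sub>2. actS (proj (gen \<theta>)) a\<^sub>1 * actS (proj (word xs)) a\<^sub>2) (\<Delta> a)" for xs
    proof -
      have "actS (proj (gen \<theta>) * proj (word xs)) a =
          proj (tensor_lift (\<lambda>a\<^sub>1 a\<^sub>2. gen (actV \<theta> a\<^sub>1) * act_word \<Delta> \<epsilon> actV xs a\<^sub>2) (\<Delta> a))"
        by (simp add: proj_simps(2)[symmetric] times_word_word actS_word)
      also have "\<dots> = tensor_lift (\<lambda>a\<^sub>1 a\<^sub>2. proj (gen (actV \<theta> a\<^sub>1)) *
          proj (act_word \<Delta> \<epsilon> actV xs a\<^sub>2)) (\<Delta> a)"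
        by (simp add: clinear_tensor_lift_apply clin proj_simps)
      finally show ?thesis
        by (simp add: actS_gen actS_word[of xs])
    qed
  qed (simp_all add: clin)
  then show ?thesis by (metis proj_cases)
qed

end

section \<open>The affine extension as a crossed product\<close>

context affine_extension
begin

lemma clinear_inA [clin]: "clinear k \<Longrightarrow> clinear (\<lambda>x. inA (k x))"
  and clinear_inS [clin]: "clinear k' \<Longrightarrow> clinear (\<lambda>x. inS (k' x))"
  and clinear_coproduct' [clin]: "clinear k'' \<Longrightarrow> clinear (\<lambda>x. \<Delta>' (k'' x))"
  and clinear_counit' [clin]: "clinear k'' \<Longrightarrow> clinear (\<lambda>x. \<epsilon>' (k'' x))"
  by (erule clinear_comp[OF unital_star_homD(1)[OF inA_hom]]
    clinear_comp[OF unital_star_homD(1)[OF inS_hom]]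
    clinear_comp[OF unital_star_homD(1)[OF affine.coproduct_hom]]
    clinear_comp[OF unital_homD(1)[OF affine.counit_hom]])+

lemmas inA_simps = unital_star_homD(2-)[OF inA_hom] clinear_add[OF unital_star_homD(1)[OF inA_hom]]
  clinear_scaleC[OF unital_star_homD(1)[OF inA_hom]]
lemmas inS_simps = unital_star_homD(2-)[OF inS_hom] clinear_add[OF unital_star_homD(1)[OF inS_hom]]
  clinear_scaleC[OF unital_star_homD(1)[OF inS_hom]]

text \<open>The map \<open>\<epsilon> \<otimes> id\<close>, transported along the linear isomorphism
  given by multiplication. It is a linear left inverse of \<open>inS\<close> and provides left
  inverses of \<open>tensor_map inS id\<close> and of the embedding \<open>emb\<close>.\<close>

definition pr_S :: "'t \<Rightarrow> 's" where
  "pr_S t = tensor_lift (\<lambda>a s. \<epsilon> a *\<^sub>C s) (inv (tensor_lift (\<lambda>a s. inA a * inS s)) t)"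

lemma pr_S_lift:
  "pr_S (tensor_lift (\<lambda>a s. inA a * inS s) u) = tensor_lift (\<lambda>a s. \<epsilon> a *\<^sub>C s) u"
  by (simp add: pr_S_def inv_f_f[OF bij_is_inj[OF multiplication_bij]])

lemma affine_cases:
  obtains u where "t = tensor_lift (\<lambda>a s. inA a * inS s) u"
  using bij_is_surj[OF multiplication_bij] by (metis surjD)

lemma clinear_pr_S [clin]: "clinear k \<Longrightarrow> clinear (\<lambda>x. pr_S (k x))"
proof (erule clinear_comp[rotated])
  have m: "clinear (tensor_lift (\<lambda>a s. inA a * inS s))" and e: "clinear (tensor_lift (\<lambda>a s. \<epsilon> a *\<^sub>C (s::'s)))"
    by (simp_all add: clin)
  have "pr_S (t + t') = pr_S t + pr_S t'" for t t'
    by (rule affine_cases[of t], rule affine_cases[of t'])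
      (simp add: clinear_add[OF m, symmetric] pr_S_lift clinear_add[OF e])
  moreover have "pr_S (c *\<^sub>C t) = c *\<^sub>C pr_S t" for c t
    by (rule affine_cases[of t])
      (simp add: clinear_scaleC[OF m, symmetric] pr_S_lift clinear_scaleC[OF e])
  ultimately show "clinear pr_S"
    by (simp add: clinear_iff)
qed

lemma pr_S_mult: "pr_S (inA a * inS s) = \<epsilon> a *\<^sub>C s"
  using pr_S_lift[of "a \<otimes> s"] by (simp add: tensor_lift_pure clin)

lemma pr_S_inS: "pr_S (inS s) = s"
  using pr_S_mult[of 1 s] unital_homD(2)[OF counit_hom] by (simp add: inA_simps scaleC_one)

text \<open>The cross relation passes from generators to all of the symmetric algebra:
  \<open>inA a\<close> is moved past one generator at a time, and coassociativity regroups the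
  resulting double coproduct into the one in \<open>actS_mult_gen\<close>.\<close>

lemma inS_inA:
  "inS s * inA a = tensor_lift (\<lambda>a\<^sub>1 a\<^sub>2. inA a\<^sub>1 * inS (actS s a\<^sub>2)) (\<Delta> a)"
proof (induction s arbitrary: a rule: sym_induct)
  case one
  have "inA (tensor_lift (\<lambda>a\<^sub>1 a\<^sub>2. \<epsilon> a\<^sub>2 *\<^sub>C a\<^sub>1) (\<Delta> a)) =
      tensor_lift (\<lambda>a\<^sub>1 a\<^sub>2. inA a\<^sub>1 * inS (actS 1 a\<^sub>2)) (\<Delta> a)"
    by (simp add: clinear_tensor_lift_apply clin inA_simps inS_simps actS_one mult_scaleC_right)
  then show ?case by (simp add: counit_right inS_simps)
next
  case (gen \<theta> s)
  let ?v = "proj (gen \<theta>)"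
  have "inS (?v * s) * inA a = inS ?v * tensor_lift (\<lambda>a\<^sub>1 a\<^sub>2. inA a\<^sub>1 * inS (actS s a\<^sub>2)) (\<Delta> a)"
    by (simp add: inS_simps gen mult.assoc)
  also have "\<dots> = tensor_lift (\<lambda>a\<^sub>1 a\<^sub>2. (inS ?v * inA a\<^sub>1) * inS (actS s a\<^sub>2)) (\<Delta> a)"
    by (simp add: clinear_tensor_lift_apply clin mult.assoc)
  also have "\<dots> = tensor_lift (\<lambda>a\<^sub>1 a\<^sub>2. tensor_lift (\<lambda>b\<^sub>1 b\<^sub>2.
      inA b\<^sub>1 * inS (actS ?v b\<^sub>2) * inS (actS s a\<^sub>2)) (\<Delta> a\<^sub>1)) (\<Delta> a)"
    unfolding cross_relation
    by (simp add: clinear_tensor_lift_apply[where h = "\<lambda>x. x * y" for y] clin actS_gen)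
  also have "\<dots> = tensor_lift (\<lambda>a\<^sub>1 a\<^sub>2. tensor_lift (\<lambda>b\<^sub>1 b\<^sub>2.
      inA a\<^sub>1 * inS (actS ?v b\<^sub>1) * inS (actS s b\<^sub>2)) (\<Delta> a\<^sub>2)) (\<Delta> a)"
    by (rule tensor_lift_assoc[symmetric]) (simp_all add: clin coassoc)
  also have "\<dots> = tensor_lift (\<lambda>a\<^sub>1 a\<^sub>2. inA a\<^sub>1 * inS (actS (?v * s) a\<^sub>2)) (\<Delta> a)"
    by (simp add: actS_mult_gen clinear_tensor_lift_apply clin inS_simps mult.assoc)
  finally show ?case .
next
  case (add s t)
  then show ?case
    by (simp add: clinear_add[OF clinear_actS_left] inS_simps algebra_simps tensor_lift_add clin)
next
  case (scale c s)
  have "c *\<^sub>C (inS s * inA a) = tensor_lift (\<lambda>a\<^sub>1 a\<^sub>2. c *\<^sub>C (inA a\<^sub>1 * inS (actS s a\<^sub>2))) (\<Delta> a)"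
    unfolding scale by (rule clinear_tensor_lift_apply) (simp_all add: clin)
  then show ?case
    by (simp add: clinear_scaleC[OF clinear_actS_left] inS_simps mult_scaleC_left mult_scaleC_right)
qed

lemma hatS_pr_S: "hatS s = tensor_map pr_S id (\<Delta>' (inS s))"
  by (simp add: hatS[symmetric] tensor_map_map clin pr_S_inS tensor_map_id)

lemma clinear_hatS [clin]: "clinear k \<Longrightarrow> clinear (\<lambda>x. hatS (k x))"
  unfolding hatS_pr_S by (simp add: clin)

text \<open>Since \<open>tensor_map inS id\<close> has the left inverse
  \<open>tensor_map pr_S id\<close>, an element is \<open>hatS s\<close> as soon as its image is
  \<open>\<Delta>' (inS s)\<close>. In this way \<open>hatS\<close> inherits the laws of the
  coproduct.\<close>

lemma hatS_eqI: "tensor_map inS id x = \<Delta>' (inS s) \<Longrightarrow> hatS s = x"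
  unfolding hatS_pr_S by (drule sym) (simp add: tensor_map_map clin pr_S_inS tensor_map_id)

lemmas coproduct'_simps = unital_star_homD(2-)[OF affine.coproduct_hom]

lemma hatS_one: "hatS 1 = 1 \<otimes> 1"
  by (rule hatS_eqI) (simp add: clin inS_simps coproduct'_simps one_tensor_def)

lemma hatS_mult: "hatS (s * s') = hatS s * hatS s'"
  by (rule hatS_eqI) (simp add: tensor_map_mult clin inS_simps coproduct'_simps hatS)

lemma hatS_star: "hatS (star s) = star (hatS s)"
  by (rule hatS_eqI) (simp add: tensor_map_star clin inS_simps coproduct'_simps hatS)

lemma hatS_gen: "hatS (proj (gen \<theta>)) =
    1 \<otimes> inS (proj (gen \<theta>)) + tensor_map (\<lambda>\<eta>. proj (gen \<eta>)) inA (coV \<theta>)"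
  by (rule hatS_eqI) (simp add: coproduct_gen clin inS_simps tensor_map_map)

lemma hatS_counit: "tensor_lift (\<lambda>r t. \<epsilon>' (inS r) *\<^sub>C t) (hatS s) = inS s"
proof -
  have "tensor_lift (\<lambda>r t. \<epsilon>' (inS r) *\<^sub>C t) (hatS s) =
      tensor_lift (\<lambda>r t. \<epsilon>' r *\<^sub>C t) (tensor_map inS id (hatS s))"
    by (simp add: tensor_lift_map clin)
  then show ?thesis by (simp add: hatS affine.counit_left)
qed

lemma counit_sym_word: "\<epsilon>' (inS (proj (word xs))) = (if xs = [] then 1 else 0)"
proof (cases xs)
  case Nil
  then show ?thesis
    by (simp add: one_tensor_algebra_def[symmetric] proj_simps inS_simps unital_homD(2)[OF affine.counit_hom])
next
  case (Cons x ys)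
  then have "word xs = gen x * word ys" by (simp add: times_word_word)
  then show ?thesis
    using Cons by (simp add: proj_simps inS_simps unital_homD(3)[OF affine.counit_hom] counit_gen)
qed

text \<open>A product of two words is a single letter only if one of them is that letter and the
  other is empty, and on words the counit of the affine quantum group is exactly the test for
  emptiness.\<close>

lemma sym_one_mult:
  "sym_one (s * s') = \<epsilon>' (inS s') *\<^sub>C sym_one s + \<epsilon>' (inS s) *\<^sub>C sym_one s'"
proof -
  have "sym_one (proj t * proj t') =
      \<epsilon>' (inS (proj t')) *\<^sub>C sym_one (proj t) + \<epsilon>' (inS (proj t)) *\<^sub>C sym_one (proj t')" for t t'
  proof (rule word_linear_eqI[of "\<lambda>t. sym_one (proj t * proj t')"])
    show "sym_one (proj (word xs) * proj t') = \<epsilon>' (inS (proj t')) *\<^sub>C sym_one (proj (word xs)) +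
        \<epsilon>' (inS (proj (word xs))) *\<^sub>C sym_one (proj t')" for xs
    proof (rule word_linear_eqI[of "\<lambda>t'. sym_one (proj (word xs) * proj t')"])
      show "sym_one (proj (word xs) * proj (word ys)) =
          \<epsilon>' (inS (proj (word ys))) *\<^sub>C sym_one (proj (word xs)) +
          \<epsilon>' (inS (proj (word xs))) *\<^sub>C sym_one (proj (word ys))" for ys
        by (cases xs; cases ys) (auto simp: proj_simps(2)[symmetric] times_word_word sym_one_proj
            degree_one_word counit_sym_word scaleC_one complex_vector.scale_zero_left
            complex_vector.scale_zero_right)
    qed (simp_all add: clin)
  qed (simp_all add: clin)
  then show ?thesis by (metis proj_cases)
qed

end

section \<open>Gradings\<close>

lemma graded_decompositionD:
  assumes "graded_decomposition gr"
  shows "csubspace (gr n)"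
  using assms by (simp add: graded_decomposition_def)

lemma graded_induct [consumes 1, case_names hom add]:
  assumes "graded_decomposition gr" "\<And>n x. x \<in> gr n \<Longrightarrow> P x" "\<And>x y. P x \<Longrightarrow> P y \<Longrightarrow> P (x + y)"
  shows "P x"
proof -
  obtain f where f: "\<And>n. f n \<in> gr n" "finite {n. f n \<noteq> 0}" "x = (\<Sum>n | f n \<noteq> 0. f n)"
    using assms(1) unfolding graded_decomposition_def by meson
  \<comment> \<open>The induction over a finite sum starts at the empty sum, so 0 must count as
    homogeneous.\<close>
  have zero: "0 \<in> gr 0"
    using graded_decompositionD[OF assms(1)] by (rule complex_vector.subspace_0)
  have P_f: "P (f n)" for n
    by (rule assms(2)[OF f(1)])
  have "P (sum f A)" if "finite A" for A
    using that by (induction A rule: finite_induct) (simp_all add: P_f assms(2)[OF zero] assms(3))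
  then show ?thesis using f by simp
qed

text \<open>Each homogeneous component is scaled by its own constant; uniqueness of the
  decomposition makes this well defined and linear. The choice \<open>(- 1) ^ n\<close> yields the
  grading involution.\<close>

lemma graded_scale_exists:
  assumes gr: "graded_decomposition gr"
  obtains \<gamma> where "clinear \<gamma>" "\<And>n x. x \<in> gr n \<Longrightarrow> \<gamma> x = c n *\<^sub>C x"
proof -
  note sub = graded_decompositionD[OF gr]
  define dec where "dec x f \<longleftrightarrow> (\<forall>n. f n \<in> gr n) \<and> finite {n. f n \<noteq> 0} \<and> x = (\<Sum>n | f n \<noteq> 0. f n)"
    for x and f :: "nat \<Rightarrow> 'a"
  define comp where "comp x = (THE f. dec x f)" for x
  have ex: "\<exists>!f. dec x f" for x
    using gr by (simp add: graded_decomposition_def dec_def)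
  have comp: "dec x (comp x)" for x
    unfolding comp_def by (rule theI'[OF ex])
  have comp_eq: "dec x f \<Longrightarrow> comp x = f" for x f
    using ex comp by blast
  \<comment> \<open>Admitting any finite set that contains the support allows two decompositions to
    be added over a common index set.\<close>
  have dec_iff: "dec x f \<longleftrightarrow> (\<forall>n. f n \<in> gr n) \<and> (\<exists>A. finite A \<and> {n. f n \<noteq> 0} \<subseteq> A \<and> x = sum f A)" for x f
  proof -
    have "sum f A = (\<Sum>n | f n \<noteq> 0. f n)" if "finite A" "{n. f n \<noteq> 0} \<subseteq> A" for A
      using that by (intro sum.mono_neutral_right) auto
    then show ?thesis
      unfolding dec_def by (metis finite_subset order_refl)
  qed
  define \<gamma> where "\<gamma> x = (\<Sum>n | comp x n \<noteq> 0. c n *\<^sub>C comp x n)" for x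
  have \<gamma>_eq: "\<gamma> x = (\<Sum>n\<in>A. c n *\<^sub>C f n)"
    if "\<And>n. f n \<in> gr n" "finite A" "{n. f n \<noteq> 0} \<subseteq> A" "x = sum f A" for x f A
  proof -
    have "comp x = f"
      by (rule comp_eq) (use that in \<open>auto simp: dec_iff\<close>)
    then show ?thesis
      by (simp add: \<gamma>_def, intro sum.mono_neutral_left)
        (use that in \<open>auto simp: complex_vector.scale_zero_right\<close>)
  qed
  have "\<gamma> (x + y) = \<gamma> x + \<gamma> y" for x y
  proof -
    let ?A = "{n. comp x n \<noteq> 0} \<union> {n. comp y n \<noteq> 0}"
    have fin: "finite ?A" using comp[of x] comp[of y] by (simp add: dec_def)
    have x: "x = sum (comp x) ?A" and y: "y = sum (comp y) ?A"
      using comp[of x] comp[of y] fin unfolding dec_def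
      by (auto intro: trans[OF _ sum.mono_neutral_left])
    have in_gr: "comp x n \<in> gr n" "comp y n \<in> gr n" for n
      using comp[of x] comp[of y] by (simp_all add: dec_def)
    have "\<gamma> (x + y) = (\<Sum>n\<in>?A. c n *\<^sub>C (comp x n + comp y n))"
      by (rule \<gamma>_eq)
        (use complex_vector.subspace_add[OF sub in_gr] fin x y in \<open>auto simp: sum.distrib\<close>)
    moreover have "\<gamma> x = (\<Sum>n\<in>?A. c n *\<^sub>C comp x n)"
      by (rule \<gamma>_eq) (use in_gr fin x in auto)
    moreover have "\<gamma> y = (\<Sum>n\<in>?A. c n *\<^sub>C comp y n)"
      by (rule \<gamma>_eq) (use in_gr fin y in auto)
    ultimately show ?thesis by (simp add: scaleC_add_right sum.distrib)
  qed
  moreover have "\<gamma> (d *\<^sub>C x) = d *\<^sub>C \<gamma> x" for d x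
  proof -
    have "\<gamma> (d *\<^sub>C x) = (\<Sum>n | comp x n \<noteq> 0. c n *\<^sub>C d *\<^sub>C comp x n)"
    proof (rule \<gamma>_eq)
      show "d *\<^sub>C x = (\<Sum>n | comp x n \<noteq> 0. d *\<^sub>C comp x n)"
        using comp[of x] unfolding dec_def by (metis complex_vector.scale_sum_right)
    qed (use comp[of x] sub in \<open>auto simp: dec_def complex_vector.subspace_scale
        complex_vector.scale_zero_right\<close>)
    then show ?thesis
      by (simp add: \<gamma>_def complex_vector.scale_sum_right scaleC_scaleC mult.commute)
  qed
  ultimately have "clinear \<gamma>" by (simp add: clinear_iff)
  moreover have "\<gamma> x = c n *\<^sub>C x" if "x \<in> gr n" for n x
  proof -
    have "\<gamma> x = (\<Sum>m\<in>{n}. c m *\<^sub>C (if m = n then x else 0))"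
      by (rule \<gamma>_eq) (use that sub complex_vector.subspace_0 in auto)
    then show ?thesis by simp
  qed
  ultimately show ?thesis using that by blast
qed

section \<open>The grading involution on horizontal forms\<close>

context horizontal_forms
begin

lemma clinear_Fh [clin]: "clinear k \<Longrightarrow> clinear (\<lambda>x. Fh (k x))"
  by (rule clinear_comp[OF unital_star_homD(1)[OF Fh_hom]])

lemmas Fh_simps = unital_star_homD(2-)[OF Fh_hom] clinear_add[OF unital_star_homD(1)[OF Fh_hom]]
  clinear_scaleC[OF unital_star_homD(1)[OF Fh_hom]]

text \<open>Replaces the sign of a homogeneous factor by a linear map, so that graded identities can
  be stated for arbitrary elements and extended to tensor products by
  \<open>tensor_map\<close>.\<close>

definition grade_inv :: "'h \<Rightarrow> 'h" where
  "grade_inv = (SOME \<gamma>. clinear \<gamma> \<and> (\<forall>n. \<forall>\<phi>\<in>hor n. \<gamma> \<phi> = (- 1) ^ n *\<^sub>C \<phi>))"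

lemma grade_inv: "clinear grade_inv" "\<phi> \<in> hor n \<Longrightarrow> grade_inv \<phi> = (- 1) ^ n *\<^sub>C \<phi>"
proof -
  have "\<exists>\<gamma>. clinear \<gamma> \<and> (\<forall>n. \<forall>\<phi>\<in>hor n. \<gamma> \<phi> = (- 1) ^ n *\<^sub>C \<phi>)"
    using graded_scale_exists[OF hor_graded, of "\<lambda>n. (- 1) ^ n"] by metis
  from someI_ex[OF this]
  show "clinear grade_inv" "\<phi> \<in> hor n \<Longrightarrow> grade_inv \<phi> = (- 1) ^ n *\<^sub>C \<phi>"
    unfolding grade_inv_def by blast+
qed

lemma clinear_grade_inv [clin]: "clinear k \<Longrightarrow> clinear (\<lambda>x. grade_inv (k x))"
  by (rule clinear_comp[OF grade_inv(1)])

lemma one_hor: "1 \<in> hor 0"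
  using inB_range unital_star_homD(2)[OF inB_hom] by (metis rangeI)

lemma grade_inv_one: "grade_inv 1 = 1"
  using grade_inv(2)[OF one_hor] by (simp add: scaleC_one)

lemma grade_inv_mult: "grade_inv (\<phi> * \<psi>) = grade_inv \<phi> * grade_inv \<psi>"
proof (induction \<phi> rule: graded_induct[OF hor_graded])
  case (1 m \<phi>)
  show ?case
  proof (induction \<psi> rule: graded_induct[OF hor_graded])
    case (1 n \<psi>)
    then show ?case using \<open>\<phi> \<in> hor m\<close>
      by (simp add: grade_inv(2) grade_inv(2)[OF hor_mult] mult_scaleC_left mult_scaleC_right
          scaleC_scaleC power_add mult.commute)
  qed (simp_all add: algebra_simps clinear_add[OF grade_inv(1)])
qed (simp_all add: algebra_simps clinear_add[OF grade_inv(1)])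

lemma grade_inv_hor: "\<phi> \<in> hor n \<Longrightarrow> grade_inv \<phi> \<in> hor n"
  using graded_decompositionD[OF hor_graded]
  by (simp add: grade_inv(2) complex_vector.subspace_scale)

text \<open>The coaction keeps its first leg in the degree of \<open>\<phi>\<close>, so on
  homogeneous \<open>\<phi>\<close> both sides multiply \<open>Fh \<phi>\<close> by the same
  sign.\<close>

lemma Fh_grade_inv: "Fh (grade_inv \<phi>) = tensor_map grade_inv id (Fh \<phi>)"
proof (induction \<phi> rule: graded_induct[OF hor_graded])
  case (1 n \<phi>)
  have "tensor_map grade_inv id (Fh \<phi>) = (- 1) ^ n *\<^sub>C Fh \<phi>"
    by (rule span_linear_eqI[OF Fh_graded[OF 1]])
      (auto simp: clin grade_inv(2) tensor_pure_linear)
  then show ?case by (simp only: grade_inv(2)[OF 1] Fh_simps)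
qed (simp_all add: Fh_simps clinear_add[OF grade_inv(1)] clin)

end

section \<open>Embedding the affine horizontal forms\<close>

context affine_horizontal_forms
begin

definition FA :: "'h \<Rightarrow> 'h \<otimes> 't" where
  "FA \<phi> = tensor_map id inA (Fh \<phi>)"

definition iS :: "'s \<Rightarrow> 'h \<otimes> 't" where
  "iS s = 1 \<otimes> inS s"

lemma clinear_FA [clin]: "clinear k \<Longrightarrow> clinear (\<lambda>x. FA (k x))"
  and clinear_iS [clin]: "clinear k' \<Longrightarrow> clinear (\<lambda>x. iS (k' x))"
  by (simp_all add: FA_def iS_def clin)

lemma FA_simps: "FA 1 = 1" "FA (\<phi> * \<psi>) = FA \<phi> * FA \<psi>" "FA (star \<phi>) = star (FA \<phi>)"
  by (simp_all add: FA_def Fh_simps one_tensor_def clin inA_simps tensor_map_mult tensor_map_star)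

lemma iS_simps: "iS 1 = 1" "iS (s * s') = iS s * iS s'" "iS (star s) = star (iS s)"
proof -
  \<comment> \<open>The star of \<open>'h\<close> obeys only the graded product rule; its value at 1
    is imported from the star-algebra of the bundle through \<open>inB\<close>.\<close>
  have "star (1::'h) = 1"
    using unital_star_homD(2)[OF inB_hom] unital_star_homD(4)[OF inB_hom, of 1]
    by (metis complex_star_algebra_1_class.star_mult mult.right_neutral mult_1 star_star)
  then show "iS 1 = 1" "iS (s * s') = iS s * iS s'" "iS (star s) = star (iS s)"
    by (simp_all add: iS_def inS_simps one_tensor_def times_tensor_pure star_tensor_pure)
qed

lemma FA_iS: "FA \<phi> * iS s = tensor_lift (\<lambda>\<psi> c. \<psi> \<otimes> (inA c * inS s)) (Fh \<phi>)"
  unfolding FA_def tensor_map_def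
  by (simp add: clinear_tensor_lift_apply[where h = "\<lambda>x. x * y" for y] clin iS_def times_tensor_pure)

text \<open>The exchange rule of the twisted product, now inside an ordinary tensor product. Moving
  \<open>inS s\<close> past \<open>inA c\<close> splits \<open>c\<close>, and coassociativity of
  \<open>Fh\<close> turns this split into a second coaction, which is the one hidden in
  \<open>FA \<psi>\<close>.\<close>

lemma iS_FA: "iS s * FA \<phi> = tensor_lift (\<lambda>\<psi> c. FA \<psi> * iS (actS s c)) (Fh \<phi>)"
proof -
  have "iS s * FA \<phi> = tensor_lift (\<lambda>\<psi> c. \<psi> \<otimes> (inS s * inA c)) (Fh \<phi>)"
    unfolding FA_def tensor_map_def
    by (simp add: clinear_tensor_lift_apply[where h = "\<lambda>x. y * x" for y] clin iS_def times_tensor_pure)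
  also have "\<dots> = tensor_lift (\<lambda>\<psi> c. tensor_lift (\<lambda>c\<^sub>1 c\<^sub>2.
      \<psi> \<otimes> (inA c\<^sub>1 * inS (actS s c\<^sub>2))) (\<Delta> c)) (Fh \<phi>)"
    by (simp add: inS_inA clinear_tensor_lift_apply[where h = "\<lambda>x. y \<otimes> x" for y] clin)
  also have "\<dots> = tensor_lift (\<lambda>\<psi> c. tensor_lift (\<lambda>\<psi>' c'.
      \<psi>' \<otimes> (inA c' * inS (actS s c))) (Fh \<psi>)) (Fh \<phi>)"
    by (rule tensor_lift_assoc) (simp_all add: clin Fh_coassoc)
  finally show ?thesis by (simp add: FA_iS)
qed

text \<open>
  \<open>emb\<close> embeds the twisted algebra into an ordinary tensor product of algebras, which reduces
  all computations with the twisted product and star to associative ones.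
\<close>

definition emb :: "'h \<otimes> 's \<Rightarrow> 'h \<otimes> 't" where
  "emb = tensor_lift (\<lambda>\<phi> s. FA \<phi> * iS s)"

lemma clinear_emb [clin]: "clinear k \<Longrightarrow> clinear (\<lambda>x. emb (k x))"
  by (simp add: emb_def clin)

lemma emb_add: "emb (x + y) = emb x + emb y"
  and emb_scaleC: "emb (c *\<^sub>C x) = c *\<^sub>C emb x"
  using clinear_emb[OF clinear_ident(1)] by (simp_all add: clinear_iff)

lemma emb_pure: "emb (\<phi> \<otimes> s) = FA \<phi> * iS s"
  by (simp add: emb_def clin tensor_lift_pure)

definition proj_emb :: "'h \<otimes> 't \<Rightarrow> 'h \<otimes> 's" where
  "proj_emb = tensor_map id pr_S"

lemma clinear_proj_emb [clin]: "clinear k \<Longrightarrow> clinear (\<lambda>x. proj_emb (k x))"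
  by (simp add: proj_emb_def clin)

text \<open>\<open>pr_S\<close> applies \<epsilon> to the leg in \<open>'a\<close> and leaves
  \<open>s\<close>; the counit law of \<open>Fh\<close> then returns \<open>\<phi>\<close>.\<close>

lemma proj_emb: "proj_emb (emb x) = x"
proof (rule tensor_linear_eqI)
  fix \<phi> s
  have "proj_emb (emb (\<phi> \<otimes> s)) = tensor_lift (\<lambda>\<psi> c. \<psi> \<otimes> (\<epsilon> c *\<^sub>C s)) (Fh \<phi>)"
    by (simp add: proj_emb_def emb_pure FA_iS clinear_tensor_lift_apply clin pr_S_mult)
  also have "\<dots> = tensor_lift (\<lambda>\<psi> c. \<epsilon> c *\<^sub>C \<psi>) (Fh \<phi>) \<otimes> s"
    by (simp add: clinear_tensor_lift_apply[where h = "\<lambda>x. x \<otimes> y" for y] clin tensor_pure_linear)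
  finally show "proj_emb (emb (\<phi> \<otimes> s)) = \<phi> \<otimes> s" by (simp add: Fh_counit)
qed (simp_all add: clin)

lemma emb_inj: "emb x = emb y \<Longrightarrow> x = y"
  by (metis proj_emb)

abbreviation amult (infixl "\<star>" 70) where
  "amult \<equiv> aff_mult Fh actS"

abbreviation astar where
  "astar \<equiv> aff_star Fh actS"

lemma clinear_amult [clin]:
  "clinear k \<Longrightarrow> clinear (\<lambda>x. k x \<star> y)" "clinear k \<Longrightarrow> clinear (\<lambda>x. y \<star> k x)"
  by (simp_all add: aff_mult_def clin)

lemma amult_pure: "(\<psi> \<otimes> \<theta>) \<star> (\<phi> \<otimes> \<eta>) =
    tensor_lift (\<lambda>\<phi>\<^sub>k c\<^sub>k. (\<psi> * \<phi>\<^sub>k) \<otimes> (actS \<theta> c\<^sub>k * \<eta>)) (Fh \<phi>)"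
  by (simp add: aff_mult_def clin tensor_lift_pure)

text \<open>In \<open>FA \<psi> * iS \<theta> * FA \<phi> * iS \<eta>\<close> the two middle factors
  are exchanged by \<open>iS_FA\<close>, with the same Sweedler sum as in the definition of the
  twisted product.\<close>

lemma emb_amult: "emb (x \<star> y) = emb x * emb y"
proof (rule tensor_linear_eqI2[of "\<lambda>x y. emb (x \<star> y)" "\<lambda>x y. emb x * emb y"])
  fix \<psi> \<theta> \<phi> \<eta>
  have "emb ((\<psi> \<otimes> \<theta>) \<star> (\<phi> \<otimes> \<eta>)) =
      tensor_lift (\<lambda>\<phi>\<^sub>k c\<^sub>k. FA \<psi> * (FA \<phi>\<^sub>k * iS (actS \<theta> c\<^sub>k)) * iS \<eta>) (Fh \<phi>)"
    by (simp add: amult_pure clinear_tensor_lift_apply clin emb_pure FA_simps iS_simps mult.assoc)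
  also have "\<dots> = FA \<psi> * (iS \<theta> * FA \<phi>) * iS \<eta>"
    by (simp add: iS_FA clinear_tensor_lift_apply[where h = "\<lambda>x. y * x * z" for y z] clin)
  finally show "emb ((\<psi> \<otimes> \<theta>) \<star> (\<phi> \<otimes> \<eta>)) = emb (\<psi> \<otimes> \<theta>) * emb (\<phi> \<otimes> \<eta>)"
    by (simp add: emb_pure mult.assoc)
qed (simp_all add: clin)

lemma amult_pure_one: "(\<phi> \<otimes> 1) \<star> (1 \<otimes> s) = \<phi> \<otimes> s"
  by (rule emb_inj) (simp add: emb_amult emb_pure FA_simps iS_simps)

text \<open>The star of \<open>'h\<close> reverses products of homogeneous forms only up to a sign,
  but \<open>iS s\<close> has horizontal component 1, so no sign arises here.\<close>

lemma star_mult_iS: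
  fixes X :: "'h \<otimes> 't"
  shows "star (X * iS s) = iS (star s) * star X"
proof (induction X rule: tensor_induct)
  case (pure x y)
  show ?case
    by (simp add: iS_def inS_simps times_tensor_pure star_tensor_pure star_mult)
qed (simp_all add: algebra_simps star_add)

text \<open>An antilinear lift is a linear lift preceded by \<open>star\<close>, and
  \<open>Fh\<close> commutes with \<open>star\<close>. Hence the Sweedler sum in the twisted star is
  the one created by the twisted product when \<open>star s\<close> passes
  \<open>star \<phi>\<close>.\<close>

lemma astar_pure: "astar (\<phi> \<otimes> s) = (1 \<otimes> star s) \<star> (star \<phi> \<otimes> 1)"
  and semilinear_astar: "semilinear cnj astar"
proof -
  let ?h = "\<lambda>r. tensor_lift (\<lambda>\<psi> c. \<psi> \<otimes> actS r c)"
  have r: "clinear (\<lambda>r. ?h r t)" and t: "clinear (?h r)" for r t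
    by (simp_all add: clin)
  have a: "clinear (actS r)" for r
    by (simp add: clin)
  have b: "semibilinear cnj (\<lambda>(\<psi>::'h) c. star \<psi> \<otimes> actS r (star c))" for r
    by (simp add: semibilinear_def semilinear_def star_add star_scaleC tensor_pure_linear
        clinear_add[OF a] clinear_scaleC[OF a])
  have c: "tensor_conj_lift (\<lambda>(\<psi>::'h) c. star \<psi> \<otimes> actS r (star c)) u = ?h r (star u)" for r u
  proof (induction u rule: tensor_induct)
    case (pure x y)
    then show ?case
      by (simp add: tensor_conj_lift_pure b star_tensor_pure tensor_lift_pure clin)
  next
    case (add u v)
    then show ?case
      using semilinear_tensor_conj_lift[OF b, of r]
      by (simp add: semilinear_def star_add clinear_add[OF t])
  qed
  have "semibilinear cnj (\<lambda>\<phi> \<theta>. ?h (star \<theta>) (star (Fh \<phi>)))"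
    by (simp add: semibilinear_def semilinear_def star_add star_scaleC Fh_simps
        clinear_add[OF t] clinear_scaleC[OF t] clinear_add[OF r] clinear_scaleC[OF r])
  then show "semilinear cnj astar" and "astar (\<phi> \<otimes> s) = (1 \<otimes> star s) \<star> (star \<phi> \<otimes> 1)"
    by (simp_all add: aff_star_def c tensor_conj_lift_pure amult_pure Fh_simps
        semilinear_tensor_conj_lift)
qed

lemma emb_astar: "emb (astar x) = star (emb x)"
proof (induction x rule: tensor_induct)
  case (pure \<phi> s)
  show ?case
    by (simp add: astar_pure emb_amult emb_pure FA_simps iS_simps star_mult_iS)
next
  case (add x y)
  then show ?case
    using semilinear_astar by (simp add: semilinear_def star_add emb_add)
qed

section \<open>Horizontal degrees of twisted products\<close>

lemma subspace_aff_grade: "csubspace (aff_grade hor n)"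
  by (simp add: aff_grade_def)

lemma aff_grade_add: "x \<in> aff_grade hor n \<Longrightarrow> y \<in> aff_grade hor n \<Longrightarrow> x + y \<in> aff_grade hor n"
  by (rule complex_vector.subspace_add[OF subspace_aff_grade])

lemma aff_grade_pure: "\<phi> \<in> hor n \<Longrightarrow> \<phi> \<otimes> s \<in> aff_grade hor n"
  unfolding aff_grade_def by (rule complex_vector.span_base) blast

lemma aff_grade_mult:
  assumes "x \<in> aff_grade hor m" "y \<in> aff_grade hor n"
  shows "x \<star> y \<in> aff_grade hor (m + n)"
proof -
  note sub = subspace_aff_grade[of "m + n"]
  have 0: "(\<psi> \<otimes> \<theta>) \<star> (\<phi> \<otimes> \<eta>) \<in> aff_grade hor (m + n)" if "\<psi> \<in> hor m" "\<phi> \<in> hor n" for \<psi> \<theta> \<phi> \<eta>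
  proof -
    let ?f = "tensor_lift (\<lambda>\<phi>\<^sub>k c\<^sub>k. (\<psi> * \<phi>\<^sub>k) \<otimes> (actS \<theta> c\<^sub>k * \<eta>))"
    have "?f (Fh \<phi>) \<in> aff_grade hor (m + n)"
    proof (rule span_linear_mem[OF Fh_graded[OF that(2)] _ sub])
      fix t :: "'h \<otimes> 'a" assume "t \<in> {\<psi> \<otimes> a | \<psi> a. \<psi> \<in> hor n}"
      then obtain \<psi>' a where "t = \<psi>' \<otimes> a" "\<psi>' \<in> hor n" by blast
      then show "?f t \<in> aff_grade hor (m + n)"
        using aff_grade_pure[OF hor_mult[OF that(1)]] by (simp add: tensor_lift_pure clin)
    qed (simp add: clin)
    then show ?thesis by (simp add: amult_pure)
  qed
  have 1: "(\<psi> \<otimes> \<theta>) \<star> y \<in> aff_grade hor (m + n)" if "\<psi> \<in> hor m" for \<psi> \<theta>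
    by (rule span_linear_mem[OF assms(2)[unfolded aff_grade_def] _ sub])
      (use 0[OF that] in \<open>auto simp: clin\<close>)
  show ?thesis
    by (rule span_linear_mem[OF assms(1)[unfolded aff_grade_def] _ sub, of "\<lambda>x. x \<star> y"])
      (use 1 in \<open>auto simp: clin\<close>)
qed

end

section \<open>The extension of an antiderivation\<close>

locale affine_antiderivation =
  affine_horizontal_forms \<Delta> \<epsilon> \<kappa> lmul rmul lco rco incl coV actV proj coS actS
    \<Delta>' \<epsilon>' \<kappa>' inA inS hatS F inB hor Fh dM H
  for \<Delta> :: "'a::complex_star_algebra_1 \<Rightarrow> 'a \<otimes> 'a"
    and \<epsilon> :: "'a \<Rightarrow> complex"
    and \<kappa> :: "'a \<Rightarrow> 'a"
    and lmul :: "'a \<Rightarrow> 'p::complex_star_vector \<Rightarrow> 'p"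
    and rmul :: "'p \<Rightarrow> 'a \<Rightarrow> 'p"
    and lco :: "'p \<Rightarrow> 'a \<otimes> 'p"
    and rco :: "'p \<Rightarrow> 'p \<otimes> 'a"
    and incl :: "'v::complex_star_vector \<Rightarrow> 'p"
    and coV :: "'v \<Rightarrow> 'v \<otimes> 'a"
    and actV :: "'v \<Rightarrow> 'a \<Rightarrow> 'v"
    and proj :: "'v tensor_algebra \<Rightarrow> 's::complex_star_algebra_1"
    and coS :: "'s \<Rightarrow> 's \<otimes> 'a"
    and actS :: "'s \<Rightarrow> 'a \<Rightarrow> 's"
    and \<Delta>' :: "'t::complex_star_algebra_1 \<Rightarrow> 't \<otimes> 't"
    and \<epsilon>' :: "'t \<Rightarrow> complex"
    and \<kappa>' :: "'t \<Rightarrow> 't"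
    and inA :: "'a \<Rightarrow> 't"
    and inS :: "'s \<Rightarrow> 't"
    and hatS :: "'s \<Rightarrow> 's \<otimes> 't"
    and F :: "'b::complex_star_algebra_1 \<Rightarrow> 'b \<otimes> 'a"
    and inB :: "'b \<Rightarrow> 'h::{complex_algebra_1,complex_star_vector}"
    and hor :: "nat \<Rightarrow> 'h set"
    and Fh :: "'h \<Rightarrow> 'h \<otimes> 'a"
    and dM :: "'h \<Rightarrow> 'h"
    and H :: "('h \<otimes> 's) \<Rightarrow> ('h \<otimes> 's) \<otimes> 't" +
  fixes lam :: "'v \<Rightarrow> 'h"
    and D :: "'h \<Rightarrow> 'h"
  assumes lam_linear: "clinear lam"
    and lam_degree: "range lam \<subseteq> hor 1"
    and lam_covariant: "\<And>\<theta>. Fh (lam \<theta>) = tensor_map lam id (coV \<theta>)"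
    and lam_commute: "\<And>\<theta> n \<phi>. \<phi> \<in> hor n \<Longrightarrow> lam \<theta> * \<phi> =
      (- 1) ^ n *\<^sub>C tensor_lift (\<lambda>\<phi>\<^sub>k c\<^sub>k. \<phi>\<^sub>k * lam (actV \<theta> c\<^sub>k)) (Fh \<phi>)"
    and D_antiderivation: "first_order_antiderivation (*) hor D"
    and D_covariant: "\<And>\<phi>. Fh (D \<phi>) = tensor_map D id (Fh \<phi>)"
begin

lemma clinear_lam [clin]: "clinear k \<Longrightarrow> clinear (\<lambda>x. lam (k x))"
  by (rule clinear_comp[OF lam_linear])

lemma D_linear: "clinear D"
  and D_degree: "\<phi> \<in> hor n \<Longrightarrow> D \<phi> \<in> hor (Suc n)"
  using D_antiderivation by (simp_all add: first_order_antiderivation_def)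

lemma clinear_D [clin]: "clinear k \<Longrightarrow> clinear (\<lambda>x. D (k x))"
  by (rule clinear_comp[OF D_linear])

lemma D_mult: "D (\<phi> * \<psi>) = D \<phi> * \<psi> + grade_inv \<phi> * D \<psi>"
proof (induction \<phi> rule: graded_induct[OF hor_graded])
  case (1 n \<phi>)
  then show ?case
    using D_antiderivation
    by (simp add: first_order_antiderivation_def grade_inv(2) mult_scaleC_left)
qed (simp add: algebra_simps clinear_add[OF grade_inv(1)] clinear_add[OF D_linear])

lemma D_one: "D 1 = 0"
  using D_mult[of 1 1] by (simp add: grade_inv_one)

section \<open>Graded derivations with values in the ordinary tensor product\<close>

definition gradeT :: "'h \<otimes> 't \<Rightarrow> 'h \<otimes> 't" where
  "gradeT = tensor_map grade_inv id"

lemma clinear_gradeT [clin]: "clinear k \<Longrightarrow> clinear (\<lambda>x. gradeT (k x))"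
  by (simp add: gradeT_def clin)

lemma gradeT_mult: "gradeT (X * Y) = gradeT X * gradeT Y"
  by (simp add: gradeT_def tensor_map_mult clin grade_inv_mult)

lemma gradeT_FA: "gradeT (FA \<phi>) = FA (grade_inv \<phi>)"
  by (simp add: gradeT_def FA_def Fh_grade_inv tensor_map_map clin)

lemma gradeT_iS: "gradeT (iS s) = iS s"
  by (simp add: gradeT_def iS_def clin grade_inv_one)

lemma FA_D: "FA (D \<phi>) = tensor_map D id (FA \<phi>)"
  by (simp add: FA_def D_covariant tensor_map_map clin)

lemma tensor_D_mult:
  "tensor_map D id (X * Y) = tensor_map D id X * Y + gradeT X * tensor_map D id Y"
  for X Y :: "'h \<otimes> 't"
  by (rule tensor_linear_eqI2[of "\<lambda>X Y. tensor_map D id (X * Y)"])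
    (simp_all add: clin times_tensor_pure gradeT_def D_mult tensor_pure_linear)

lemma tensor_D_iS: "tensor_map D id (iS s) = 0"
  by (simp add: iS_def clin D_one) (metis complex_vector.scale_zero_left tensor_pure_linear(3))

text \<open>
  \<open>symD s\<close> will be \<open>emb\<close> of the value of the extension at \<open>1 \<otimes> s\<close>. Defining it by the coproduct of
  the affine quantum group makes it well defined on the braided symmetric algebra.
\<close>

definition symD :: "'s \<Rightarrow> 'h \<otimes> 't" where
  "symD s = tensor_map (\<lambda>r. lam (sym_one r)) id (hatS s)"

lemma clinear_symD [clin]: "clinear k \<Longrightarrow> clinear (\<lambda>x. symD (k x))"
  by (simp add: symD_def clin)

text \<open>In the Leibniz rule for \<open>sym_one\<close> one factor is hit by the counit; on the
  left leg of \<open>hatS s\<close> the counit law reduces this to \<open>iS s\<close>.\<close>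

lemma hatS_counit_map: "tensor_map (\<lambda>r. \<epsilon>' (inS r) *\<^sub>C 1) id (hatS s) = iS s"
proof -
  have "iS s = 1 \<otimes> tensor_lift (\<lambda>r t. \<epsilon>' (inS r) *\<^sub>C t) (hatS s)"
    by (simp add: iS_def hatS_counit)
  also have "\<dots> = tensor_lift (\<lambda>r t. 1 \<otimes> (\<epsilon>' (inS r) *\<^sub>C t)) (hatS s)"
    by (rule clinear_tensor_lift_apply) (simp_all add: clin)
  finally show ?thesis
    by (simp add: tensor_map_def tensor_pure_linear)
qed

text \<open>\<open>lam\<close> after \<open>sym_one\<close> is a derivation relative to the counit
  and \<open>hatS\<close> is multiplicative; the factor hit by the counit becomes \<open>iS\<close>.
  There is no sign because \<open>iS s\<close> has horizontal degree 0.\<close>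

lemma symD_mult: "symD (s * s') = symD s * iS s' + iS s * symD s'"
proof -
  let ?m = "tensor_map (\<lambda>r. lam (sym_one r)) id :: 's \<otimes> 't \<Rightarrow> 'h \<otimes> 't"
  let ?e = "tensor_map (\<lambda>r. \<epsilon>' (inS r) *\<^sub>C 1) id :: 's \<otimes> 't \<Rightarrow> 'h \<otimes> 't"
  have "?m (X * Y) = ?m X * ?e Y + ?e X * ?m Y" for X Y :: "'s \<otimes> 't"
    by (rule tensor_linear_eqI2[of "\<lambda>X Y. ?m (X * Y)"])
      (simp_all add: clin times_tensor_pure sym_one_mult tensor_pure_linear clinear_add[OF lam_linear]
        clinear_scaleC[OF lam_linear] mult_scaleC_left mult_scaleC_right)
  then show ?thesis
    by (simp add: symD_def hatS_mult hatS_counit_map)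
qed

text \<open>The summand of \<open>hatS_gen\<close> with left leg 1 has no degree-one part; the other
  one becomes \<open>FA (lam \<theta>)\<close> by covariance of \<open>lam\<close>.\<close>

lemma symD_gen: "symD (proj (gen \<theta>)) = FA (lam \<theta>)"
proof -
  have "sym_one 1 = 0"
    by (metis proj_simps(1) sym_one_proj one_tensor_algebra_def degree_one_word list.size(3) zero_neq_one)
  then have "lam (sym_one 1) \<otimes> t = 0" for t :: 't
    by (metis clinear_zero[OF lam_linear] complex_vector.scale_zero_left tensor_pure_linear(3))
  then have "symD (proj (gen \<theta>)) = tensor_map lam inA (coV \<theta>)"
    by (simp add: symD_def hatS_gen clin tensor_map_map sym_one_proj degree_one_word)
  then show ?thesis
    by (simp add: FA_def lam_covariant tensor_map_map clin)
qed

lemma symD_one: "symD 1 = 0"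
  using symD_mult[of 1 1] by (simp add: iS_simps)

text \<open>\<open>Fh\<close> commutes with the grading involution, so the sign of the commutation
  rule can be moved inside the Sweedler sum, which frees the rule from homogeneity.\<close>

lemma lam_commute_grade_inv:
  "lam \<theta> * \<phi> = tensor_lift (\<lambda>\<phi>\<^sub>k c\<^sub>k. grade_inv \<phi>\<^sub>k * lam (actV \<theta> c\<^sub>k)) (Fh \<phi>)"
proof (induction \<phi> rule: graded_induct[OF hor_graded])
  case (1 n \<phi>)
  let ?f = "\<lambda>\<psi> c. \<psi> * lam (actV \<theta> c)"
  have f: "cbilinear ?f" by (simp add: clin)
  have "tensor_lift (\<lambda>\<psi> c. ?f (grade_inv \<psi>) c) (Fh \<phi>) = tensor_lift ?f (Fh (grade_inv \<phi>))"
    by (simp add: Fh_grade_inv tensor_lift_map f clin)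
  also have "\<dots> = (- 1) ^ n *\<^sub>C tensor_lift ?f (Fh \<phi>)"
    by (simp add: grade_inv(2)[OF 1] Fh_simps clinear_scaleC[OF clinear_tensor_lift[OF f]])
  finally show ?case by (simp add: lam_commute[OF 1])
qed (simp_all add: algebra_simps Fh_simps clinear_add[OF clinear_tensor_lift] clin)

text \<open>The counterpart of the exchange rule \<open>iS_FA\<close> for \<open>symD\<close>: it
  expresses that the derivation is compatible with the relation defining the twisted product. For a
  generator it is the commutation rule of \<open>lam\<close>; products follow by the Leibniz
  rule.\<close>

lemma symD_FA:
  "symD s * FA \<phi> = tensor_lift (\<lambda>\<psi> c. gradeT (FA \<psi>) * symD (actS s c)) (Fh \<phi>)"
proof (induction s arbitrary: \<phi> rule: sym_induct)
  case one
  have "tensor_lift (\<lambda>(\<psi>::'h) (c::'a). 0 :: 'h \<otimes> 't) x = 0" for x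
    by (rule tensor_linear_eqI) (simp_all add: clin tensor_lift_pure)
  then show ?case
    by (simp add: actS_one clinear_scaleC[of symD] clin symD_one complex_vector.scale_zero_right)
next
  case (gen \<theta> s)
  let ?v = "proj (gen \<theta>)"
  have v: "symD ?v * FA \<phi> = tensor_lift (\<lambda>\<psi> c. gradeT (FA \<psi>) * symD (actS ?v c)) (Fh \<phi>)" for \<phi>
    by (simp add: symD_gen actS_gen gradeT_FA FA_simps(2)[symmetric] lam_commute_grade_inv
        clinear_tensor_lift_apply[of FA] clin)
  have iv: "iS ?v * gradeT (FA \<phi>) =
      tensor_lift (\<lambda>\<psi> c. gradeT (FA \<psi>) * iS (actS ?v c)) (Fh \<phi>)" for \<phi>
  proof -
    have "gradeT (iS ?v * FA \<phi>) =
        tensor_lift (\<lambda>\<psi> c. gradeT (FA \<psi> * iS (actS ?v c))) (Fh \<phi>)"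
      unfolding iS_FA by (rule clinear_tensor_lift_apply) (simp_all add: clin)
    then show ?thesis by (simp add: gradeT_mult gradeT_iS)
  qed
  let ?f = "\<lambda>\<psi> c\<^sub>1 c\<^sub>2. gradeT (FA \<psi>) * symD (actS ?v c\<^sub>1) * iS (actS s c\<^sub>2)"
  let ?g = "\<lambda>\<psi> c\<^sub>1 c\<^sub>2. gradeT (FA \<psi>) * iS (actS ?v c\<^sub>1) * symD (actS s c\<^sub>2)"
  have "tensor_lift (\<lambda>\<psi> c. gradeT (FA \<psi>) * symD (actS (?v * s) c)) (Fh \<phi>) =
      tensor_lift (\<lambda>\<psi> c. tensor_lift (\<lambda>c\<^sub>1 c\<^sub>2. ?f \<psi> c\<^sub>1 c\<^sub>2 + ?g \<psi> c\<^sub>1 c\<^sub>2) (\<Delta> c)) (Fh \<phi>)"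
    by (simp add: actS_mult_gen clinear_tensor_lift_apply clin symD_mult algebra_simps)
  \<comment> \<open>Coassociativity turns the split of \<open>c\<close> into a second coaction on
    \<open>\<psi>\<close>; the inner sums then have the form of \<open>v\<close> and
    \<open>iv\<close>.\<close>
  also have "\<dots> = tensor_lift (\<lambda>\<psi> c. tensor_lift (\<lambda>\<psi>' c'. ?f \<psi>' c' c + ?g \<psi>' c' c) (Fh \<psi>)) (Fh \<phi>)"
    by (rule tensor_lift_assoc) (simp_all add: clin Fh_coassoc)
  also have "\<dots> = tensor_lift (\<lambda>\<psi> c. symD ?v * FA \<psi> * iS (actS s c) +
      iS ?v * gradeT (FA \<psi>) * symD (actS s c)) (Fh \<phi>)"
    by (simp add: tensor_lift_add clin v iv clinear_tensor_lift_apply[where h = "\<lambda>x. x * y" for y])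
  also have "\<dots> = symD ?v * (iS s * FA \<phi>) + iS ?v * (symD s * FA \<phi>)"
    by (simp add: tensor_lift_add clin gen.IH iS_FA mult.assoc
        clinear_tensor_lift_apply[where h = "\<lambda>x. y * x" for y])
  finally show ?case
    by (simp add: symD_mult algebra_simps)
next
  case (add s t)
  then show ?case
    by (simp add: clinear_add[OF clinear_actS_left] clinear_add[of symD] clin algebra_simps
        tensor_lift_add)
next
  case (scale c s)
  have "c *\<^sub>C (symD s * FA \<phi>) =
      tensor_lift (\<lambda>\<psi> a. c *\<^sub>C (gradeT (FA \<psi>) * symD (actS s a))) (Fh \<phi>)"
    unfolding scale by (rule clinear_tensor_lift_apply) (simp_all add: clin)
  then show ?case
    by (simp add: clinear_scaleC[OF clinear_actS_left] clinear_scaleC[of symD] clin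
        mult_scaleC_left mult_scaleC_right)
qed

definition embD :: "'h \<otimes> 's \<Rightarrow> 'h \<otimes> 't" where
  "embD x = tensor_map D id (emb x) + tensor_lift (\<lambda>\<phi> s. gradeT (FA \<phi>) * symD s) x"

lemma clinear_embD [clin]: "clinear k \<Longrightarrow> clinear (\<lambda>x. embD (k x))"
  by (simp add: embD_def clin)

lemma embD_pure: "embD (\<phi> \<otimes> s) = FA (D \<phi>) * iS s + gradeT (FA \<phi>) * symD s"
  by (simp add: embD_def emb_pure tensor_D_mult tensor_D_iS FA_D tensor_lift_pure clin)

text \<open>The summand from \<open>D\<close> is a graded derivation of the whole tensor product.
  For the other summand, \<open>symD_FA\<close> and \<open>iS_FA\<close> account for the two terms
  in which the middle factors were exchanged.\<close>

lemma embD_amult: "embD (x \<star> y) = embD x * emb y + gradeT (emb x) * embD y"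
proof -
  let ?L = "tensor_lift (\<lambda>\<phi> s. gradeT (FA \<phi>) * symD s)"
  have "?L (x \<star> y) = ?L x * emb y + gradeT (emb x) * ?L y"
  proof (rule tensor_linear_eqI2[of "\<lambda>x y. ?L (x \<star> y)"])
    fix \<psi> \<theta> \<phi> \<eta>
    have "?L ((\<psi> \<otimes> \<theta>) \<star> (\<phi> \<otimes> \<eta>)) =
        tensor_lift (\<lambda>\<phi>\<^sub>k c\<^sub>k. gradeT (FA \<psi>) * (gradeT (FA \<phi>\<^sub>k) * symD (actS \<theta> c\<^sub>k)) * iS \<eta> +
          gradeT (FA \<psi>) * gradeT (FA \<phi>\<^sub>k * iS (actS \<theta> c\<^sub>k)) * symD \<eta>) (Fh \<phi>)"
      by (simp add: amult_pure clinear_tensor_lift_apply clin tensor_lift_pure FA_simps gradeT_mult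
          gradeT_iS symD_mult algebra_simps)
    also have "\<dots> = gradeT (FA \<psi>) * (symD \<theta> * FA \<phi>) * iS \<eta> +
        gradeT (FA \<psi>) * gradeT (iS \<theta> * FA \<phi>) * symD \<eta>"
      by (simp add: symD_FA iS_FA tensor_lift_add clin clinear_tensor_lift_apply[of gradeT]
          clinear_tensor_lift_apply[where h = "\<lambda>x. y * x * z" for y z])
    finally show "?L ((\<psi> \<otimes> \<theta>) \<star> (\<phi> \<otimes> \<eta>)) =
        ?L (\<psi> \<otimes> \<theta>) * emb (\<phi> \<otimes> \<eta>) + gradeT (emb (\<psi> \<otimes> \<theta>)) * ?L (\<phi> \<otimes> \<eta>)"
      by (simp add: emb_pure tensor_lift_pure clin gradeT_mult algebra_simps)
  qed (simp_all add: clin)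
  then show ?thesis
    by (simp add: embD_def emb_amult tensor_D_mult algebra_simps)
qed

text \<open>A priori \<open>symD s\<close> lies only in the large tensor product. By the Leibniz
  rule it is built from embedded products in which exactly one generator \<open>\<theta>\<close> has
  been replaced by \<open>lam \<theta>\<close>, which also gives the degree.\<close>

lemma symD_range: "\<exists>y \<in> aff_grade hor 1. emb y = symD s"
proof (induction s rule: sym_induct)
  case one
  have "0 \<in> aff_grade hor 1"
    unfolding aff_grade_def by (rule complex_vector.span_zero)
  then show ?case
    using symD_one clinear_zero[OF clinear_emb[OF clinear_ident(1)]] by (intro bexI[of _ 0]) simp_all
next
  case (gen \<theta> s)
  then obtain y where y: "y \<in> aff_grade hor 1" "emb y = symD s" by blast
  have "lam \<theta> \<in> hor 1" using lam_degree by blast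
  then have "(lam \<theta> \<otimes> 1) \<star> (1 \<otimes> s) \<in> aff_grade hor (1 + 0)"
    by (intro aff_grade_mult aff_grade_pure one_hor)
  moreover have "(1 \<otimes> proj (gen \<theta>)) \<star> y \<in> aff_grade hor (0 + 1)"
    by (intro aff_grade_mult aff_grade_pure one_hor y)
  ultimately have "(lam \<theta> \<otimes> 1) \<star> (1 \<otimes> s) + (1 \<otimes> proj (gen \<theta>)) \<star> y \<in> aff_grade hor 1"
    using aff_grade_add by simp
  moreover have "emb ((lam \<theta> \<otimes> 1) \<star> (1 \<otimes> s) + (1 \<otimes> proj (gen \<theta>)) \<star> y) = symD (proj (gen \<theta>) * s)"
    by (simp add: emb_add emb_amult emb_pure FA_simps iS_simps y symD_mult symD_gen)
  ultimately show ?case by blast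
next
  case (add s t)
  then obtain y z where "y \<in> aff_grade hor 1" "emb y = symD s" "z \<in> aff_grade hor 1" "emb z = symD t"
    by blast
  then show ?case
    by (intro bexI[of _ "y + z"])
      (simp_all add: emb_add clinear_add[of symD] clin aff_grade_def complex_vector.span_add)
next
  case (scale c s)
  then obtain y where "y \<in> aff_grade hor 1" "emb y = symD s" by blast
  then show ?case
    by (intro bexI[of _ "c *\<^sub>C y"])
      (simp_all add: emb_scaleC clinear_scaleC[of symD] clin aff_grade_def complex_vector.span_scale)
qed

text \<open>The preimage is dictated by the Leibniz rule for
  \<open>(\<phi> \<otimes> 1) \<star> (1 \<otimes> s)\<close>. It is chosen before \<open>n\<close>,
  so that one witness serves for arbitrary \<open>\<phi>\<close> and carries the degree whenever
  \<open>\<phi>\<close> is homogeneous.\<close>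

lemma embD_range:
  "\<exists>z. emb z = embD (\<phi> \<otimes> s) \<and> (\<forall>n. \<phi> \<in> hor n \<longrightarrow> z \<in> aff_grade hor (Suc n))"
proof -
  obtain y where y: "y \<in> aff_grade hor 1" "emb y = symD s" using symD_range by blast
  let ?z = "D \<phi> \<otimes> s + (grade_inv \<phi> \<otimes> 1) \<star> y"
  have "emb ?z = embD (\<phi> \<otimes> s)"
    by (simp add: emb_add emb_amult emb_pure embD_pure iS_simps gradeT_FA y)
  moreover have "?z \<in> aff_grade hor (Suc n)" if "\<phi> \<in> hor n" for n
  proof (rule aff_grade_add)
    show "D \<phi> \<otimes> s \<in> aff_grade hor (Suc n)"
      by (intro aff_grade_pure D_degree that)
    have "(grade_inv \<phi> \<otimes> 1) \<star> y \<in> aff_grade hor (n + 1)"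
      by (intro aff_grade_mult aff_grade_pure grade_inv_hor that y)
    then show "(grade_inv \<phi> \<otimes> 1) \<star> y \<in> aff_grade hor (Suc n)" by simp
  qed
  ultimately show ?thesis by blast
qed

definition extension :: "'h \<otimes> 's \<Rightarrow> 'h \<otimes> 's" where
  "extension x = proj_emb (embD x)"

lemma clinear_extension [clin]: "clinear k \<Longrightarrow> clinear (\<lambda>x. extension (k x))"
  by (simp add: extension_def clin)

text \<open>\<open>proj_emb\<close> inverts \<open>emb\<close> on its range, and \<open>embD\<close>
  takes its values there.\<close>

lemma emb_ext: "emb (extension x) = embD x"
proof (rule tensor_linear_eqI[of "\<lambda>x. emb (extension x)"])
  show "emb (extension (\<phi> \<otimes> s)) = embD (\<phi> \<otimes> s)" for \<phi> s
    using embD_range[of \<phi> s] by (metis extension_def proj_emb)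
qed (simp_all add: clin)

lemma extension_degree: "x \<in> aff_grade hor n \<Longrightarrow> extension x \<in> aff_grade hor (Suc n)"
  unfolding aff_grade_def[of hor n]
proof (erule span_linear_mem)
  fix b assume "b \<in> {\<phi> \<otimes> s |\<phi> (s::'s). \<phi> \<in> hor n}"
  then show "extension b \<in> aff_grade hor (Suc n)"
    using embD_range by (auto simp: extension_def) (metis proj_emb)
qed (simp_all add: clin aff_grade_def)

definition gradeS :: "'h \<otimes> 's \<Rightarrow> 'h \<otimes> 's" where
  "gradeS = tensor_map grade_inv id"

lemma clinear_gradeS [clin]: "clinear k \<Longrightarrow> clinear (\<lambda>x. gradeS (k x))"
  by (simp add: gradeS_def clin)

lemma gradeS_pure: "gradeS (\<phi> \<otimes> s) = grade_inv \<phi> \<otimes> s"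
  by (simp add: gradeS_def clin)

lemma emb_gradeS: "emb (gradeS x) = gradeT (emb x)"
  by (rule tensor_linear_eqI[of "\<lambda>x. emb (gradeS x)"])
    (simp_all add: clin gradeS_pure emb_pure gradeT_mult gradeT_FA gradeT_iS)

lemma gradeS_eq: "x \<in> aff_grade hor n \<Longrightarrow> gradeS x = (- 1) ^ n *\<^sub>C x"
  unfolding aff_grade_def
  by (erule span_linear_eqI) (auto simp: clin gradeS_pure grade_inv(2) tensor_pure_linear)

lemma extension_amult: "extension (x \<star> y) = extension x \<star> y + gradeS x \<star> extension y"
  by (rule emb_inj) (simp add: emb_ext embD_amult emb_add emb_amult emb_gradeS)

lemma extension_hor: "extension (\<phi> \<otimes> 1) = D \<phi> \<otimes> 1"
  by (rule emb_inj) (simp add: emb_ext embD_pure emb_pure symD_one)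

lemma gradeT_one: "gradeT 1 = 1"
  using gradeT_iS[of 1] by (simp add: iS_simps)

lemma embD_sym: "embD (1 \<otimes> s) = symD s"
  using clinear_zero[OF clinear_FA[OF clinear_ident(1)]]
  by (simp add: embD_pure D_one gradeT_one FA_simps)

lemma extension_gen: "extension (1 \<otimes> proj (gen \<theta>)) = lam \<theta> \<otimes> 1"
  by (rule emb_inj) (simp add: emb_ext embD_sym symD_gen emb_pure iS_simps)

lemma extends_extension: "extends_antiderivation Fh actS hor proj lam D extension"
  unfolding extends_antiderivation_def first_order_antiderivation_def
  by (simp add: clin extension_degree extension_hor extension_gen extension_amult gradeS_eq clinear_scaleC[of "\<lambda>x. x \<star> y" for y])

section \<open>Uniqueness of the extension\<close>

lemma sym_amult: "(1 \<otimes> s) \<star> (1 \<otimes> s') = 1 \<otimes> (s * s')"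
  by (rule emb_inj) (simp add: emb_amult emb_pure FA_simps iS_simps)

lemma extension_unique:
  assumes "extends_antiderivation Fh actS hor proj lam D D'"
  shows "D' = extension"
proof -
  have lin: "clinear D'" and hor: "D' (\<phi> \<otimes> 1) = D \<phi> \<otimes> 1" and gen: "D' (1 \<otimes> proj (gen \<theta>)) = lam \<theta> \<otimes> 1"
    and mult: "x \<in> aff_grade hor n \<Longrightarrow> D' (x \<star> y) = D' x \<star> y + (- 1) ^ n *\<^sub>C (x \<star> D' y)"
    for \<phi> \<theta> x y n
    using assms unfolding extends_antiderivation_def first_order_antiderivation_def
    by (simp_all only: simp_thms)
  \<comment> \<open>Agreement passes to products as soon as the left factor is homogeneous; the left
    factors used are \<open>1 \<otimes> proj (gen \<theta>)\<close>, of horizontal degree 0, and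
    \<open>\<phi> \<otimes> 1\<close> with \<open>\<phi>\<close> homogeneous.\<close>
  have mult': "D' (x \<star> y) = extension (x \<star> y)"
    if "x \<in> aff_grade hor n" "D' x = extension x" "D' y = extension y" for x y n
    using that by (simp add: mult extension_amult gradeS_eq clinear_scaleC[of "\<lambda>x. x \<star> y" for y] clin)
  have sym: "D' (1 \<otimes> s) = extension (1 \<otimes> s)" for s
  proof (induction s rule: sym_induct)
    case (gen \<theta> s)
    then show ?case
      using mult'[OF aff_grade_pure[OF one_hor], of "proj (gen \<theta>)" "1 \<otimes> s"]
      by (simp add: \<open>D' (1 \<otimes> proj (gen \<theta>)) = lam \<theta> \<otimes> 1\<close> extension_gen sym_amult)
  qed (simp_all add: hor extension_hor tensor_pure_linear clinear_add[OF lin] clinear_scaleC[OF lin]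
      clinear_add[of extension] clinear_scaleC[of extension] clin)
  have "D' (\<phi> \<otimes> s) = extension (\<phi> \<otimes> s)" for \<phi> s
  proof (induction \<phi> rule: graded_induct[OF hor_graded])
    case (1 n \<phi>)
    then show ?case
      using mult'[OF aff_grade_pure[OF 1], of 1 "1 \<otimes> s"]
      by (simp add: hor extension_hor sym amult_pure_one)
  qed (simp add: tensor_pure_linear clinear_add[OF lin] clinear_add[of extension] clin)
  then have "D' x = extension x" for x
    by (induction x rule: tensor_induct) (simp_all add: clinear_add[OF lin] clinear_add[of extension] clin)
  then show ?thesis by blast
qed

section \<open>Covariance of the extension\<close>

lemma clinear_H [clin]: "clinear k \<Longrightarrow> clinear (\<lambda>x. H (k x))"
  by (rule clinear_comp[OF H_linear])

lemma extension_covariant: "H (extension x) = tensor_map extension id (H x)"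
proof -
  have b: "cbilinear amult" "cbilinear ((*) :: 't \<Rightarrow> 't \<Rightarrow> 't)"
    by (simp_all add: clin)
  let ?m = "tensor_mult amult ((*) :: 't \<Rightarrow> 't \<Rightarrow> 't)"
  have m: "clinear k \<Longrightarrow> clinear (\<lambda>x. ?m (k x) Y)" "clinear k \<Longrightarrow> clinear (\<lambda>x. ?m Y (k x))"
    for k :: "('h \<otimes> 's) \<otimes> 't \<Rightarrow> ('h \<otimes> 's) \<otimes> 't" and Y
    using cbilinear_tensor_mult[OF b] unfolding cbilinear_def
    by (blast intro: clinear_comp[of "\<lambda>X. ?m X Y"] clinear_comp[of "?m Y"])+
  \<comment> \<open>The extension tensored with the identity is again a graded derivation for the
    product in which \<open>H\<close> is multiplicative.\<close>
  have "tensor_map extension id (?m X Y) =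
      ?m (tensor_map extension id X) Y + ?m (tensor_map gradeS id X) (tensor_map extension id Y)" for X Y
    by (rule tensor_linear_eqI2[of "\<lambda>X Y. tensor_map extension id (?m X Y)"])
      (simp_all add: clin m tensor_mult_pure[OF b] extension_amult tensor_pure_linear)
  \<comment> \<open>Covariance passes to a product if \<open>H\<close> also commutes with the
    grading involution at the left factor; this third condition is checked for the generators that
    occur on the left.\<close>
  then have mult: "H (extension (x \<star> y)) = tensor_map extension id (H (x \<star> y))"
    if "H (extension x) = tensor_map extension id (H x)" "H (extension y) = tensor_map extension id (H y)"
      "H (gradeS x) = tensor_map gradeS id (H x)" for x y
    using that by (simp add: extension_amult H_mult clinear_add[OF H_linear])
  have sym: "H (extension (1 \<otimes> s)) = tensor_map extension id (H (1 \<otimes> s))" for s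
  proof (induction s rule: sym_induct)
    case one
    have "extension (1 \<otimes> 1) = 0" by (simp add: extension_hor D_one pure_zero)
    then show ?case
      using clinear_zero[OF H_linear] by (simp add: H_sym hatS_one clin pure_zero)
  next
    case (gen \<theta> s)
    \<comment> \<open>This kills the summand with left leg 1 in the coproduct of a generator; what
      remains matches the covariance of \<open>lam\<close>.\<close>
    have "extension (1 \<otimes> 1) = 0" by (simp add: extension_hor D_one pure_zero)
    then have "H (extension (1 \<otimes> proj (gen \<theta>))) = tensor_map extension id (H (1 \<otimes> proj (gen \<theta>)))"
      by (simp add: extension_gen H_hor lam_covariant H_sym hatS_gen tensor_map_map clin pure_zero)
    moreover have "H (gradeS (1 \<otimes> proj (gen \<theta>))) = tensor_map gradeS id (H (1 \<otimes> proj (gen \<theta>)))"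
      by (simp add: gradeS_pure grade_inv_one H_sym tensor_map_map clin id_def)
    ultimately show ?case
      unfolding sym_amult[symmetric] using gen by (intro mult)
  qed (simp_all add: tensor_pure_linear clinear_add[OF H_linear] clinear_scaleC[OF H_linear]
      clinear_add[of extension] clinear_scaleC[of extension] clin)
  show ?thesis
  proof (rule tensor_linear_eqI[of "\<lambda>x. H (extension x)"])
    fix \<phi> s
    have "H (extension (\<phi> \<otimes> 1)) = tensor_map extension id (H (\<phi> \<otimes> 1))"
      by (simp add: extension_hor H_hor D_covariant tensor_map_map clin)
    moreover have "H (gradeS (\<phi> \<otimes> 1)) = tensor_map gradeS id (H (\<phi> \<otimes> 1))"
      by (simp add: gradeS_pure H_hor Fh_grade_inv tensor_map_map clin)
    ultimately show "H (extension (\<phi> \<otimes> s)) = tensor_map extension id (H (\<phi> \<otimes> s))"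
      unfolding amult_pure_one[of \<phi> s, symmetric] using sym by (intro mult)
  qed (simp_all add: clin)
qed

section \<open>Hermiticity of the extension\<close>

lemma graded_star_mult:
  fixes X Y :: "'h \<otimes> 't"
  assumes "X \<in> aff_grade hor m" "Y \<in> aff_grade hor n"
  shows "star (X * Y) = (- 1) ^ (m * n) *\<^sub>C (star Y * star X)"
proof -
  \<comment> \<open>A single star is antilinear. Starring the reversed product once more gives
    linear maps, to which comparison on spanning sets applies.\<close>
  have s: "clinear (\<lambda>X. star (star Y * star X))" "clinear (\<lambda>Y. star (star Y * star X))"
    for X Y :: "'h \<otimes> 't"
    by (simp_all add: clinear_iff star_add star_scaleC algebra_simps mult_scaleC_left
        mult_scaleC_right)
  have pure: "(x \<otimes> a) * Y = (- 1) ^ (m * n) *\<^sub>C star (star Y * star (x \<otimes> a))" if x: "x \<in> hor m" for x a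
  proof (rule span_linear_eqI[OF assms(2)[unfolded aff_grade_def]])
    fix b assume "b \<in> {\<psi> \<otimes> a | \<psi> (a::'t). \<psi> \<in> hor n}"
    then obtain y c where b: "b = y \<otimes> c" "y \<in> hor n" by blast
    have "star (star y * star x) = (- 1) ^ (n * m) *\<^sub>C (x * y)"
      using star_hor[OF hor_star[OF b(2)] hor_star[OF x]] by (simp add: star_star)
    then show "(x \<otimes> a) * b = (- 1) ^ (m * n) *\<^sub>C star (star b * star (x \<otimes> a))"
      by (simp add: b times_tensor_pure star_tensor_pure star_mult star_star tensor_pure_linear
          scaleC_scaleC mult.commute[of n m] power_add[symmetric] scaleC_one)
  qed (simp_all add: clin s)
  have "X * Y = (- 1) ^ (m * n) *\<^sub>C star (star Y * star X)"
    by (rule span_linear_eqI[OF assms(1)[unfolded aff_grade_def], of "\<lambda>X. X * Y"])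
      (auto simp: clin s pure)
  then have "star (X * Y) = cnj ((- 1) ^ (m * n)) *\<^sub>C (star Y * star X)"
    by (simp add: star_scaleC star_star)
  then show ?thesis by simp
qed

lemma extension_star:
  assumes lam: "\<And>\<theta>. lam (star \<theta>) = star (lam \<theta>)" and D: "\<And>\<phi>. D (star \<phi>) = star (D \<phi>)"
  shows "extension (astar x) = astar (extension x)"
proof -
  have symD: "symD (star s) = star (symD s)" for s
    unfolding symD_def hatS_star by (rule tensor_map_star) (simp_all add: clin sym_one_star lam)
  have symD_deg: "symD s \<in> aff_grade hor 1" for s
  proof -
    have "tensor_map (\<lambda>r. lam (sym_one r)) id t \<in> aff_grade hor 1" for t :: "'s \<otimes> 't"
    proof (induction t rule: tensor_induct)
      case (pure r a)
      show ?case
        using lam_degree by (auto simp: clin intro!: aff_grade_pure)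
    qed (simp add: clin aff_grade_add)
    then show ?thesis by (simp add: symD_def)
  qed
  have "embD (astar (\<phi> \<otimes> s)) = star (embD (\<phi> \<otimes> s))" for \<phi> s
  proof (induction \<phi> rule: graded_induct[OF hor_graded])
    case (1 n \<phi>)
    have "FA \<phi> \<in> aff_grade hor n"
      unfolding FA_def
      by (rule span_linear_mem[OF Fh_graded[OF 1]])
        (auto simp: clin subspace_aff_grade intro!: aff_grade_pure)
    \<comment> \<open>Reversing \<open>FA \<phi>\<close> and the degree-one element
      \<open>symD s\<close> costs the sign \<open>(- 1) ^ n\<close>; it cancels the sign that the
      grading involution puts into \<open>embD\<close>.\<close>
    then have "star (FA \<phi> * symD s) = (- 1) ^ n *\<^sub>C (symD (star s) * FA (star \<phi>))"
      using graded_star_mult[OF _ symD_deg] by (simp add: symD FA_simps)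
    then have "star (embD (\<phi> \<otimes> s)) = iS (star s) * FA (D (star \<phi>)) + symD (star s) * FA (star \<phi>)"
      by (simp add: embD_pure gradeT_FA grade_inv(2)[OF 1] clinear_scaleC[of FA] clin mult_scaleC_left
          star_add star_scaleC star_mult_iS FA_simps(3)[symmetric] D scaleC_scaleC
          power_add[symmetric] scaleC_one)
    then show ?case
      by (simp only: astar_pure embD_amult embD_sym)
        (simp add: embD_pure emb_pure iS_simps(1) FA_simps(1) symD_one gradeT_iS)
  next
    case (2 \<phi> \<psi>)
    then show ?case
      using semilinear_astar
      by (simp add: tensor_pure_linear semilinear_def clinear_add[of embD] clin star_add)
  qed
  then have "embD (astar x) = star (embD x)"
    using semilinear_astar
    by (induction x rule: tensor_induct) (simp_all add: semilinear_def clinear_add[of embD] clin star_add)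
  then show ?thesis
    by (intro emb_inj) (simp add: emb_ext emb_astar)
qed

text \<open>The counit takes the value 1 at the unit of the symmetric algebra, so applying it to the
  second leg recovers \<open>\<phi>\<close>; in particular that unit is not 0.\<close>

lemma pure_one_inj: "\<phi> \<otimes> (1::'s) = \<psi> \<otimes> 1 \<Longrightarrow> \<phi> = \<psi>" for \<phi> \<psi> :: 'h
proof -
  have "tensor_lift (\<lambda>\<phi> s. \<epsilon>' (inS s) *\<^sub>C \<phi>) (\<phi> \<otimes> 1) = \<phi>" for \<phi> :: 'h
    by (simp add: tensor_lift_pure clin inS_simps unital_homD(2)[OF affine.counit_hom] scaleC_one)
  then show "\<phi> \<otimes> (1::'s) = \<psi> \<otimes> 1 \<Longrightarrow> \<phi> = \<psi>" by metis
qed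

lemma astar_hor: "astar (\<phi> \<otimes> 1) = star \<phi> \<otimes> 1"
  by (rule emb_inj) (simp add: emb_astar emb_pure FA_simps iS_simps)

lemma astar_sym: "astar (1 \<otimes> s) = 1 \<otimes> star s"
  by (rule emb_inj) (simp add: emb_astar emb_pure FA_simps iS_simps)

text \<open>For the direct implication, evaluation at \<open>\<phi> \<otimes> 1\<close> and
  \<open>1 \<otimes> proj (gen \<theta>)\<close> suffices: there the extension is given by
  \<open>D\<close> and \<open>lam\<close>, and \<open>pure_one_inj\<close> removes the second
  leg.\<close>

lemma extension_star_iff:
  "(\<forall>x. extension (astar x) = astar (extension x)) \<longleftrightarrow>
    (\<forall>\<theta>. lam (star \<theta>) = star (lam \<theta>)) \<and> (\<forall>\<phi>. D (star \<phi>) = star (D \<phi>))"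
proof (intro iffI conjI allI)
  assume h: "\<forall>x. extension (astar x) = astar (extension x)"
  show "lam (star \<theta>) = star (lam \<theta>)" for \<theta>
  proof (rule pure_one_inj)
    have "star (proj (gen \<theta>)) = proj (gen (star \<theta>))"
      by (simp add: proj_simps(3)[symmetric] star_word)
    then show "lam (star \<theta>) \<otimes> (1::'s) = star (lam \<theta>) \<otimes> 1"
      using h[rule_format, of "1 \<otimes> proj (gen \<theta>)"] by (simp add: astar_sym extension_gen astar_hor)
  qed
  show "D (star \<phi>) = star (D \<phi>)" for \<phi>
    by (rule pure_one_inj) (use h[rule_format, of "\<phi> \<otimes> 1"] in \<open>simp add: astar_hor extension_hor\<close>)
qed (simp add: extension_star)

end

theorem proposition3p2:
  fixes \<Delta> :: "'a::complex_star_algebra_1 \<Rightarrow> 'a \<otimes> 'a"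
    and \<epsilon> :: "'a \<Rightarrow> complex"
    and \<kappa> :: "'a \<Rightarrow> 'a"
    and lmul :: "'a \<Rightarrow> 'p::complex_star_vector \<Rightarrow> 'p"
    and rmul :: "'p \<Rightarrow> 'a \<Rightarrow> 'p"
    and lco :: "'p \<Rightarrow> 'a \<otimes> 'p"
    and rco :: "'p \<Rightarrow> 'p \<otimes> 'a"
    and incl :: "'v::complex_star_vector \<Rightarrow> 'p"
    and coV :: "'v \<Rightarrow> 'v \<otimes> 'a"
    and actV :: "'v \<Rightarrow> 'a \<Rightarrow> 'v"
    and proj :: "'v tensor_algebra \<Rightarrow> 's::complex_star_algebra_1"
    and coS :: "'s \<Rightarrow> 's \<otimes> 'a"
    and actS :: "'s \<Rightarrow> 'a \<Rightarrow> 's"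
    and \<Delta>' :: "'t::complex_star_algebra_1 \<Rightarrow> 't \<otimes> 't"
    and \<epsilon>' :: "'t \<Rightarrow> complex"
    and \<kappa>' :: "'t \<Rightarrow> 't"
    and inA :: "'a \<Rightarrow> 't"
    and inS :: "'s \<Rightarrow> 't"
    and hatS :: "'s \<Rightarrow> 's \<otimes> 't"
    and F :: "'b::complex_star_algebra_1 \<Rightarrow> 'b \<otimes> 'a"
    and inB :: "'b \<Rightarrow> 'h::{complex_algebra_1,complex_star_vector}"
    and hor :: "nat \<Rightarrow> 'h set"
    and Fh :: "'h \<Rightarrow> 'h \<otimes> 'a"
    and dM :: "'h \<Rightarrow> 'h"
    and H :: "('h \<otimes> 's) \<Rightarrow> ('h \<otimes> 's) \<otimes> 't"
    and lam :: "'v \<Rightarrow> 'h"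
    and D :: "'h \<Rightarrow> 'h"
  assumes setting: "affine_horizontal_forms \<Delta> \<epsilon> \<kappa> lmul rmul lco rco incl coV actV proj coS actS
      \<Delta>' \<epsilon>' \<kappa>' inA inS hatS F inB hor Fh dM H"
    and lam_linear: "clinear lam"
    and lam_degree: "range lam \<subseteq> hor 1"
    and lam_covariant: "\<And>\<theta>. Fh (lam \<theta>) = tensor_map lam id (coV \<theta>)"
    and lam_commute: "\<And>\<theta> n \<phi>. \<phi> \<in> hor n \<Longrightarrow> lam \<theta> * \<phi> =
      (- 1) ^ n *\<^sub>C tensor_lift (\<lambda>\<phi>\<^sub>k c\<^sub>k. \<phi>\<^sub>k * lam (actV \<theta> c\<^sub>k)) (Fh \<phi>)"
    and D_antiderivation: "first_order_antiderivation (*) hor D"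
    and D_covariant: "\<And>\<phi>. Fh (D \<phi>) = tensor_map D id (Fh \<phi>)"
  shows "(\<exists>!D'. extends_antiderivation Fh actS hor proj lam D D') \<and>
    (\<forall>D'. extends_antiderivation Fh actS hor proj lam D D' \<longrightarrow>
      (\<forall>x. H (D' x) = tensor_map D' id (H x)) \<and>
      ((\<forall>x. D' (aff_star Fh actS x) = aff_star Fh actS (D' x)) \<longleftrightarrow>
        (\<forall>\<theta>. lam (star \<theta>) = star (lam \<theta>)) \<and> (\<forall>\<phi>. D (star \<phi>) = star (D \<phi>))))"
proof -
  interpret affine_antiderivation \<Delta> \<epsilon> \<kappa> lmul rmul lco rco incl coV actV proj coS actS
    \<Delta>' \<epsilon>' \<kappa>' inA inS hatS F inB hor Fh dM H lam D
    using assms by (simp add: affine_antiderivation_def affine_antiderivation_axioms_def)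
  show ?thesis
    using extends_extension extension_unique extension_covariant extension_star_iff by blast
qed

end
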